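(* Assume that for every $u\in\mathcal D$, $W^u(w)=W^{u(w)}(w)$ for $\nu$-a.e. $w\in\mathbb W$. Let $a,b,c:\mathbb W\to\mathbb R$ be positive measurable functions such that for every $h,k\in H_b$ and $s\in[0,1]$ we have, $\nu$-a.s., $$a\circ W^{sh+(1-s)k}\,e^{-\frac12|sh+(1-s)k|_H^2}\ \ge\ \left(b\circ W^h\,e^{-\frac12|h|_H^2}\right)^s\left(c\circ W^k\,e^{-\frac12|k|_H^2}\right)^{1-s}.$$ Let $d$ be a probability density with respect to $\nu$ such that $h\in H_b\mapsto-\log d\circ W^h$ is $\nu$-a.s. convex and $\mathbb E_\nu[d\,|\,\mathcal F_\tau]=1$, and let $\theta$ be the measure on $\mathbb W$ given by $\frac{d\theta}{d\nu}=d$. Then for every $s\in[0,1]$, almost surely and as an inequality in $\overline{\mathbb R}$, $$\mathbb E_\theta\left[a\,|\,\mathcal F_\tau\right]\ \ge\ \left(\mathbb E_\theta\left[b\,|\,\mathcal F_\tau\right]\right)^s\left(\mathbb E_\theta\left[c\,|\,\mathcal F_\tau\right]\right)^{1-s}.$$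
   Context: $n\ge1$; $\mathbb W=C([0,1],\mathbb R^n)$ with a probability measure $\nu$; $W$ is the coordinate process, $(\mathcal F_t)$ its filtration (all filtrations are completed with respect to $\nu$), $\tau$ a stopping time of $(\mathcal F_t)$. $H=\{\int_0^\cdot\dot h(s)ds:\dot h\in L^2([0,1];\mathbb R^n)\}$, $|h|_H^2=\int_0^1|\dot h(s)|^2ds$. $L^0_a(\nu,H)$ is the set of measurable $u:\mathbb W\to H$ with $\dot u$ $(\mathcal F_t)$-adapted. $\mathcal D=\{u\in L^0_a(\nu,H):\dot u\text{ is } d\nu\times dt\text{-a.s. bounded}\}$. $H_b=\{h\in H:\dot h\text{ is }dt\text{-a.s. bounded}\}$; elements of $H_b$ are regarded as constant (deterministic) elements of $\mathcal D$, and $u(w)\in H_b$ for $\nu$-a.e. $w$ if $u\in\mathcal D$. For $u\in L^0_a(\nu,H)$: $\pi_\tau u=\int_0^\cdot\dot u(s)1_{s\le\tau}ds$. For a $\nu$-Brownian motion $\beta$: $\delta_\beta v=\int_0^1\dot v(s)d\beta(s)$, $\rho(\delta_\beta v)=\exp(\int_0^1\dot v\,d\beta-\frac12\int_0^1|\dot v|^2ds)$. Standing assumption: there are a $\nu$-Brownian motion $\beta$ and adapted processes $(W^u)_{u\in\mathcal D}$ (viewed as maps $\mathbb W\to\mathbb W$) such that: (i) $\beta$ and $W$ have the same filtration; (ii) $W^0=W$; (iii) for $u\in\mathcal D$ the law of $W^u$ under $\tilde\nu^u$, $d\tilde\nu^u=\rho(-\delta_\beta u)d\nu$, equals the law of $W$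 under $\nu$; (iv) $\beta\circ W^u=\beta+u$ for $u\in\mathcal D$; (v) $W^u\circ W^v=W^{v+u\circ W^v}$ $\nu$-a.s. for $u,v\in\mathcal D$; (vi) $(W^u(s\wedge\tau))_{s\le1}=(W^{\pi_\tau u}(s\wedge\tau))_{s\le1}$ for $u\in\mathcal D$. *)

theory Defs
  imports "HOL-Probability.Probability"
begin

section \<open>The path space $C([0,1],R^n)$\<close>

text \<open>Paths are extensional functions on $[0,1]$ (value \<open>undefined\<close> outside), so that equality of
  paths is equality on $[0,1]$. The sigma-algebra generated by the coordinates is the Borel
  sigma-algebra of the uniform norm.\<close>

type_synonym 'n cpath = "real \<Rightarrow> real ^ 'n"

definition path_space :: "'n::finite cpath measure" where
  "path_space = restrict_space (PiM {0..1} (\<lambda>_. borel)) {w. continuous_on {0..1} w}"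

definition path_zero :: "'n::finite cpath" where
  "path_zero = (\<lambda>t\<in>{0..1}. 0)"

definition path_add :: "'n::finite cpath \<Rightarrow> 'n cpath \<Rightarrow> 'n cpath" where
  "path_add h k = (\<lambda>t\<in>{0..1}. h t + k t)"

definition path_conv :: "real \<Rightarrow> 'n::finite cpath \<Rightarrow> 'n cpath \<Rightarrow> 'n cpath" where
  "path_conv s h k = (\<lambda>t\<in>{0..1}. s *\<^sub>R h t + (1 - s) *\<^sub>R k t)"

section \<open>Completed filtrations and Brownian motion\<close>

text \<open>The time index is real, as the time set of a filtration in the library is a type. Only times
  in $[0,1]$ generate, so the filtration is constant from time 1 on.\<close>

definition nat_filtration ::
  "'n::finite cpath measure \<Rightarrow> ('n cpath \<Rightarrow> 'n cpath) \<Rightarrow> real \<Rightarrow> 'n cpath measure" where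
  "nat_filtration \<nu> X t = sigma (space \<nu>)
     ({(\<lambda>w. X w s) -` B \<inter> space \<nu> | s B. s \<in> {0..1} \<and> s \<le> t \<and> B \<in> sets borel}
      \<union> null_sets (completion \<nu>))"

definition coord_process :: "'n::finite cpath \<Rightarrow> 'n cpath" where
  "coord_process w = w"

abbreviation coord_filtration :: "'n::finite cpath measure \<Rightarrow> real \<Rightarrow> 'n cpath measure" where
  "coord_filtration \<nu> \<equiv> nat_filtration \<nu> coord_process"

definition stopped_sigma ::
  "'n::finite cpath measure \<Rightarrow> ('n cpath \<Rightarrow> real) \<Rightarrow> 'n cpath measure" where
  "stopped_sigma \<nu> \<tau> = filtration.pre_sigma (space \<nu>) (coord_filtration \<nu>) \<tau>"

definition brownian_motion ::
  "'n::finite cpath measure \<Rightarrow> ('n cpath \<Rightarrow> 'n cpath) \<Rightarrow> bool" where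
  "brownian_motion \<nu> \<beta> \<longleftrightarrow>
     \<beta> \<in> completion \<nu> \<rightarrow>\<^sub>M path_space \<and>
     (AE w in \<nu>. \<beta> w 0 = 0) \<and>
     (\<forall>s t. 0 \<le> s \<and> s < t \<and> t \<le> 1 \<longrightarrow>
        distributed (completion \<nu>) lborel (\<lambda>w. \<beta> w t - \<beta> w s)
          (\<lambda>x. ennreal (\<Prod>i\<in>UNIV. normal_density 0 (sqrt (t - s)) (x $ i))) \<and>
        prob_space.indep_set (completion \<nu>) (sets (nat_filtration \<nu> \<beta> s))
          {(\<lambda>w. \<beta> w t - \<beta> w s) -` B \<inter> space \<nu> | B. B \<in> sets borel})"

section \<open>The Cameron-Martin space\<close>

definition has_H_deriv :: "'n::finite cpath \<Rightarrow> (real \<Rightarrow> real ^ 'n) \<Rightarrow> bool" where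
  "has_H_deriv h g \<longleftrightarrow>
     g \<in> borel_measurable borel \<and>
     set_integrable lborel {0..1} (\<lambda>s. (norm (g s))\<^sup>2) \<and>
     h = (\<lambda>t\<in>{0..1}. LINT s:{0..t}|lborel. g s)"

definition H_space :: "'n::finite cpath set" where
  "H_space = {h. \<exists>g. has_H_deriv h g}"

text \<open>A version of the derivative; it is unique up to equality almost everywhere on $[0,1]$.\<close>

definition H_deriv :: "'n::finite cpath \<Rightarrow> real \<Rightarrow> real ^ 'n" where
  "H_deriv h = (SOME g. has_H_deriv h g)"

definition H_norm :: "'n::finite cpath \<Rightarrow> real" where
  "H_norm h = sqrt (LINT s:{0..1}|lborel. (norm (H_deriv h s))\<^sup>2)"

definition H_b :: "'n::finite cpath set" where
  "H_b = {h \<in> H_space. \<exists>C. AE s in lborel. s \<in> {0..1} \<longrightarrow> norm (H_deriv h s) \<le> C}"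

definition adapted_H_deriv ::
  "'n::finite cpath measure \<Rightarrow> ('n cpath \<Rightarrow> 'n cpath) \<Rightarrow> ('n cpath \<Rightarrow> real \<Rightarrow> real ^ 'n) \<Rightarrow> bool"
  where
  "adapted_H_deriv \<nu> u v \<longleftrightarrow>
     (\<lambda>(w, s). v w s) \<in> borel_measurable (completion \<nu> \<Otimes>\<^sub>M borel) \<and>
     (\<forall>t\<in>{0..1}. (\<lambda>w. v w t) \<in> borel_measurable (coord_filtration \<nu> t)) \<and>
     (\<forall>w\<in>space \<nu>. has_H_deriv (u w) (v w))"

definition L0a :: "'n::finite cpath measure \<Rightarrow> ('n cpath \<Rightarrow> 'n cpath) set" where
  "L0a \<nu> = {u. u \<in> completion \<nu> \<rightarrow>\<^sub>M path_space \<and> (\<exists>v. adapted_H_deriv \<nu> u v)}"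

definition bounded_drifts :: "'n::finite cpath measure \<Rightarrow> ('n cpath \<Rightarrow> 'n cpath) set" where
  "bounded_drifts \<nu> = {u \<in> L0a \<nu>. \<exists>v C. adapted_H_deriv \<nu> u v \<and>
     (AE (w, s) in completion \<nu> \<Otimes>\<^sub>M lborel. s \<in> {0..1} \<longrightarrow> norm (v w s) \<le> C)}"

definition drift_stop ::
  "('n::finite cpath \<Rightarrow> real) \<Rightarrow> ('n cpath \<Rightarrow> 'n cpath) \<Rightarrow> 'n cpath \<Rightarrow> 'n cpath" where
  "drift_stop \<tau> u w =
     (\<lambda>t\<in>{0..1}. LINT s:{0..t}|lborel. (if s \<le> \<tau> w then H_deriv (u w) s else 0))"

section \<open>The Ito integral and the Girsanov density\<close>

text \<open>An elementary integrand equals \<open>\<xi> i\<close> on the time interval from \<open>t i\<close> (excluded) to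
  \<open>t (Suc i)\<close> (included), for \<open>i < m\<close>.\<close>

definition elementary_integrand ::
  "'n::finite cpath measure \<Rightarrow> nat \<Rightarrow> (nat \<Rightarrow> real) \<Rightarrow> (nat \<Rightarrow> 'n cpath \<Rightarrow> real ^ 'n) \<Rightarrow> bool" where
  "elementary_integrand \<nu> m t \<xi> \<longleftrightarrow>
     t 0 = 0 \<and> t m = 1 \<and> (\<forall>i<m. t i < t (Suc i)) \<and>
     (\<forall>i<m. \<xi> i \<in> borel_measurable (coord_filtration \<nu> (t i)) \<and>
        (\<exists>C. \<forall>w\<in>space \<nu>. norm (\<xi> i w) \<le> C))"

definition elementary_process ::
  "nat \<Rightarrow> (nat \<Rightarrow> real) \<Rightarrow> (nat \<Rightarrow> 'n::finite cpath \<Rightarrow> real ^ 'n) \<Rightarrow> 'n cpath \<Rightarrow> real \<Rightarrow> real ^ 'n"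
  where
  "elementary_process m t \<xi> w s = (\<Sum>i<m. if t i < s \<and> s \<le> t (Suc i) then \<xi> i w else 0)"

definition elementary_integral ::
  "('n::finite cpath \<Rightarrow> 'n cpath) \<Rightarrow> nat \<Rightarrow> (nat \<Rightarrow> real) \<Rightarrow> (nat \<Rightarrow> 'n cpath \<Rightarrow> real ^ 'n) \<Rightarrow>
     'n cpath \<Rightarrow> real" where
  "elementary_integral \<beta> m t \<xi> w = (\<Sum>i<m. \<xi> i w \<bullet> (\<beta> w (t (Suc i)) - \<beta> w (t i)))"

text \<open>The integral over $[0,1]$ of the derivative of \<open>u\<close> against \<open>\<beta>\<close>, as the limit in mean square of
  elementary integrals. It is used for square integrable integrands only, and for a Brownian motion
  \<open>\<beta>\<close> with the filtration of the coordinate process.\<close>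

definition is_ito_integral ::
  "'n::finite cpath measure \<Rightarrow> ('n cpath \<Rightarrow> 'n cpath) \<Rightarrow> ('n cpath \<Rightarrow> 'n cpath) \<Rightarrow>
     ('n cpath \<Rightarrow> real) \<Rightarrow> bool" where
  "is_ito_integral \<nu> \<beta> u I \<longleftrightarrow>
     I \<in> borel_measurable (completion \<nu>) \<and>
     (\<exists>m t \<xi>. (\<forall>k. elementary_integrand \<nu> (m k) (t k) (\<xi> k)) \<and>
        (\<lambda>k. \<integral>\<^sup>+w. (\<integral>\<^sup>+s\<in>{0..1}. ennreal ((norm (elementary_process (m k) (t k) (\<xi> k) w s
                - H_deriv (u w) s))\<^sup>2) \<partial>lborel) \<partial>completion \<nu>) \<longlonglongrightarrow> 0 \<and>
        (\<lambda>k. \<integral>\<^sup>+w. ennreal ((elementary_integral \<beta> (m k) (t k) (\<xi> k) w - I w)\<^sup>2)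
                \<partial>completion \<nu>) \<longlonglongrightarrow> 0)"

definition ito_integral ::
  "'n::finite cpath measure \<Rightarrow> ('n cpath \<Rightarrow> 'n cpath) \<Rightarrow> ('n cpath \<Rightarrow> 'n cpath) \<Rightarrow>
     'n cpath \<Rightarrow> real" where
  "ito_integral \<nu> \<beta> u = (SOME I. is_ito_integral \<nu> \<beta> u I)"

text \<open>This is $\rho(-\delta_\beta u)$; the drift enters with a minus sign.\<close>

definition girsanov_density ::
  "'n::finite cpath measure \<Rightarrow> ('n cpath \<Rightarrow> 'n cpath) \<Rightarrow> ('n cpath \<Rightarrow> 'n cpath) \<Rightarrow>
     'n cpath \<Rightarrow> real" where
  "girsanov_density \<nu> \<beta> u w = exp (- ito_integral \<nu> \<beta> u w - 1/2 * (H_norm (u w))\<^sup>2)"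

section \<open>Perturbations of the coordinate process\<close>

text \<open>\<open>X u\<close> is the process $W^u$. Equalities between processes are meant almost surely. An element
  \<open>h\<close> of \<open>H_b\<close> is regarded as the constant drift \<open>\<lambda>_. h\<close>. Values of \<open>\<tau>\<close> above 1 play the role of infinity.\<close>

locale perturbed_coordinates =
  fixes \<nu> :: "'n::finite cpath measure"
    and \<tau> :: "'n cpath \<Rightarrow> real"
    and \<beta> :: "'n cpath \<Rightarrow> 'n cpath"
    and X :: "('n cpath \<Rightarrow> 'n cpath) \<Rightarrow> 'n cpath \<Rightarrow> 'n cpath"
  assumes prob_space: "prob_space \<nu>"
    and sets_eq: "sets \<nu> = sets path_space"
    and stopping_time: "stopping_time (coord_filtration \<nu>) \<tau>"
    and stopping_time_nonneg: "\<And>w. w \<in> space \<nu> \<Longrightarrow> 0 \<le> \<tau> w"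
    and brownian_motion: "brownian_motion \<nu> \<beta>"
    and X_paths: "\<And>u. u \<in> bounded_drifts \<nu> \<Longrightarrow> X u \<in> completion \<nu> \<rightarrow>\<^sub>M path_space"
    and X_adapted: "\<And>u t. u \<in> bounded_drifts \<nu> \<Longrightarrow> t \<in> {0..1} \<Longrightarrow>
      (\<lambda>w. X u w t) \<in> borel_measurable (coord_filtration \<nu> t)"
    and same_filtration: "\<And>t. t \<in> {0..1} \<Longrightarrow>
      sets (nat_filtration \<nu> \<beta> t) = sets (coord_filtration \<nu> t)"
    and X_zero: "AE w in \<nu>. X (\<lambda>_. path_zero) w = coord_process w"
    and X_law: "\<And>u. u \<in> bounded_drifts \<nu> \<Longrightarrow>
      distr (density (completion \<nu>) (\<lambda>w. ennreal (girsanov_density \<nu> \<beta> u w))) path_space (X u)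
        = distr \<nu> path_space coord_process"
    and X_shift: "\<And>u. u \<in> bounded_drifts \<nu> \<Longrightarrow> AE w in \<nu>. \<beta> (X u w) = path_add (\<beta> w) (u w)"
    and X_comp: "\<And>u v. u \<in> bounded_drifts \<nu> \<Longrightarrow> v \<in> bounded_drifts \<nu> \<Longrightarrow>
      AE w in \<nu>. X u (X v w) = X (\<lambda>w'. path_add (v w') (u (X v w'))) w"
    and X_stop: "\<And>u. u \<in> bounded_drifts \<nu> \<Longrightarrow>
      AE w in \<nu>. \<forall>s\<in>{0..1}. X u w (min s (\<tau> w)) = X (drift_stop \<tau> u) w (min s (\<tau> w))"

section \<open>Extended-valued conventions\<close>

text \<open>Here $x^0 = 1$ also for $x = 0$ and $x = \infty$ (in the library \<open>0 powr 0 = 0\<close>).\<close>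

definition ennreal_powr :: "ennreal \<Rightarrow> real \<Rightarrow> ennreal" where
  "ennreal_powr x s =
     (if s = 0 then 1 else if x = \<infinity> then \<infinity> else ennreal (enn2real x powr s))"

definition neg_log :: "real \<Rightarrow> ereal" where
  "neg_log x = (if x = 0 then \<infinity> else ereal (- ln x))"

text \<open>Almost sure convexity on \<open>H_b\<close> of $h \mapsto f(h,\cdot)$: the exceptional null set may depend on
  \<open>h\<close>, \<open>k\<close> and \<open>s\<close>.\<close>

definition as_convex_on_H_b ::
  "'n::finite cpath measure \<Rightarrow> ('n cpath \<Rightarrow> 'n cpath \<Rightarrow> ereal) \<Rightarrow> bool" where
  "as_convex_on_H_b \<nu> f \<longleftrightarrow>
     (\<forall>h\<in>H_b. \<forall>k\<in>H_b. \<forall>s\<in>{0..1}. AE w in \<nu>.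
        f (path_conv s h k) w \<le> ereal s * f h w + ereal (1 - s) * f k w)"

end

theory Submission
  imports Defs
begin

text \<open>Write \<open>A = a d\<close>, \<open>B = b d\<close>, \<open>C = c d\<close>. Since \<open>E[d | F\<^sub>\<tau>] = 1\<close>, conditional expectations
  under \<open>\<theta>\<close> of \<open>a\<close>, \<open>b\<close>, \<open>c\<close> are those of \<open>A\<close>, \<open>B\<close>, \<open>C\<close> under \<open>\<nu>\<close>; convexity of \<open>- log d\<close>
  gives \<open>A\<close>, \<open>B\<close>, \<open>C\<close> the same inequality as \<open>a\<close>, \<open>b\<close>, \<open>c\<close>, and truncation makes them bounded.
  Up to null sets they are functions of \<open>\<beta>\<close>, and \<open>W\<^sup>h\<close> becomes the translation of \<open>\<beta>\<close> by \<open>h\<close>.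
  For a grid of mesh \<open>1/m\<close>, the increment of \<open>\<beta>\<close> over each grid interval after \<open>\<tau>\<close>, coordinate by
  coordinate, is replaced by an independent Gaussian variable that is then integrated out. By the one-dimensional
  Prekopa-Leindler inequality each such average preserves the translation inequality for the step
  functions on the grid, which at zero translation is the claim for the averaged functions. As \<open>m\<close>
  grows, the iterated averages converge in \<open>L\<^sup>1\<close> to the conditional expectations given \<open>F\<^sub>\<tau>\<close>.\<close>

section \<open>The one-dimensional Prekopa-Leindler inequality\<close>

text \<open>The exceptional null set in the hypothesis depends on the two shifts, so a single path
  cannot be compared with all its translates at once. Hence the one-dimensional inequality is proved
  under an almost-everywhere hypothesis, and Fubini moves the null sets. The hypothesis is used for
  the shifts \<open>(1 - s) y\<close> and \<open>- s y\<close>, whose convex combination vanishes;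
  the quadratic exponents then leave \<open>exp (- s (1 - s) |y|^2 / 2)\<close>. This is also the
  ratio between the geometric mean of two Gaussian densities and the density at the convex
  combination, so averaging over one coordinate reproduces the condition for the others. A grid does
  not see the path between its points. The averages agree with conditional expectations at grid
  times for functions of the grid values; everything else follows by density, since averaging and
  conditioning both contract \<open>L^1\<close>. Rounding \<tau> up to the grid makes each level set
  an event of the corresponding time, so that the averages preserve integrals over events of
  \<open>F\<^sub>\<tau>\<close>.\<close>

lemma emeasure_affine_preimage:
  fixes F :: "real set"
  assumes F: "F \<in> sets borel" and s: "0 < s"
  shows "emeasure lborel {p. (p - t) / s \<in> F} = ennreal s * emeasure lborel F"
proof -
  have m: "{p. (p - t) / s \<in> F} \<in> sets borel"
    using F by measurable
  have "emeasure lborel F = (\<integral>\<^sup>+x. indicator F x \<partial>lborel)"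
    using F by simp
  also have "\<dots> = ennreal (1 / s) * (\<integral>\<^sup>+x. indicator F (- t / s + (1 / s) * x) \<partial>lborel)"
    using s F by (subst nn_integral_real_affine[where c = "1 / s" and t = "- t / s"]) auto
  also have "(\<lambda>x. indicator F (- t / s + (1 / s) * x) :: ennreal) = indicator {p. (p - t) / s \<in> F}"
    by (auto simp: indicator_def fun_eq_iff diff_divide_distrib)
  finally have "emeasure lborel F = ennreal (1 / s) * emeasure lborel {p. (p - t) / s \<in> F}"
    using m by simp
  then show ?thesis
    using s by (simp add: mult.assoc[symmetric] ennreal_mult''[symmetric])
qed

text \<open>A discrete essential supremum: \<open>t\<close> is the last point of a lattice of mesh
  \<open>e\<close> with mass of \<open>F\<close> beyond it. The true supremum would not help, since
  points of \<open>F\<close> can be chosen only off a null set.\<close>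

lemma exists_essential_right_end:
  fixes F :: "real set"
  assumes F: "F \<in> sets borel" "bounded F" "emeasure lborel F > 0" and e: "0 < e"
  shows "\<exists>t. emeasure lborel (F \<inter> {t<..}) > 0 \<and> emeasure lborel (F \<inter> {t + e<..}) = 0"
proof -
  obtain K where K: "F \<subseteq> {-K..K}"
    using F(2) by (auto simp: bounded_iff abs_le_iff) (metis minus_le_iff subsetI atLeastAtMost_iff)
  define P where "P j \<longleftrightarrow> emeasure lborel (F \<inter> {-K - 1 + real j * e<..}) = 0" for j
  have "F \<inter> {-K - 1 + real 0 * e<..} = F" using K by auto
  then have n0: "\<not> P 0" using F(3) by (simp add: P_def)
  obtain j :: nat where j: "2 * K + 1 < real j * e"
    using e ex_less_of_nat_mult by blast
  then have "F \<inter> {-K - 1 + real j * e<..} = {}" using K by force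
  then have "P j" by (simp add: P_def)
  with n0 obtain k where k: "\<not> P k" "P (Suc k)"
    using ex_least_nat_less[of P j] by auto
  show ?thesis
    by (rule exI[of _ "-K - 1 + real k * e"])
       (use k in \<open>auto simp: P_def algebra_simps zero_less_iff_neq_zero\<close>)
qed

lemma exists_essential_left_end:
  fixes F :: "real set"
  assumes F: "F \<in> sets borel" "bounded F" "emeasure lborel F > 0" and e: "0 < e"
  shows "\<exists>t. emeasure lborel (F \<inter> {..<t}) > 0 \<and> emeasure lborel (F \<inter> {..<t - e}) = 0"
proof -
  obtain K where K: "F \<subseteq> {-K..K}"
    using F(2) by (auto simp: bounded_iff abs_le_iff) (metis minus_le_iff subsetI atLeastAtMost_iff)
  define P where "P j \<longleftrightarrow> emeasure lborel (F \<inter> {..<K + 1 - real j * e}) = 0" for j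
  have "F \<inter> {..<K + 1 - real 0 * e} = F" using K by auto
  then have n0: "\<not> P 0" using F(3) by (simp add: P_def)
  obtain j :: nat where j: "2 * K + 1 < real j * e"
    using e ex_less_of_nat_mult by blast
  then have "F \<inter> {..<K + 1 - real j * e} = {}" using K by force
  then have "P j" by (simp add: P_def)
  with n0 obtain k where k: "\<not> P k" "P (Suc k)"
    using ex_least_nat_less[of P j] by auto
  show ?thesis
    by (rule exI[of _ "K + 1 - real k * e"])
       (use k in \<open>auto simp: P_def algebra_simps zero_less_iff_neq_zero\<close>)
qed

lemma AE_exists_in:
  assumes "AE x in M. P x" "emeasure M A > 0"
  shows "\<exists>x\<in>A. P x"
proof (rule ccontr)
  assume "\<not> ?thesis"
  then have "AE x in M. x \<notin> A" using assms(1) by (auto elim: eventually_mono)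
  moreover have "A \<in> sets M" using assms(2) emeasure_notin_sets by fastforce
  ultimately have "emeasure M A = 0" by (simp add: AE_iff_null_sets null_setsD1)
  with assms(2) show False by simp
qed

text \<open>A copy of \<open>s F\<close> translated near the left end of \<open>(1 - s) G\<close> and a copy of \<open>(1 - s) G\<close>
  translated near the right end of \<open>s F\<close> both lie in \<open>H\<close> and hardly overlap.\<close>

lemma brunn_minkowski_AE_bounded:
  fixes F G H :: "real set"
  assumes F: "F \<in> sets borel" "bounded F" "emeasure lborel F > 0"
    and G: "G \<in> sets borel" "bounded G" "emeasure lborel G > 0"
    and H: "H \<in> sets borel" and s: "0 < s" "s < 1"
    and AE: "AE z in lborel. AE y in lborel. y \<in> F \<longrightarrow> z \<in> G \<longrightarrow> s * y + (1 - s) * z \<in> H"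
  shows "ennreal s * emeasure lborel F + ennreal (1 - s) * emeasure lborel G \<le> emeasure lborel H"
proof (rule ennreal_le_epsilon)
  fix e :: real assume e: "0 < e"
  have s': "0 < 1 - s" using s by simp
  obtain t where t: "emeasure lborel (F \<inter> {t<..}) > 0" "emeasure lborel (F \<inter> {t + e<..}) = 0"
    using exists_essential_right_end[OF F e] by blast
  obtain u where u: "emeasure lborel (G \<inter> {..<u}) > 0" "emeasure lborel (G \<inter> {..<u - e}) = 0"
    using exists_essential_left_end[OF G e] by blast
  \<comment> \<open>The hypothesis with its variables exchanged: fixing \<open>z\<close> gives the
    copy of \<open>F\<close>, fixing \<open>y\<close> the copy of \<open>G\<close>, and each fixed
    point must avoid a null set.\<close>
  have AE': "AE y in lborel. AE z in lborel. y \<in> F \<longrightarrow> z \<in> G \<longrightarrow> s * y + (1 - s) * z \<in> H"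
  proof (subst lborel_pair.AE_commute)
    note [measurable] = F(1) G(1) H
    show "{x \<in> space (lborel \<Otimes>\<^sub>M lborel). fst x \<in> F \<longrightarrow> snd x \<in> G \<longrightarrow> s * fst x + (1 - s) * snd x \<in> H}
        \<in> sets (lborel \<Otimes>\<^sub>M lborel)" by measurable
  qed (rule AE)
  obtain z where z: "z \<in> G" "z < u" and zH: "AE y in lborel. y \<in> F \<longrightarrow> s * y + (1 - s) * z \<in> H"
    using AE_exists_in[OF AE u(1)] by auto
  obtain y where y: "y \<in> F" "t < y" and yH: "AE z in lborel. z \<in> G \<longrightarrow> s * y + (1 - s) * z \<in> H"
    using AE_exists_in[OF AE' t(1)] by auto
  \<comment> \<open>Cutting off the null tails changes no measure, but it confines \<open>P\<close>
    to the left of \<open>r\<close> and \<open>Q\<close> to the right of \<open>l\<close> below;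
    \<open>t < y\<close> and \<open>z < u\<close> then give \<open>r - l \<le> e\<close>.\<close>
  define P where "P = {p. (p - (1 - s) * z) / s \<in> F - {t + e<..}}"
  define Q where "Q = {p. (p - s * y) / (1 - s) \<in> G - {..<u - e}}"
  have PQ: "P \<in> sets borel" "Q \<in> sets borel"
    unfolding P_def Q_def using F G by measurable
  have "emeasure lborel (F - {t + e<..}) = emeasure lborel F"
    using emeasure_Diff_null_set[of "F \<inter> {t + e<..}" lborel F] F t(2)
    by (auto simp: Diff_Int null_sets_def)
  then have mP: "emeasure lborel P = ennreal s * emeasure lborel F"
    unfolding P_def using F s by (subst emeasure_affine_preimage) auto
  have "emeasure lborel (G - {..<u - e}) = emeasure lborel G"
    using emeasure_Diff_null_set[of "G \<inter> {..<u - e}" lborel G] G u(2)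
    by (auto simp: Diff_Int null_sets_def)
  then have mQ: "emeasure lborel Q = ennreal (1 - s) * emeasure lborel G"
    unfolding Q_def using G s by (subst emeasure_affine_preimage) auto
  have "AE p in lborel. (- ((1 - s) * z) / s + (1 / s) * p) \<in> F \<longrightarrow>
      s * (- ((1 - s) * z) / s + (1 / s) * p) + (1 - s) * z \<in> H"
    by (rule AE_borel_affine) (use zH s F H in \<open>auto\<close>)
  then have PH: "AE p in lborel. p \<in> P \<longrightarrow> p \<in> H"
    by eventually_elim (use s in \<open>auto simp: P_def diff_divide_distrib right_diff_distrib\<close>)
  have "AE p in lborel. (- (s * y) / (1 - s) + (1 / (1 - s)) * p) \<in> G \<longrightarrow>
      s * y + (1 - s) * (- (s * y) / (1 - s) + (1 / (1 - s)) * p) \<in> H"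
    by (rule AE_borel_affine) (use yH s G H in \<open>auto\<close>)
  then have QH: "AE p in lborel. p \<in> Q \<longrightarrow> p \<in> H"
    by eventually_elim (use s in \<open>auto simp: Q_def diff_divide_distrib right_diff_distrib\<close>)
  define l where "l = s * y + (1 - s) * (u - e)"
  define r where "r = s * (t + e) + (1 - s) * z"
  have "P \<inter> Q \<subseteq> {l..r}"
    using s by (auto simp: P_def Q_def l_def r_def not_less field_simps)
  then have "emeasure lborel (P \<inter> Q) \<le> emeasure lborel {l..r}"
    by (intro emeasure_mono) auto
  also have "\<dots> \<le> ennreal e"
  proof -
    have "s * (t - y) \<le> 0" "(1 - s) * (z - u) \<le> 0"
      using y z s by (auto intro!: mult_nonneg_nonpos)
    then have "r - l \<le> e" by (simp add: l_def r_def algebra_simps)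
    then show ?thesis using e by (cases "l \<le> r") (auto simp: ennreal_leI)
  qed
  finally have I: "emeasure lborel (P \<inter> Q) \<le> ennreal e" .
  have "ennreal s * emeasure lborel F + ennreal (1 - s) * emeasure lborel G
      = emeasure lborel P + emeasure lborel Q" by (simp add: mP mQ)
  also have "\<dots> = emeasure lborel (P \<union> Q) + emeasure lborel (P \<inter> Q)"
    by (rule emeasure_Un_Int) (use PQ in auto)
  also have "\<dots> \<le> emeasure lborel H + ennreal e"
  proof (rule add_mono[OF _ I])
    show "emeasure lborel (P \<union> Q) \<le> emeasure lborel H"
      by (rule emeasure_mono_AE) (use PH QH H in \<open>auto elim: eventually_elim2\<close>)
  qed
  finally show "ennreal s * emeasure lborel F + ennreal (1 - s) * emeasure lborel G
    \<le> emeasure lborel H + ennreal e" .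
qed

text \<open>Both truncations to \<open>[-k, k]\<close> have positive measure for all large
  \<open>k\<close>, which suffices for the limit.\<close>

lemma brunn_minkowski_AE:
  fixes F G H :: "real set"
  assumes F: "F \<in> sets borel" "emeasure lborel F > 0"
    and G: "G \<in> sets borel" "emeasure lborel G > 0"
    and H: "H \<in> sets borel" and s: "0 < s" "s < 1"
    and AE: "AE z in lborel. AE y in lborel. y \<in> F \<longrightarrow> z \<in> G \<longrightarrow> s * y + (1 - s) * z \<in> H"
  shows "ennreal s * emeasure lborel F + ennreal (1 - s) * emeasure lborel G \<le> emeasure lborel H"
proof -
  let ?I = "\<lambda>A (k::nat). A \<inter> {- real k..real k}"
  have lim: "(\<lambda>k. emeasure lborel (?I A k)) \<longlonglongrightarrow> emeasure lborel A" if "A \<in> sets borel" for A :: "real set"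
  proof -
    have "(\<Union>k. ?I A k) = A"
    proof safe
      fix x assume "x \<in> A"
      obtain k where "\<bar>x\<bar> \<le> real k" using real_arch_simple by blast
      then show "x \<in> (\<Union>k. ?I A k)" using \<open>x \<in> A\<close> by (intro UN_I[of k]) auto
    qed
    moreover have "(\<lambda>k. emeasure lborel (?I A k)) \<longlonglongrightarrow> emeasure lborel (\<Union>k. ?I A k)"
      using that by (intro Lim_emeasure_incseq) (auto simp: incseq_def)
    ultimately show ?thesis by simp
  qed
  have "eventually (\<lambda>k. emeasure lborel (?I F k) > 0) sequentially"
    "eventually (\<lambda>k. emeasure lborel (?I G k) > 0) sequentially"
    using order_tendstoD(1)[OF lim] F G by auto
  then have "eventually (\<lambda>k. ennreal s * emeasure lborel (?I F k)
      + ennreal (1 - s) * emeasure lborel (?I G k) \<le> emeasure lborel H) sequentially"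
  proof eventually_elim
    case (elim k)
    show ?case
    proof (rule brunn_minkowski_AE_bounded)
      show "AE z in lborel. AE y in lborel. y \<in> ?I F k \<longrightarrow> z \<in> ?I G k \<longrightarrow> s * y + (1 - s) * z \<in> H"
        using AE by (rule eventually_mono) (auto elim: eventually_mono)
    qed (use elim F G H s in \<open>auto intro: bounded_Int\<close>)
  qed
  moreover have "(\<lambda>k. ennreal s * emeasure lborel (?I F k) + ennreal (1 - s) * emeasure lborel (?I G k))
      \<longlonglongrightarrow> ennreal s * emeasure lborel F + ennreal (1 - s) * emeasure lborel G"
    by (intro tendsto_add tendsto_mult_ennreal tendsto_const lim F G) (use s in auto)
  ultimately show ?thesis
    by (intro tendsto_upperbound[OF _ _ sequentially_bot])
qed

lemma nn_integral_layer_cake: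
  fixes f :: "real \<Rightarrow> real"
  assumes f[measurable]: "f \<in> borel_measurable borel" and nn: "\<And>x. 0 \<le> f x"
  shows "(\<integral>\<^sup>+x. ennreal (f x) \<partial>lborel)
    = (\<integral>\<^sup>+l. indicator {0..} l * emeasure lborel {x. l < f x} \<partial>lborel)"
proof -
  have M: "(\<lambda>(x, l). indicator {0..} l * indicator {x. l < f x} x :: ennreal)
      \<in> borel_measurable (lborel \<Otimes>\<^sub>M lborel)"
  proof -
    have "(\<lambda>(x, l). indicator {0..} l * indicator {x. l < f x} x :: ennreal)
        = (\<lambda>p. indicator {p. 0 \<le> snd p \<and> snd p < f (fst p)} p)"
      by (auto simp: indicator_def fun_eq_iff)
    moreover have "{p \<in> space (borel \<Otimes>\<^sub>M borel). 0 \<le> snd p \<and> snd p < f (fst p)}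
        \<in> sets (borel \<Otimes>\<^sub>M (borel :: real measure))"
      by measurable
    ultimately show ?thesis by (simp add: space_pair_measure)
  qed
  have "(\<integral>\<^sup>+x. ennreal (f x) \<partial>lborel)
      = (\<integral>\<^sup>+x. \<integral>\<^sup>+l. indicator {0..} l * indicator {x. l < f x} x \<partial>lborel \<partial>lborel)"
  proof (rule nn_integral_cong)
    fix x
    have "(\<integral>\<^sup>+l. indicator {0..} l * indicator {x. l < f x} x \<partial>lborel)
      = (\<integral>\<^sup>+l. indicator {0..<f x} l \<partial>lborel)"
      by (rule nn_integral_cong) (auto simp: indicator_def)
    then show "ennreal (f x) = (\<integral>\<^sup>+l. indicator {0..} l * indicator {x. l < f x} x \<partial>lborel)"
      using nn[of x] by simp
  qed
  also have "\<dots> = (\<integral>\<^sup>+l. \<integral>\<^sup>+x. indicator {0..} l * indicator {x. l < f x} x \<partial>lborel \<partial>lborel)"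
    by (rule lborel_pair.Fubini'[OF M, symmetric])
  also have "\<dots> = (\<integral>\<^sup>+l. indicator {0..} l * emeasure lborel {x. l < f x} \<partial>lborel)"
    by (rule nn_integral_cong) (simp add: nn_integral_cmult)
  finally show ?thesis .
qed

lemma weighted_AM_GM:
  fixes x y s :: real
  assumes "0 \<le> x" "0 \<le> y" "0 < s" "s < 1"
  shows "x powr s * y powr (1 - s) \<le> s * x + (1 - s) * y"
  using Youngs_inequality_0[of s "1 - s" x y] assms by (cases "x = 0 \<or> y = 0") auto

text \<open>Brunn-Minkowski needs both level sets to be non-null. After division by the essential
  suprema \<open>a\<close> and \<open>b\<close> this holds at exactly the levels below 1 for both
  functions. Integrating the additive inequality over the levels bounds the arithmetic mean of the
  normalized integrals, and the weighted AM-GM inequality passes to the geometric mean, where the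
  normalization cancels by the choice of \<open>c\<close>.\<close>

theorem prekopa_leindler_AE:
  fixes f g h :: "real \<Rightarrow> real"
  assumes f[measurable]: "integrable lborel f" and g[measurable]: "integrable lborel g"
    and h[measurable]: "integrable lborel h"
    and nn: "\<And>x. 0 \<le> f x" "\<And>x. 0 \<le> g x" "\<And>x. 0 \<le> h x"
    and bdd: "\<And>x. f x \<le> K" "\<And>x. g x \<le> K"
    and s: "0 < s" "s < 1"
    and AE: "AE z in lborel. AE y in lborel. f y powr s * g z powr (1 - s) \<le> h (s * y + (1 - s) * z)"
  shows "(LINT x|lborel. f x) powr s * (LINT x|lborel. g x) powr (1 - s) \<le> (LINT x|lborel. h x)"
proof -
  have [measurable]: "f \<in> borel_measurable borel" "g \<in> borel_measurable borel" "h \<in> borel_measurable borel"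
    using f g h by (auto dest!: borel_measurable_integrable)
  \<comment> \<open>\<open>a\<close> is the essential supremum. The bound \<open>K\<close> makes the
    set \<open>S\<close> of essential bounds nonempty, and its infimum is attained because countably
    many bounds \<open>Inf S + 1 / Suc n\<close> hold simultaneously.\<close>
  have ess: "\<exists>a>0. (AE x in lborel. f x \<le> a) \<and> (\<forall>b<a. emeasure lborel {x. b < f x} > 0)"
    if [measurable]: "f \<in> borel_measurable borel" and nz: "\<not> (AE x in lborel. f x \<le> 0)"
      and bdd: "\<And>x. f x \<le> K" for f :: "real \<Rightarrow> real"
  proof -
    define S where "S = {a. AE x in lborel. f x \<le> a}"
    have pos: "a > 0" if "a \<in> S" for a
    proof (rule ccontr)
      assume "\<not> 0 < a"
      with that have "AE x in lborel. f x \<le> 0" by (auto simp: S_def elim!: eventually_mono)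
      with nz show False by simp
    qed
    have bb: "bdd_below S" using pos by (intro bdd_belowI[of _ 0]) (auto intro: less_imp_le)
    have KS: "K \<in> S" using bdd by (simp add: S_def)
    have "AE x in lborel. \<forall>n::nat. f x \<le> Inf S + 1 / real (Suc n)"
    proof (subst AE_all_countable, rule allI)
      fix n :: nat
      obtain a where a: "a \<in> S" "a < Inf S + 1 / real (Suc n)"
        using cInf_lessD[of S "Inf S + 1 / real (Suc n)"] KS by auto
      then show "AE x in lborel. f x \<le> Inf S + 1 / real (Suc n)"
        unfolding S_def by (auto elim!: eventually_mono)
    qed
    then have "AE x in lborel. f x \<le> Inf S"
    proof eventually_elim
      case (elim x)
      have "(\<lambda>n. Inf S + 1 / real (Suc n)) \<longlonglongrightarrow> Inf S + 0"
        by (intro tendsto_add tendsto_const LIMSEQ_Suc[OF lim_1_over_n])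
      then show ?case using elim by (intro LIMSEQ_le_const[of _ "Inf S"]) auto
    qed
    then have IS: "Inf S \<in> S" by (simp add: S_def)
    moreover have "emeasure lborel {x. b < f x} > 0" if "b < Inf S" for b
    proof (rule ccontr)
      assume "\<not> ?thesis"
      then have "AE x in lborel. x \<notin> {x. b < f x}"
        by (intro AE_not_in) (auto simp: null_sets_def)
      then have "b \<in> S" by (simp add: S_def not_less)
      then show False using cInf_lower[OF _ bb, of b] that by simp
    qed
    ultimately show ?thesis using pos by (intro exI[of _ "Inf S"]) (auto simp: S_def)
  qed
  have zero: "(LINT x|lborel. f x) = 0" if "AE x in lborel. f x \<le> 0" "\<And>x. 0 \<le> f x" for f :: "real \<Rightarrow> real"
    using that by (intro integral_eq_zero_AE) (auto elim!: eventually_mono intro: antisym)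
  show ?thesis
  proof (cases "(AE x in lborel. f x \<le> 0) \<or> (AE x in lborel. g x \<le> 0)")
    case True
    then show ?thesis using zero nn by auto
  next
    case False
    then obtain a b where a: "a > 0" "AE x in lborel. f x \<le> a" "\<And>c. c < a \<Longrightarrow> emeasure lborel {x. c < f x} > 0"
      and b: "b > 0" "AE x in lborel. g x \<le> b" "\<And>c. c < b \<Longrightarrow> emeasure lborel {x. c < g x} > 0"
      using ess[of f, OF _ _ bdd(1)] ess[of g, OF _ _ bdd(2)] by auto
    define c where "c = a powr s * b powr (1 - s)"
    have c: "c > 0" using a b by (simp add: c_def)
    have level: "ennreal s * emeasure lborel {x. l < f x / a} + ennreal (1 - s) * emeasure lborel {x. l < g x / b}
        \<le> emeasure lborel {x. l < h x / c}" if l: "0 < l" "l < 1" for l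
    proof (rule brunn_minkowski_AE[OF _ _ _ _ _ s])
      have "{x. l < f x / a} = {x. l * a < f x}" "{x. l < g x / b} = {x. l * b < g x}"
        using a b by (auto simp: field_simps)
      then show "0 < emeasure lborel {x. l < f x / a}" "0 < emeasure lborel {x. l < g x / b}"
        using a b l by (auto intro!: a(3) b(3))
      show "AE z in lborel. AE y in lborel. y \<in> {x. l < f x / a} \<longrightarrow> z \<in> {x. l < g x / b} \<longrightarrow>
           s * y + (1 - s) * z \<in> {x. l < h x / c}"
        using AE
      proof (rule eventually_mono, elim eventually_mono, safe)
        fix y z assume le: "f y powr s * g z powr (1 - s) \<le> h (s * y + (1 - s) * z)"
          and y: "l < f y / a" and z: "l < g z / b"
        have "l * c = (l * a) powr s * (l * b) powr (1 - s)"
        proof -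
          have "(l * a) powr s * (l * b) powr (1 - s) = (l powr s * l powr (1 - s)) * c"
            using a b l by (simp add: powr_mult c_def)
          also have "l powr s * l powr (1 - s) = l" using l by (simp add: powr_add[symmetric])
          finally show ?thesis by simp
        qed
        also have "\<dots> < f y powr s * g z powr (1 - s)"
        proof -
          have "0 < l * a" "0 < l * b" "l * a < f y" "l * b < g z"
            using a b l y z by (auto simp: pos_less_divide_eq)
          then show ?thesis
            using s by (intro mult_strict_mono powr_less_mono2) auto
        qed
        finally show "l < h (s * y + (1 - s) * z) / c" using le c by (simp add: field_simps)
      qed
    qed auto
    \<comment> \<open>At levels from 1 on both normalized level sets are null, so the left-hand side
      vanishes there.\<close>
    have nz: "emeasure lborel {x. l < f x / a} = 0" if "1 \<le> l" "AE x in lborel. f x \<le> a" "a > 0"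
      "f \<in> borel_measurable borel" for l a and f :: "real \<Rightarrow> real"
    proof -
      have [measurable]: "f \<in> borel_measurable borel" by fact
      have "AE x in lborel. x \<notin> {x. l < f x / a}"
        using that(2)
      proof eventually_elim
        case (elim x)
        then have "f x / a \<le> 1" using that by simp
        then have "\<not> l < f x / a" using that(1) by linarith
        then show ?case by simp
      qed
      then show ?thesis by (subst (asm) AE_iff_null_sets[symmetric]) auto
    qed
    have "ennreal s * (\<integral>\<^sup>+x. ennreal (f x / a) \<partial>lborel) + ennreal (1 - s) * (\<integral>\<^sup>+x. ennreal (g x / b) \<partial>lborel)
       = (\<integral>\<^sup>+l. indicator {0..} l * (ennreal s * emeasure lborel {x. l < f x / a}
            + ennreal (1 - s) * emeasure lborel {x. l < g x / b}) \<partial>lborel)"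
    proof -
      have [measurable]: "(\<lambda>l. emeasure lborel {x. l < f x / a}) \<in> borel_measurable borel"
        if [measurable]: "f \<in> borel_measurable borel" for f :: "real \<Rightarrow> real" and a :: real
      proof -
        have "{p \<in> space (borel \<Otimes>\<^sub>M borel). fst p < f (snd p) / a} \<in> sets (borel \<Otimes>\<^sub>M (borel :: real measure))"
          by measurable
        then have "{p. fst p < f (snd p) / a} \<in> sets (borel \<Otimes>\<^sub>M lborel)"
          by (simp add: space_pair_measure sets_pair_measure_cong[OF refl sets_lborel])
        from lborel.measurable_emeasure_Pair[OF this] show ?thesis by (simp add: vimage_def)
      qed
      show ?thesis
      proof -
        have "(\<integral>\<^sup>+l. indicator {0..} l * (ennreal s * emeasure lborel {x. l < f x / a}
            + ennreal (1 - s) * emeasure lborel {x. l < g x / b}) \<partial>lborel)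
          = (\<integral>\<^sup>+l. ennreal s * (indicator {0..} l * emeasure lborel {x. l < f x / a})
            + ennreal (1 - s) * (indicator {0..} l * emeasure lborel {x. l < g x / b}) \<partial>lborel)"
          by (rule nn_integral_cong) (simp add: distrib_left mult_ac)
        also have "\<dots> = ennreal s * (\<integral>\<^sup>+x. ennreal (f x / a) \<partial>lborel)
            + ennreal (1 - s) * (\<integral>\<^sup>+x. ennreal (g x / b) \<partial>lborel)"
          using a b nn by (subst nn_integral_add; simp add: nn_integral_cmult nn_integral_layer_cake)
        finally show ?thesis ..
      qed
    qed
    also have "\<dots> \<le> (\<integral>\<^sup>+l. indicator {0..} l * emeasure lborel {x. l < h x / c} \<partial>lborel)"
    proof (rule nn_integral_mono_AE)
      have "AE l in lborel. l \<noteq> (0::real)" by (rule AE_lborel_singleton)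
      then show "AE l in lborel. indicator {0..} l * (ennreal s * emeasure lborel {x. l < f x / a}
            + ennreal (1 - s) * emeasure lborel {x. l < g x / b})
          \<le> indicator {0..} l * emeasure lborel {x. l < h x / c}"
      proof eventually_elim
        case (elim l)
        show ?case
          using level[of l] elim a b nz[of l f a] nz[of l g b] by (cases "0 < l"; cases "l < 1") (auto simp: indicator_def)
      qed
    qed
    also have "\<dots> = (\<integral>\<^sup>+x. ennreal (h x / c) \<partial>lborel)"
      using c nn by (subst nn_integral_layer_cake) auto
    finally have "ennreal (s * ((LINT x|lborel. f x) / a) + (1 - s) * ((LINT x|lborel. g x) / b)) \<le> ennreal ((LINT x|lborel. h x) / c)"
      using a b c nn s f g h
      by (simp add: nn_integral_eq_integral ennreal_mult'' ennreal_plus[symmetric] del: ennreal_plus)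
         (simp add: ennreal_mult[symmetric] ennreal_plus[symmetric] del: ennreal_plus)
    then have "s * ((LINT x|lborel. f x) / a) + (1 - s) * ((LINT x|lborel. g x) / b) \<le> (LINT x|lborel. h x) / c"
      using c nn by (subst (asm) ennreal_le_iff) auto
    moreover have "((LINT x|lborel. f x) / a) powr s * ((LINT x|lborel. g x) / b) powr (1 - s)
       \<le> s * ((LINT x|lborel. f x) / a) + (1 - s) * ((LINT x|lborel. g x) / b)"
      by (rule weighted_AM_GM) (use s a b nn in auto)
    ultimately have "((LINT x|lborel. f x) / a) powr s * ((LINT x|lborel. g x) / b) powr (1 - s)
        \<le> (LINT x|lborel. h x) / c" by linarith
    then show ?thesis
      using a b c by (simp add: powr_divide c_def field_simps)
  qed
qed

section \<open>Measurability on the path space\<close>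

lemma space_path_space_iff:
  "x \<in> space path_space \<longleftrightarrow> x \<in> extensional {0..1} \<and> continuous_on {0..1} x"
  by (auto simp: path_space_def space_restrict_space space_PiM PiE_def)

lemma measurable_path_eval:
  assumes "t \<in> {0..1}"
  shows "(\<lambda>x. x t) \<in> borel_measurable path_space"
  unfolding path_space_def using assms
  by (intro measurable_restrict_space1 measurable_component_singleton)

lemma measurable_pathI:
  assumes "\<And>\<omega>. \<omega> \<in> space M \<Longrightarrow> Y \<omega> \<in> space path_space"
    and "\<And>t. t \<in> {0..1} \<Longrightarrow> (\<lambda>\<omega>. Y \<omega> t) \<in> borel_measurable M"
  shows "Y \<in> M \<rightarrow>\<^sub>M path_space"
  unfolding path_space_def
proof (rule measurable_restrict_space2)
  show "Y \<in> space M \<rightarrow> {w. continuous_on {0..1} w}"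
    using assms(1) by (auto simp: space_path_space_iff)
  show "Y \<in> M \<rightarrow>\<^sub>M PiM {0..1} (\<lambda>_. borel)"
    by (rule measurable_PiM_single')
      (use assms in \<open>auto simp: space_path_space_iff PiE_def\<close>)
qed

lemma nat_floor_approx:
  fixes x k :: real
  assumes "0 \<le> x" "0 < k"
  shows "x - 1 / k \<le> real (nat \<lfloor>k * x\<rfloor>) / k" "real (nat \<lfloor>k * x\<rfloor>) / k \<le> x"
proof -
  have "0 \<le> k * x" using assms by simp
  then have "k * x - 1 \<le> real (nat \<lfloor>k * x\<rfloor>)" "real (nat \<lfloor>k * x\<rfloor>) \<le> k * x" by linarith+
  then show "x - 1 / k \<le> real (nat \<lfloor>k * x\<rfloor>) / k" "real (nat \<lfloor>k * x\<rfloor>) / k \<le> x"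
    using assms(2) by (simp_all only: le_divide_eq pos_divide_le_eq left_diff_distrib) (simp_all add: mult.commute)
qed

lemma nat_floor_approx_tendsto:
  fixes x :: real
  assumes "0 \<le> x"
  shows "(\<lambda>k. real (nat \<lfloor>real (Suc k) * x\<rfloor>) / real (Suc k)) \<longlonglongrightarrow> x"
proof (rule tendsto_sandwich)
  show "\<forall>\<^sub>F k in sequentially. x - 1 / real (Suc k) \<le> real (nat \<lfloor>real (Suc k) * x\<rfloor>) / real (Suc k)"
    "\<forall>\<^sub>F k in sequentially. real (nat \<lfloor>real (Suc k) * x\<rfloor>) / real (Suc k) \<le> x"
    using nat_floor_approx[OF assms] by (simp_all del: of_nat_Suc)
  show "(\<lambda>k. x - 1 / real (Suc k)) \<longlonglongrightarrow> x"
    using tendsto_diff[OF tendsto_const LIMSEQ_Suc[OF lim_1_over_n]] by simp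
qed simp

text \<open>Evaluation is jointly measurable in path and time: the time is rounded to countably many
  values, and continuity of the path passes to the limit.\<close>

lemma measurable_path_eval_comp:
  assumes Y: "Y \<in> M \<rightarrow>\<^sub>M path_space" and T[measurable]: "T \<in> borel_measurable M"
    and T01: "\<And>\<omega>. \<omega> \<in> space M \<Longrightarrow> T \<omega> \<in> {0..1}"
  shows "(\<lambda>\<omega>. Y \<omega> (T \<omega>)) \<in> borel_measurable M"
proof (rule borel_measurable_LIMSEQ_metric)
  \<comment> \<open>The rounded times already lie in \<open>[0, 1]\<close>; the clamp is there
    because measurability is checked for every index \<open>i\<close>, also for those that would
    lead to evaluation outside \<open>[0, 1]\<close>.\<close>
  let ?c = "\<lambda>r. max 0 (min 1 r) :: real"
  let ?f = "\<lambda>k \<omega>. Y \<omega> (?c (real (nat \<lfloor>real (Suc k) * T \<omega>\<rfloor>) / real (Suc k)))"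
  have [measurable]: "(\<lambda>\<omega>. Y \<omega> t) \<in> borel_measurable M" if "t \<in> {0..1}" for t
    using measurable_compose[OF Y measurable_path_eval[OF that]] .
  show "?f k \<in> borel_measurable M" for k
  proof (rule measurable_compose_countable[where g = "\<lambda>\<omega>. nat \<lfloor>real (Suc k) * T \<omega>\<rfloor>"])
    show "(\<lambda>\<omega>. Y \<omega> (?c (real i / real (Suc k)))) \<in> borel_measurable M" for i by measurable
    show "(\<lambda>\<omega>. nat \<lfloor>real (Suc k) * T \<omega>\<rfloor>) \<in> M \<rightarrow>\<^sub>M count_space UNIV" by measurable
  qed
  fix \<omega> assume \<omega>: "\<omega> \<in> space M"
  have "(\<lambda>k. real (nat \<lfloor>real (Suc k) * T \<omega>\<rfloor>) / real (Suc k)) \<longlonglongrightarrow> T \<omega>"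
    using T01[OF \<omega>] by (intro nat_floor_approx_tendsto) auto
  then have "(\<lambda>k. ?c (real (nat \<lfloor>real (Suc k) * T \<omega>\<rfloor>) / real (Suc k))) \<longlonglongrightarrow> ?c (T \<omega>)"
    by (intro tendsto_max tendsto_min tendsto_const)
  moreover have "?c (T \<omega>) = T \<omega>" using T01[OF \<omega>] by auto
  moreover have "continuous_on {0..1} (Y \<omega>)"
    using measurable_space[OF Y \<omega>] by (simp add: space_path_space_iff)
  ultimately show "(\<lambda>k. ?f k \<omega>) \<longlonglongrightarrow> Y \<omega> (T \<omega>)"
    by (intro continuous_on_tendsto_compose[of "{0..1}" "Y \<omega>"]) (use T01[OF \<omega>] in auto)
qed

definition path_stop :: "real \<Rightarrow> 'n::finite cpath \<Rightarrow> 'n cpath" where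
  "path_stop t x = (\<lambda>s\<in>{0..1}. x (min s t))"

text \<open>Up to time \<open>t\<close> the bracket vanishes, so this is \<open>x\<close> until
  \<open>t\<close>, continued by the increments of \<open>x'\<close> after \<open>t\<close>.\<close>

definition path_concat :: "real \<Rightarrow> 'n::finite cpath \<Rightarrow> 'n cpath \<Rightarrow> 'n cpath" where
  "path_concat t x x' = (\<lambda>s\<in>{0..1}. x (min s t) + (x' s - x' (min s t)))"

lemma path_stop_apply: "s \<in> {0..1} \<Longrightarrow> path_stop t x s = x (min s t)"
  by (simp add: path_stop_def)

lemma path_concat_apply: "s \<in> {0..1} \<Longrightarrow> path_concat t x x' s = x (min s t) + (x' s - x' (min s t))"
  by (simp add: path_concat_def)

lemma path_add_apply: "s \<in> {0..1} \<Longrightarrow> path_add x h s = x s + h s"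
  by (simp add: path_add_def)

lemma continuous_on_restrict_iff:
  "continuous_on A (restrict f A) \<longleftrightarrow> continuous_on A f"
  by (rule continuous_on_cong) auto

lemma continuous_on_stop:
  assumes "continuous_on {0..1::real} x" "0 \<le> (t::real)"
  shows "continuous_on {0..1} (\<lambda>s. x (min s t))"
  by (rule continuous_on_compose2[OF assms(1)]) (use assms(2) in \<open>auto intro!: continuous_intros\<close>)

lemma path_stop_space: "x \<in> space path_space \<Longrightarrow> 0 \<le> t \<Longrightarrow> path_stop t x \<in> space path_space"
  unfolding space_path_space_iff path_stop_def continuous_on_restrict_iff
  by (simp add: continuous_on_stop)

lemma path_concat_space:
  "x \<in> space path_space \<Longrightarrow> x' \<in> space path_space \<Longrightarrow> 0 \<le> t \<Longrightarrow> path_concat t x x' \<in> space path_space"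
  unfolding space_path_space_iff path_concat_def continuous_on_restrict_iff
  by (simp add: continuous_on_add continuous_on_diff continuous_on_stop)

lemma path_add_space:
  "x \<in> space path_space \<Longrightarrow> continuous_on {0..1} h \<Longrightarrow> path_add x h \<in> space path_space"
  unfolding space_path_space_iff path_add_def continuous_on_restrict_iff
  by (simp add: continuous_on_add)

lemma path_eqI:
  assumes "x \<in> extensional {0..1}" "y \<in> extensional {0..1}" "\<And>s. s \<in> {0..1} \<Longrightarrow> x s = y s"
  shows "x = (y :: 'n::finite cpath)"
  using assms by (intro extensionalityI[of x "{0..1}"])

lemma path_ops_extensional [simp]:
  "path_stop t x \<in> extensional {0..1}" "path_concat t x x' \<in> extensional {0..1}"
  "path_add x h \<in> extensional {0..1}"
  by (auto simp: path_stop_def path_concat_def path_add_def)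

lemma measurable_path_stop:
  assumes Y: "Y \<in> M \<rightarrow>\<^sub>M path_space" and T[measurable]: "T \<in> borel_measurable M"
    and T0: "\<And>\<omega>. \<omega> \<in> space M \<Longrightarrow> 0 \<le> T \<omega>"
  shows "(\<lambda>\<omega>. path_stop (T \<omega>) (Y \<omega>)) \<in> M \<rightarrow>\<^sub>M path_space"
proof (rule measurable_pathI)
  show "\<omega> \<in> space M \<Longrightarrow> path_stop (T \<omega>) (Y \<omega>) \<in> space path_space" for \<omega>
    using measurable_space[OF Y] T0 by (auto intro: path_stop_space)
  show "(\<lambda>\<omega>. path_stop (T \<omega>) (Y \<omega>) t) \<in> borel_measurable M" if "t \<in> {0..1}" for t
    using that T0 by (auto simp: path_stop_apply intro!: measurable_path_eval_comp[OF Y])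
qed

lemma measurable_path_concat:
  assumes Y: "Y \<in> M \<rightarrow>\<^sub>M path_space" and Y': "Y' \<in> M \<rightarrow>\<^sub>M path_space"
    and T[measurable]: "T \<in> borel_measurable M"
    and T0: "\<And>\<omega>. \<omega> \<in> space M \<Longrightarrow> 0 \<le> T \<omega>"
  shows "(\<lambda>\<omega>. path_concat (T \<omega>) (Y \<omega>) (Y' \<omega>)) \<in> M \<rightarrow>\<^sub>M path_space"
proof (rule measurable_pathI)
  show "\<omega> \<in> space M \<Longrightarrow> path_concat (T \<omega>) (Y \<omega>) (Y' \<omega>) \<in> space path_space" for \<omega>
    using measurable_space[OF Y] measurable_space[OF Y'] T0 by (auto intro: path_concat_space)
  show "(\<lambda>\<omega>. path_concat (T \<omega>) (Y \<omega>) (Y' \<omega>) t) \<in> borel_measurable M" if "t \<in> {0..1}" for t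
    using that T0
    by (auto simp: path_concat_apply intro!: measurable_path_eval_comp[OF Y] measurable_path_eval_comp[OF Y']
        borel_measurable_add borel_measurable_diff)
qed

lemma measurable_path_add:
  assumes Y: "Y \<in> M \<rightarrow>\<^sub>M path_space"
    and h: "\<And>t. t \<in> {0..1} \<Longrightarrow> (\<lambda>\<omega>. h \<omega> t) \<in> borel_measurable M"
    and c: "\<And>\<omega>. \<omega> \<in> space M \<Longrightarrow> continuous_on {0..1} (h \<omega>)"
  shows "(\<lambda>\<omega>. path_add (Y \<omega>) (h \<omega>)) \<in> M \<rightarrow>\<^sub>M path_space"
proof (rule measurable_pathI)
  show "\<omega> \<in> space M \<Longrightarrow> path_add (Y \<omega>) (h \<omega>) \<in> space path_space" for \<omega>
    using measurable_space[OF Y] c by (auto intro: path_add_space)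
  show "(\<lambda>\<omega>. path_add (Y \<omega>) (h \<omega>) t) \<in> borel_measurable M" if "t \<in> {0..1}" for t
    using that h measurable_compose[OF Y measurable_path_eval[OF that]]
    by (auto simp: path_add_apply intro!: borel_measurable_add)
qed

text \<open>Open sets are enough to generate, and their indicators are limits of continuous
  functions, which is exploited when convergence of the averages is extended to cylinders. The empty
  \<open>J\<close> gives the whole path space.\<close>

definition path_cylinders :: "'n::finite cpath set set" where
  "path_cylinders = {{x \<in> space path_space. \<forall>t\<in>J. x t \<in> U t} | J U.
     finite J \<and> J \<subseteq> {0..1} \<and> (\<forall>t. open (U t))}"

lemma path_cylinder_measurable:
  assumes "finite J" "J \<subseteq> {0..1}" "\<And>t. U t \<in> sets borel"
  shows "{x \<in> space path_space. \<forall>t\<in>J. x t \<in> U t} \<in> sets (path_space :: 'n::finite cpath measure)"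
proof -
  have "Measurable.pred path_space (\<lambda>x::'n cpath. x t \<in> U t)" if "t \<in> J" for t
    using measurable_sets[OF measurable_path_eval[of t], of "U t"] assms that
    by (auto simp: pred_def vimage_def Int_def conj_commute)
  then show ?thesis
    using assms(1) by (cases "J = {}") (auto intro!: sets.sets_Collect_finite_All' simp: pred_def)
qed

lemma path_cylinders_subset: "path_cylinders \<subseteq> sets path_space"
  by (auto simp: path_cylinders_def intro!: path_cylinder_measurable)

lemma Int_stable_path_cylinders: "Int_stable path_cylinders"
proof (rule Int_stableI)
  fix a b :: "'n::finite cpath set" assume "a \<in> path_cylinders" "b \<in> path_cylinders"
  then obtain J U K V where a: "a = {x \<in> space path_space. \<forall>t\<in>J. x t \<in> U t}" "finite J" "J \<subseteq> {0..1}" "\<forall>t. open (U t)"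
    and b: "b = {x \<in> space path_space. \<forall>t\<in>K. x t \<in> V t}" "finite K" "K \<subseteq> {0..1}" "\<forall>t. open (V t)"
    unfolding path_cylinders_def by blast
  let ?W = "\<lambda>t. (if t \<in> J then U t else UNIV) \<inter> (if t \<in> K then V t else UNIV)"
  have "a \<inter> b = {x \<in> space path_space. \<forall>t\<in>J \<union> K. x t \<in> ?W t}"
    unfolding a b by auto
  then show "a \<inter> b \<in> path_cylinders"
    unfolding path_cylinders_def using a b by (intro CollectI exI[of _ "J \<union> K"] exI[of _ ?W]) auto
qed

lemma sets_path_space:
  "sets (path_space :: 'n::finite cpath measure) = sigma_sets (space path_space) path_cylinders"
proof
  let ?N = "sigma (space path_space) (path_cylinders :: 'n cpath set set)"
  have sub: "path_cylinders \<subseteq> Pow (space (path_space :: 'n cpath measure))"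
    using path_cylinders_subset sets.space_closed by blast
  have "(\<lambda>x. x) \<in> ?N \<rightarrow>\<^sub>M (path_space :: 'n cpath measure)"
  proof (rule measurable_pathI)
    show "(\<lambda>x. x t) \<in> borel_measurable ?N" if t: "t \<in> {0..1}" for t
    proof (rule borel_measurableI)
      fix S :: "(real ^ 'n) set" assume "open S"
      then have "{x \<in> space path_space. \<forall>s\<in>{t}. x s \<in> S} \<in> path_cylinders"
        unfolding path_cylinders_def using t by (intro CollectI exI[of _ "{t}"] exI[of _ "\<lambda>_. S"]) auto
      then show "(\<lambda>x. x t) -` S \<inter> space ?N \<in> sets ?N"
        using sub by (simp add: vimage_def Int_def conj_commute)
    qed
  qed (use sub in \<open>simp add: space_measure_of\<close>)
  from measurable_sets[OF this] show "sets path_space \<subseteq> sigma_sets (space path_space) (path_cylinders :: 'n cpath set set)"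
    using sub sets.sets_into_space by (fastforce simp: Int_absorb1)
next
  show "sigma_sets (space path_space) path_cylinders \<subseteq> sets path_space"
    by (rule sets.sigma_sets_subset[OF path_cylinders_subset])
qed

lemma path_measure_eqI:
  fixes M N :: "'n::finite cpath measure"
  assumes sets: "sets M = sets path_space" "sets N = sets path_space" and fin: "finite_measure M"
    and eq: "\<And>A. A \<in> path_cylinders \<Longrightarrow> emeasure M A = emeasure N A"
  shows "M = N"
proof (rule measure_eqI_generator_eq[where A = "\<lambda>_. space path_space"])
  show "Int_stable (path_cylinders :: 'n cpath set set)" by (rule Int_stable_path_cylinders)
  show "path_cylinders \<subseteq> Pow (space path_space)"
    using path_cylinders_subset sets.space_closed by blast
  show "sets M = sigma_sets (space path_space) path_cylinders"
    "sets N = sigma_sets (space path_space) path_cylinders"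
    using sets by (simp_all add: sets_path_space)
  show "range (\<lambda>_. space path_space) \<subseteq> (path_cylinders :: 'n cpath set set)"
    unfolding path_cylinders_def by (auto intro!: exI[of _ "{}"])
  show "emeasure M (space path_space) \<noteq> \<infinity>"
    using finite_measure.emeasure_finite[OF fin] by simp
qed (use eq in auto)

section \<open>Wiener measure\<close>

definition gauss :: "real \<Rightarrow> (real ^ 'n::finite) measure" where
  "gauss v = density lborel (\<lambda>x. ennreal (\<Prod>i\<in>UNIV. normal_density 0 (sqrt v) (x $ i)))"

lemma sets_gauss [simp, measurable_cong]: "sets (gauss v) = sets borel"
  by (simp add: gauss_def)

lemma space_gauss [simp]: "space (gauss v) = UNIV"
  by (simp add: gauss_def)

text \<open>Completing the square in each component; \<open>c\<close> is a drift rate and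
  \<open>v *\<^sub>R c\<close> the displacement it causes during a time \<open>v\<close>.\<close>

lemma gauss_density_shift:
  fixes z c :: "real ^ 'n::finite"
  assumes "0 < v"
  shows "(\<Prod>i\<in>UNIV. normal_density 0 (sqrt v) ((z - v *\<^sub>R c) $ i)) * exp (- (c \<bullet> (z - v *\<^sub>R c)) - 1/2 * (norm c)\<^sup>2 * v)
    = (\<Prod>i\<in>UNIV. normal_density 0 (sqrt v) (z $ i))"
proof -
  have e: "- (c \<bullet> (z - v *\<^sub>R c)) - 1/2 * (norm c)\<^sup>2 * v = (\<Sum>i\<in>UNIV. 1/2 * (c $ i)\<^sup>2 * v - c $ i * z $ i)"
  proof -
    have "(norm c)\<^sup>2 = (\<Sum>i\<in>UNIV. (c $ i)\<^sup>2)"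
      by (simp only: power2_norm_eq_inner) (simp add: inner_vec_def power2_eq_square)
    moreover have "c \<bullet> z = (\<Sum>i\<in>UNIV. c $ i * z $ i)"
      by (simp add: inner_vec_def)
    moreover have "c \<bullet> (z - v *\<^sub>R c) = c \<bullet> z - v * (norm c)\<^sup>2"
      by (simp add: inner_diff_right power2_norm_eq_inner)
    moreover have "(\<Sum>i\<in>UNIV. 1/2 * (c $ i)\<^sup>2 * v - c $ i * z $ i)
        = (1/2 * v) * (\<Sum>i\<in>UNIV. (c $ i)\<^sup>2) - (\<Sum>i\<in>UNIV. c $ i * z $ i)"
      by (simp add: sum_subtractf sum_distrib_left mult_ac)
    ultimately show ?thesis
      by simp
  qed
  show ?thesis
    unfolding e exp_sum[OF finite] prod.distrib[symmetric]
  proof (rule prod.cong[OF refl])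
    fix i
    have "- ((z $ i - v * c $ i)\<^sup>2) / (2 * v) + (1/2 * (c $ i)\<^sup>2 * v - c $ i * z $ i) = - ((z $ i)\<^sup>2) / (2 * v)"
      using assms by (simp add: field_simps power2_eq_square)
    then show "normal_density 0 (sqrt v) ((z - v *\<^sub>R c) $ i) * exp (1/2 * (c $ i)\<^sup>2 * v - c $ i * z $ i)
      = normal_density 0 (sqrt v) (z $ i)"
      using assms by (simp add: normal_density_def mult.assoc exp_add[symmetric])
  qed
qed

text \<open>The Cameron-Martin formula for a single Gaussian increment, by translation invariance of
  Lebesgue measure.\<close>

lemma nn_integral_gauss_shift:
  fixes c :: "real ^ 'n::finite"
  assumes g[measurable]: "g \<in> borel_measurable borel" and v: "0 < v"
  shows "(\<integral>\<^sup>+z. g (z + v *\<^sub>R c) * ennreal (exp (- (c \<bullet> z) - 1/2 * (norm c)\<^sup>2 * v)) \<partial>gauss v) = (\<integral>\<^sup>+z. g z \<partial>gauss v)"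
proof -
  let ?p = "\<lambda>x::real^'n. \<Prod>i\<in>UNIV. normal_density 0 (sqrt v) (x $ i)"
  have nn: "0 \<le> ?p x" for x by (intro prod_nonneg) auto
  let ?h = "\<lambda>z. g (z + v *\<^sub>R c) * ennreal (?p z * exp (- (c \<bullet> z) - 1/2 * (norm c)\<^sup>2 * v))"
  have "(\<integral>\<^sup>+z. g (z + v *\<^sub>R c) * ennreal (exp (- (c \<bullet> z) - 1/2 * (norm c)\<^sup>2 * v)) \<partial>gauss v) = (\<integral>\<^sup>+z. ?h z \<partial>lborel)"
    unfolding gauss_def by (subst nn_integral_density)
      (auto intro!: nn_integral_cong simp: ennreal_mult[OF nn] mult_ac)
  also have "\<dots> = (\<integral>\<^sup>+z. ?h z \<partial>distr lborel borel ((+) (- v *\<^sub>R c)))"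
    by (subst lborel_distr_plus) simp
  also have "\<dots> = (\<integral>\<^sup>+z. ?h (- v *\<^sub>R c + z) \<partial>lborel)"
    by (rule nn_integral_distr) measurable
  also have "\<dots> = (\<integral>\<^sup>+z. g z * ennreal (?p z) \<partial>lborel)"
  proof (rule nn_integral_cong)
    fix z
    show "?h (- v *\<^sub>R c + z) = g z * ennreal (?p z)"
      using gauss_density_shift[OF v, of z c] by (simp add: algebra_simps)
  qed
  also have "\<dots> = (\<integral>\<^sup>+z. g z \<partial>gauss v)"
    unfolding gauss_def by (subst nn_integral_density) (auto intro!: nn_integral_cong simp: mult_ac)
  finally show ?thesis .
qed

text \<open>The law of a Brownian motion on the path space.  The stopped path \<open>path_stop a x\<close> stands
  for the past of \<open>x\<close> up to time \<open>a\<close>.\<close>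

locale wiener = prob_space \<mu> for \<mu> :: "'n::finite cpath measure" +
  assumes sets_mu [measurable_cong]: "sets \<mu> = sets path_space"
    and start: "AE x in \<mu>. x 0 = 0"
    and markov: "\<And>a b \<Phi>. 0 \<le> a \<Longrightarrow> a < b \<Longrightarrow> b \<le> 1 \<Longrightarrow> \<Phi> \<in> borel_measurable (path_space \<Otimes>\<^sub>M borel) \<Longrightarrow>
      (\<integral>\<^sup>+x. \<Phi> (path_stop a x, x b - x a) \<partial>\<mu>) = (\<integral>\<^sup>+x. \<integral>\<^sup>+z. \<Phi> (path_stop a x, z) \<partial>gauss (b - a) \<partial>\<mu>)"

text \<open>Under \<open>M\<close> with weight \<open>Z\<close>, the increment of \<open>Y\<close> from \<open>a\<close> to \<open>b\<close> is Gaussian and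
  independent of the values of \<open>Y\<close> at finitely many times up to \<open>a\<close>.\<close>

definition gaussian_step :: "'a measure \<Rightarrow> ('a \<Rightarrow> 'n::finite cpath) \<Rightarrow> (real \<Rightarrow> 'a \<Rightarrow> ennreal) \<Rightarrow> real \<Rightarrow> real \<Rightarrow> bool" where
  "gaussian_step M Y Z a b \<longleftrightarrow> (\<forall>J (F :: (real \<Rightarrow> real ^ 'n) \<Rightarrow> ennreal). finite J \<and> J \<subseteq> {0..a} \<and> a \<in> J \<and> F \<in> borel_measurable (PiM (insert b J) (\<lambda>_. borel)) \<longrightarrow>
     (\<integral>\<^sup>+\<omega>. F (restrict (Y \<omega>) (insert b J)) * Z b \<omega> \<partial>M)
     = (\<integral>\<^sup>+\<omega>. (\<integral>\<^sup>+z. F ((restrict (Y \<omega>) J)(b := Y \<omega> a + z)) \<partial>gauss (b - a)) * Z a \<omega> \<partial>M))"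

lemma gaussian_stepD:
  assumes "gaussian_step M Y Z a b" "finite J" "J \<subseteq> {0..a}" "a \<in> J"
    and "F \<in> borel_measurable (PiM (insert b J) (\<lambda>_. borel))"
  shows "(\<integral>\<^sup>+\<omega>. F (restrict (Y \<omega>) (insert b J)) * Z b \<omega> \<partial>M)
     = (\<integral>\<^sup>+\<omega>. (\<integral>\<^sup>+z. F ((restrict (Y \<omega>) J)(b := Y \<omega> a + z)) \<partial>gauss (b - a)) * Z a \<omega> \<partial>M)"
  using assms unfolding gaussian_step_def by simp

context wiener
begin

lemma space_mu: "space \<mu> = space path_space"
  by (rule sets_eq_imp_space_eq[OF sets_mu])

text \<open>No Gaussian integral is computed: total mass 1 is read off from \<open>markov\<close>
  with a constant function, whence the restriction to \<open>v \<le> 1\<close>.\<close>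

lemma prob_space_gauss: "0 < v \<Longrightarrow> v \<le> 1 \<Longrightarrow> prob_space (gauss v :: (real ^ 'n) measure)"
  using markov[of 0 v "\<lambda>_. 1"] by (intro prob_spaceI) (simp add: emeasure_space_1)

lemma restrict_path_measurable:
  assumes "J \<subseteq> {0..1}" "Y \<in> M \<rightarrow>\<^sub>M (path_space :: 'n cpath measure)"
  shows "(\<lambda>\<omega>. restrict (Y \<omega>) J) \<in> M \<rightarrow>\<^sub>M PiM J (\<lambda>_. borel)"
proof (rule measurable_restrict)
  fix t assume "t \<in> J"
  then have "t \<in> {0..1}" using assms(1) by blast
  from measurable_compose[OF assms(2) measurable_path_eval[OF this]]
  show "(\<lambda>\<omega>. Y \<omega> t) \<in> borel_measurable M" .
qed

lemma gaussian_step_mu: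
  assumes ab: "0 \<le> a" "a < b" "b \<le> 1"
  shows "gaussian_step \<mu> (\<lambda>x. x) (\<lambda>_ _. 1) a b"
  unfolding gaussian_step_def
proof (intro allI impI, elim conjE)
  fix J :: "real set" and F :: "(real \<Rightarrow> real ^ 'n) \<Rightarrow> ennreal"
  assume J: "finite J" "J \<subseteq> {0..a}" "a \<in> J"
    and F: "F \<in> borel_measurable (PiM (insert b J) (\<lambda>_. borel :: (real ^ 'n) measure))"
  let ?\<Phi> = "\<lambda>(x, z). F ((restrict x J)(b := x a + z))"
  have J1: "J \<subseteq> {0..1}" using J ab by auto
  have m: "?\<Phi> \<in> borel_measurable (path_space \<Otimes>\<^sub>M borel)"
    unfolding case_prod_beta
    by (rule measurable_compose[OF _ F], rule measurable_fun_upd[where J = J])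
      (use ab in \<open>auto intro!: restrict_path_measurable[OF J1] borel_measurable_add measurable_path_eval_comp\<close>)
  have "(\<integral>\<^sup>+x. F (restrict x (insert b J)) \<partial>\<mu>) = (\<integral>\<^sup>+x. ?\<Phi> (path_stop a x, x b - x a) \<partial>\<mu>)"
  proof (rule nn_integral_cong)
    fix x assume "x \<in> space \<mu>"
    have "restrict x (insert b J) = (restrict (path_stop a x) J)(b := path_stop a x a + (x b - x a))"
      using J J1 ab by (auto simp: fun_eq_iff restrict_def path_stop_def min_def)
    then show "F (restrict x (insert b J)) = ?\<Phi> (path_stop a x, x b - x a)" by simp
  qed
  also have "\<dots> = (\<integral>\<^sup>+x. \<integral>\<^sup>+z. ?\<Phi> (path_stop a x, z) \<partial>gauss (b - a) \<partial>\<mu>)"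
    by (rule markov[OF ab m])
  also have "\<dots> = (\<integral>\<^sup>+x. \<integral>\<^sup>+z. F ((restrict x J)(b := x a + z)) \<partial>gauss (b - a) \<partial>\<mu>)"
  proof (intro nn_integral_cong)
    fix x :: "'n cpath" and z
    have "(restrict (path_stop a x) J)(b := path_stop a x a + z) = (restrict x J)(b := x a + z)"
      using J J1 ab by (auto simp: fun_eq_iff restrict_def path_stop_def min_def)
    then show "?\<Phi> (path_stop a x, z) = F ((restrict x J)(b := x a + z))" by simp
  qed
  finally show "(\<integral>\<^sup>+x. F (restrict x (insert b J)) * 1 \<partial>\<mu>)
    = (\<integral>\<^sup>+x. (\<integral>\<^sup>+z. F ((restrict x J)(b := x a + z)) \<partial>gauss (b - a)) * 1 \<partial>\<mu>)" by simp
qed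

text \<open>Induction on the largest time \<open>b\<close>. The step from the previous time to
  \<open>b\<close> is known to be Gaussian if no point of \<open>D\<close> lies between, which is
  why \<open>J\<close> has to contain the points of \<open>D\<close> up to its maximum.
  \<open>Z t\<close> is the density in force at time \<open>t\<close>, so the weight moves along
  with \<open>Max J\<close>.\<close>

lemma finite_dimensional_laws:
  fixes Y :: "'a \<Rightarrow> 'n cpath"
  assumes Zm: "\<And>t. Z t \<in> borel_measurable M" and Y0: "AE \<omega> in M. Y \<omega> 0 = 0" and Z0: "(\<integral>\<^sup>+\<omega>. Z 0 \<omega> \<partial>M) = 1"
    and step: "\<And>a b. 0 \<le> a \<Longrightarrow> a < b \<Longrightarrow> b \<le> 1 \<Longrightarrow> D \<inter> {a<..<b} = {} \<Longrightarrow> gaussian_step M Y Z a b"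
    and J: "finite J" "J \<subseteq> {0..1}" "0 \<in> J" "\<And>d. d \<in> D \<Longrightarrow> d \<le> Max J \<Longrightarrow> d \<in> J"
    and F: "F \<in> borel_measurable (PiM J (\<lambda>_. borel))"
  shows "(\<integral>\<^sup>+\<omega>. F (restrict (Y \<omega>) J) * Z (Max J) \<omega> \<partial>M) = (\<integral>\<^sup>+x. F (restrict x J) \<partial>\<mu>)"
  using J F
proof (induction J arbitrary: F rule: finite_linorder_max_induct)
  case empty
  then show ?case by simp
next
  case (insert b A)
  show ?case
  proof (cases "A = {}")
    case True
    then have b: "b = 0" using insert by auto
    have "(\<integral>\<^sup>+\<omega>. F (restrict (Y \<omega>) {0}) * Z 0 \<omega> \<partial>M) = (\<integral>\<^sup>+\<omega>. F (\<lambda>t\<in>{0}. 0) * Z 0 \<omega> \<partial>M)"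
    proof (rule nn_integral_cong_AE, use Y0 in eventually_elim)
      case (elim \<omega>)
      then have "restrict (Y \<omega>) {0} = (\<lambda>t\<in>{0}. 0)" by (auto simp: fun_eq_iff)
      then show ?case by simp
    qed
    also have "\<dots> = F (\<lambda>t\<in>{0}. 0)"
    proof -
      have "(\<integral>\<^sup>+\<omega>. F (\<lambda>t\<in>{0}. 0) * Z 0 \<omega> \<partial>M) = F (\<lambda>t\<in>{0}. 0) * (\<integral>\<^sup>+\<omega>. Z 0 \<omega> \<partial>M)"
        by (rule nn_integral_cmult) (rule Zm)
      then show ?thesis using Z0 by simp
    qed
    also have "\<dots> = (\<integral>\<^sup>+x. F (\<lambda>t\<in>{0}. 0) \<partial>\<mu>)" by (simp add: emeasure_space_1)
    also have "\<dots> = (\<integral>\<^sup>+x. F (restrict x {0}) \<partial>\<mu>)"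
    proof (rule nn_integral_cong_AE, use start in eventually_elim)
      case (elim x)
      then have "restrict x {0} = (\<lambda>t\<in>{0}. 0)" by (auto simp: fun_eq_iff)
      then show ?case by simp
    qed
    finally show ?thesis unfolding True b by (simp only: Max_singleton)
  next
    case False
    let ?a = "Max A"
    have a: "?a \<in> A" "?a < b" using False insert.hyps by auto
    have A: "finite A" "A \<subseteq> {0..?a}" using insert.hyps(1) insert.prems(1) by auto
    have b1: "b \<le> 1" "0 \<le> ?a" using insert.prems(1) a(1) by auto
    have A0: "0 \<in> A" using insert.prems(2) b1 a(2) by auto
    have mx: "Max (insert b A) = b" using insert.hyps by (intro Max_eqI) (auto intro: less_imp_le)
    have D: "D \<inter> {?a<..<b} = {}"
    proof -
      have "d \<in> A" if "d \<in> D" "d < b" for d using insert.prems(3)[of d] that mx by auto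
      then show ?thesis using A by fastforce
    qed
    have IH: "(\<integral>\<^sup>+\<omega>. G (restrict (Y \<omega>) A) * Z ?a \<omega> \<partial>M) = (\<integral>\<^sup>+x. G (restrict x A) \<partial>\<mu>)"
      if "G \<in> borel_measurable (PiM A (\<lambda>_. borel))" for G
    proof (rule insert.IH[OF _ A0 _ that])
      show "A \<subseteq> {0..1}" using insert.prems(1) by auto
      show "d \<in> A" if "d \<in> D" "d \<le> ?a" for d
        using insert.prems(3)[of d] that mx a by auto
    qed
    let ?G = "\<lambda>\<eta>. \<integral>\<^sup>+z. F (\<eta>(b := \<eta> ?a + z)) \<partial>gauss (b - ?a)"
    interpret g: prob_space "gauss (b - ?a) :: (real ^ 'n) measure"
      using a b1 by (intro prob_space_gauss) auto
    have G: "?G \<in> borel_measurable (PiM A (\<lambda>_. borel))"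
    proof (rule g.borel_measurable_nn_integral)
      show "(\<lambda>(\<eta>, z). F (\<eta>(b := \<eta> ?a + z))) \<in> borel_measurable (PiM A (\<lambda>_. borel) \<Otimes>\<^sub>M gauss (b - ?a))"
        unfolding case_prod_beta using a(1)
        by (intro measurable_compose[OF _ insert.prems(4)] measurable_fun_upd[where J = A])
          (auto intro!: borel_measurable_add measurable_compose[OF measurable_fst measurable_component_singleton])
    qed
    have ra: "restrict x A ?a = x ?a" for x :: "'n cpath" using a by simp
    have "(\<integral>\<^sup>+\<omega>. F (restrict (Y \<omega>) (insert b A)) * Z b \<omega> \<partial>M) = (\<integral>\<^sup>+\<omega>. ?G (restrict (Y \<omega>) A) * Z ?a \<omega> \<partial>M)"
      using gaussian_stepD[OF step[OF b1(2) a(2) b1(1) D] A a(1) insert.prems(4)] by (simp only: ra)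
    also have "\<dots> = (\<integral>\<^sup>+x. ?G (restrict x A) \<partial>\<mu>)" by (rule IH[OF G])
    also have "\<dots> = (\<integral>\<^sup>+x. F (restrict x (insert b A)) \<partial>\<mu>)"
      using gaussian_stepD[OF gaussian_step_mu[OF b1(2) a(2) b1(1)] A a(1) insert.prems(4)] by (simp only: ra mult_1_right)
    finally show ?thesis unfolding mx .
  qed
qed

lemma law_eqI:
  fixes Y :: "'a \<Rightarrow> 'n cpath"
  assumes Y[measurable]: "Y \<in> M \<rightarrow>\<^sub>M path_space" and Z[measurable]: "\<And>t. Z t \<in> borel_measurable M"
    and Y0: "AE \<omega> in M. Y \<omega> 0 = 0" and Z0: "(\<integral>\<^sup>+\<omega>. Z 0 \<omega> \<partial>M) = 1"
    and step: "\<And>a b. 0 \<le> a \<Longrightarrow> a < b \<Longrightarrow> b \<le> 1 \<Longrightarrow> D \<inter> {a<..<b} = {} \<Longrightarrow> gaussian_step M Y Z a b"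
    and D: "finite D" "D \<subseteq> {0..1}"
  shows "distr (density M (Z 1)) path_space Y = \<mu>"
proof (rule sym, rule path_measure_eqI)
  show "finite_measure \<mu>" by unfold_locales
  fix A assume A: "A \<in> (path_cylinders :: 'n cpath set set)"
  then have Am[measurable]: "A \<in> sets path_space" using path_cylinders_subset by blast
  obtain J U where J: "finite J" "J \<subseteq> {0..1}" and U: "\<And>t. open (U t)"
    and AJ: "A = {x \<in> space path_space. \<forall>t\<in>J. x t \<in> U t}"
    using A unfolding path_cylinders_def by blast
  \<comment> \<open>Adjoining times does not change the cylinder set. The points of \<open>D\<close>
    make every step admissible, and 1 makes the final weight \<open>Z 1\<close>.\<close>
  let ?J = "J \<union> D \<union> {0, 1}"
  let ?F = "\<lambda>\<eta>. indicator {\<eta> \<in> space (PiM ?J (\<lambda>_. borel)). \<forall>t\<in>J. \<eta> t \<in> U t} \<eta> :: ennreal"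
  have F: "?F \<in> borel_measurable (PiM ?J (\<lambda>_. borel :: (real ^ 'n) measure))"
  proof (intro borel_measurable_indicator)
    have "Measurable.pred (PiM ?J (\<lambda>_. borel :: (real ^ 'n) measure)) (\<lambda>\<eta>. \<eta> t \<in> U t)" if "t \<in> J" for t
    proof -
      have [measurable]: "U t \<in> sets borel" using U by auto
      have "(\<lambda>\<eta>. \<eta> t) \<in> PiM ?J (\<lambda>_. borel :: (real ^ 'n) measure) \<rightarrow>\<^sub>M borel"
        using that by (intro measurable_component_singleton) auto
      then show ?thesis by measurable
    qed
    then show "{\<eta> \<in> space (PiM ?J (\<lambda>_. borel :: (real ^ 'n) measure)). \<forall>t\<in>J. \<eta> t \<in> U t} \<in> sets (PiM ?J (\<lambda>_. borel))"
      using J(1) by (cases "J = {}") (auto intro!: sets.sets_Collect_finite_All' simp: pred_def)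
  qed
  have Max: "Max ?J = 1" using J D by (intro Max_eqI) auto
  have ind: "?F (restrict x ?J) = indicator A x" if "x \<in> space path_space" for x
    using that unfolding AJ by (auto simp: indicator_def space_PiM)
  have "emeasure (distr (density M (Z 1)) path_space Y) A = (\<integral>\<^sup>+\<omega>. indicator A (Y \<omega>) * Z 1 \<omega> \<partial>M)"
    by (simp add: nn_integral_indicator[symmetric] nn_integral_distr nn_integral_density mult.commute del: nn_integral_indicator)
  also have "\<dots> = (\<integral>\<^sup>+\<omega>. ?F (restrict (Y \<omega>) ?J) * Z (Max ?J) \<omega> \<partial>M)"
    unfolding Max by (rule nn_integral_cong) (use measurable_space[OF Y] in \<open>simp only: ind\<close>)
  also have "\<dots> = (\<integral>\<^sup>+x. ?F (restrict x ?J) \<partial>\<mu>)"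
    by (rule finite_dimensional_laws[OF Z Y0 Z0 step _ _ _ _ F]) (use J D in auto)
  also have "\<dots> = (\<integral>\<^sup>+x. indicator A x \<partial>\<mu>)"
    by (rule nn_integral_cong) (simp only: ind space_mu)
  finally show "emeasure \<mu> A = emeasure (distr (density M (Z 1)) path_space Y) A"
    using Am by (simp add: sets_mu)
qed (simp_all add: sets_mu)

end

text \<open>The primitive of the indicator function of the interval from \<open>u\<close> to \<open>v\<close>.\<close>

definition ramp :: "real \<Rightarrow> real \<Rightarrow> real \<Rightarrow> real" where
  "ramp u v s = max 0 (min s v - u)"

lemma continuous_on_ramp: "continuous_on A (ramp u v)"
  unfolding ramp_def by (intro continuous_intros)

section \<open>The Cameron-Martin formula for linear ramps\<close>

context wiener
begin

lemma nn_integral_gauss_measurable: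
  assumes "0 < v" "v \<le> 1" "(\<lambda>(x, z). f x z) \<in> borel_measurable (M \<Otimes>\<^sub>M borel)"
  shows "(\<lambda>x. \<integral>\<^sup>+z. f x z \<partial>(gauss v :: (real ^ 'n) measure)) \<in> borel_measurable M"
proof -
  interpret g: prob_space "gauss v :: (real ^ 'n) measure"
    using assms by (intro prob_space_gauss)
  have "(\<lambda>(x, z). f x z) \<in> borel_measurable (M \<Otimes>\<^sub>M gauss v)"
    using assms(3) by (simp cong: measurable_cong_sets sets_pair_measure_cong)
  then show ?thesis by (rule g.borel_measurable_nn_integral)
qed

text \<open>Neither corner of the ramp lies inside the interval, so the drift has a constant rate
  \<open>c\<close> on it, either \<open>q\<close> or 0. The quotient of the weights at
  \<open>b\<close> and \<open>a\<close> is then the density in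
  \<open>nn_integral_gauss_shift\<close>.\<close>

lemma gaussian_step_shift:
  fixes q :: "real ^ 'n"
  assumes uv: "0 \<le> u" "u < v" "v \<le> 1" and ab: "0 \<le> a" "a < b" "b \<le> 1" "{u, v} \<inter> {a<..<b} = {}"
  shows "gaussian_step \<mu> (\<lambda>x. path_add x (\<lambda>s. ramp u v s *\<^sub>R q))
    (\<lambda>t x. ennreal (exp (- (q \<bullet> (x (min (max t u) v) - x u)) - 1/2 * (norm q)\<^sup>2 * ramp u v t))) a b"
    (is "gaussian_step \<mu> ?Y ?Z a b")
  unfolding gaussian_step_def
proof (intro allI impI, elim conjE)
  fix J :: "real set" and F :: "(real \<Rightarrow> real ^ 'n) \<Rightarrow> ennreal"
  assume J: "finite J" "J \<subseteq> {0..a}" "a \<in> J"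
    and F: "F \<in> borel_measurable (PiM (insert b J) (\<lambda>_. borel :: (real ^ 'n) measure))"
  define c where "c = (if u \<le> a \<and> b \<le> v then q else 0)"
  have J1: "J \<subseteq> {0..1}" using J ab by auto
  have cases: "b \<le> u \<or> v \<le> a \<or> (u \<le> a \<and> b \<le> v)" using ab uv by (auto simp: not_less)
  have Yb: "?Y x b = ?Y x a + (x b - x a) + (b - a) *\<^sub>R c" for x
    using cases uv ab by (auto simp: path_add_apply ramp_def c_def algebra_simps min_def max_def)
  have Zb: "?Z b x = ?Z a x * ennreal (exp (- (c \<bullet> (x b - x a)) - 1/2 * (norm c)\<^sup>2 * (b - a)))" for x
  proof -
    consider "b \<le> u" | "v \<le> a" | "u \<le> a" "b \<le> v" using cases by blast
    then have "- (q \<bullet> (x (min (max b u) v) - x u)) - 1/2 * (norm q)\<^sup>2 * ramp u v b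
      = (- (q \<bullet> (x (min (max a u) v) - x u)) - 1/2 * (norm q)\<^sup>2 * ramp u v a)
        + (- (c \<bullet> (x b - x a)) - 1/2 * (norm c)\<^sup>2 * (b - a))"
    proof cases
      case 3
      then have eqs: "min (max b u) v = b" "min (max a u) v = a" "ramp u v a = a - u" "ramp u v b = b - u" "c = q"
        using ab uv by (auto simp: ramp_def c_def)
      show ?thesis unfolding eqs by (simp add: inner_diff_right field_simps)
    qed (use ab uv in \<open>auto simp: ramp_def c_def min_def max_def\<close>)
    then show ?thesis by (simp add: ennreal_mult[symmetric] exp_add[symmetric])
  qed
  have Za: "?Z a (path_stop a x) = ?Z a x" for x
    using uv ab by (auto simp: path_stop_def min_def max_def)
  have Ya: "restrict (?Y (path_stop a x)) J = restrict (?Y x) J" "?Y (path_stop a x) a = ?Y x a" for x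
    using J J1 ab by (auto simp: fun_eq_iff restrict_def path_stop_def path_add_def min_def)
  have Ym: "?Y \<in> path_space \<rightarrow>\<^sub>M path_space"
    by (rule measurable_path_add) (auto intro!: continuous_intros continuous_on_ramp)
  have Zm: "?Z t \<in> borel_measurable path_space" for t
  proof -
    have [measurable]: "(\<lambda>x. x (min (max t u) v)) \<in> borel_measurable (path_space :: 'n cpath measure)"
      "(\<lambda>x. x u) \<in> borel_measurable (path_space :: 'n cpath measure)"
      using uv by (auto intro!: measurable_path_eval)
    show ?thesis by measurable
  qed
  let ?\<Phi> = "\<lambda>(x, z). F ((restrict (?Y x) J)(b := ?Y x a + z + (b - a) *\<^sub>R c))
      * (?Z a x * ennreal (exp (- (c \<bullet> z) - 1/2 * (norm c)\<^sup>2 * (b - a))))"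
  have upd: "(\<lambda>p. F ((restrict (?Y (fst p)) J)(b := ?Y (fst p) a + snd p + d))) \<in> borel_measurable (path_space \<Otimes>\<^sub>M borel)" for d
  proof (intro measurable_compose[OF _ F] measurable_fun_upd[where J = J])
    have Y: "(\<lambda>p. ?Y (fst p)) \<in> path_space \<Otimes>\<^sub>M (borel :: (real ^ 'n) measure) \<rightarrow>\<^sub>M path_space"
      by (rule measurable_compose[OF measurable_fst Ym])
    show "(\<lambda>p. restrict (?Y (fst p)) J) \<in> path_space \<Otimes>\<^sub>M (borel :: (real ^ 'n) measure) \<rightarrow>\<^sub>M PiM J (\<lambda>_. borel)"
      by (rule restrict_path_measurable[OF J1 Y])
    have [measurable]: "(\<lambda>p. ?Y (fst p) a) \<in> borel_measurable (path_space \<Otimes>\<^sub>M (borel :: (real ^ 'n) measure))"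
      using ab by (intro measurable_path_eval_comp[OF Y]) auto
    show "(\<lambda>p. ?Y (fst p) a + snd p + d) \<in> borel_measurable (path_space \<Otimes>\<^sub>M borel)" by measurable
  qed auto
  have m: "?\<Phi> \<in> borel_measurable (path_space \<Otimes>\<^sub>M borel)"
    unfolding case_prod_beta
    by (rule borel_measurable_times_ennreal[OF upd borel_measurable_times_ennreal[OF measurable_compose[OF measurable_fst Zm]]]) measurable
  have "(\<integral>\<^sup>+x. F (restrict (?Y x) (insert b J)) * ?Z b x \<partial>\<mu>) = (\<integral>\<^sup>+x. ?\<Phi> (path_stop a x, x b - x a) \<partial>\<mu>)"
  proof (rule nn_integral_cong)
    fix x assume "x \<in> space \<mu>"
    have "restrict (?Y x) (insert b J) = (restrict (?Y x) J)(b := ?Y x b)"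
      by (auto simp: fun_eq_iff restrict_def)
    then show "F (restrict (?Y x) (insert b J)) * ?Z b x = ?\<Phi> (path_stop a x, x b - x a)"
      unfolding Zb by (simp only: prod.case Ya Za Yb)
  qed
  also have "\<dots> = (\<integral>\<^sup>+x. \<integral>\<^sup>+z. ?\<Phi> (path_stop a x, z) \<partial>gauss (b - a) \<partial>\<mu>)"
    by (rule markov[OF ab(1-3) m])
  also have "\<dots> = (\<integral>\<^sup>+x. (\<integral>\<^sup>+z. F ((restrict (?Y x) J)(b := ?Y x a + z)) \<partial>gauss (b - a)) * ?Z a x \<partial>\<mu>)"
  proof (rule nn_integral_cong)
    fix x assume x: "x \<in> space \<mu>"
    let ?g = "\<lambda>z. F ((restrict (?Y x) J)(b := ?Y x a + z))"
    have "(\<lambda>z. (x, z)) \<in> borel \<rightarrow>\<^sub>M path_space \<Otimes>\<^sub>M (borel :: (real ^ 'n) measure)"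
      using x by (simp add: space_mu)
    from measurable_compose[OF this upd[of 0]] have g: "?g \<in> borel_measurable borel" by simp
    have "(\<integral>\<^sup>+z. ?\<Phi> (path_stop a x, z) \<partial>gauss (b - a))
      = (\<integral>\<^sup>+z. ?Z a x * (?g (z + (b - a) *\<^sub>R c) * ennreal (exp (- (c \<bullet> z) - 1/2 * (norm c)\<^sup>2 * (b - a)))) \<partial>gauss (b - a))"
      by (rule nn_integral_cong) (simp only: prod.case Ya Za, simp add: add.assoc mult_ac)
    also have "\<dots> = ?Z a x * (\<integral>\<^sup>+z. ?g (z + (b - a) *\<^sub>R c) * ennreal (exp (- (c \<bullet> z) - 1/2 * (norm c)\<^sup>2 * (b - a))) \<partial>gauss (b - a))"
      by (rule nn_integral_cmult) (use g in measurable)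
    also have "\<dots> = ?Z a x * (\<integral>\<^sup>+z. ?g z \<partial>gauss (b - a))"
      using nn_integral_gauss_shift[OF g, of "b - a" c] ab by simp
    finally show "(\<integral>\<^sup>+z. ?\<Phi> (path_stop a x, z) \<partial>gauss (b - a)) = (\<integral>\<^sup>+z. ?g z \<partial>gauss (b - a)) * ?Z a x"
      by (simp add: mult.commute)
  qed
  finally show "(\<integral>\<^sup>+x. F (restrict (?Y x) (insert b J)) * ?Z b x \<partial>\<mu>)
      = (\<integral>\<^sup>+x. (\<integral>\<^sup>+z. F ((restrict (?Y x) J)(b := ?Y x a + z)) \<partial>gauss (b - a)) * ?Z a x \<partial>\<mu>)" .
qed

text \<open>Under the weight, the shifted path has Gaussian steps over every interval with neither
  corner time in its interior, and \<open>law_eqI\<close> identifies its law. The sign is that of a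
  Girsanov density: the weight favours paths moving against \<open>q\<close>.\<close>

theorem cameron_martin:
  fixes q :: "real ^ 'n"
  assumes uv: "0 \<le> u" "u < v" "v \<le> 1" and F[measurable]: "F \<in> borel_measurable path_space"
  shows "(\<integral>\<^sup>+x. F (path_add x (\<lambda>s. ramp u v s *\<^sub>R q))
      * ennreal (exp (- (q \<bullet> (x v - x u)) - 1/2 * (norm q)\<^sup>2 * (v - u))) \<partial>\<mu>) = (\<integral>\<^sup>+x. F x \<partial>\<mu>)"
proof -
  let ?Y = "\<lambda>x. path_add x (\<lambda>s. ramp u v s *\<^sub>R q)"
  let ?Z = "\<lambda>t x. ennreal (exp (- (q \<bullet> (x (min (max t u) v) - x u)) - 1/2 * (norm q)\<^sup>2 * ramp u v t))"
  have Y[measurable]: "?Y \<in> \<mu> \<rightarrow>\<^sub>M path_space"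
    by (rule measurable_path_add) (auto intro!: continuous_intros continuous_on_ramp simp: measurable_cong_sets[OF sets_mu refl])
  have Z[measurable]: "?Z t \<in> borel_measurable \<mu>" for t
  proof -
    have [measurable]: "(\<lambda>x. x (min (max t u) v)) \<in> borel_measurable (path_space :: 'n cpath measure)"
      "(\<lambda>x. x u) \<in> borel_measurable (path_space :: 'n cpath measure)"
      using uv by (auto intro!: measurable_path_eval)
    show ?thesis by measurable
  qed
  have "distr (density \<mu> (?Z 1)) path_space ?Y = \<mu>"
  proof (rule law_eqI[where D = "{u, v}" and Z = "?Z"])
    show "AE x in \<mu>. ?Y x 0 = 0"
      using start by eventually_elim (use uv in \<open>auto simp: path_add_apply ramp_def\<close>)
    show "(\<integral>\<^sup>+x. ?Z 0 x \<partial>\<mu>) = 1"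
      using uv by (simp add: ramp_def max_def min_def emeasure_space_1)
    show "?Z t \<in> borel_measurable \<mu>" for t by (rule Z)
    show "gaussian_step \<mu> ?Y ?Z a b" if "0 \<le> a" "a < b" "b \<le> 1" "{u, v} \<inter> {a<..<b} = {}" for a b
      by (rule gaussian_step_shift[OF uv that])
  qed (use uv Y in auto)
  then have "(\<integral>\<^sup>+x. F x \<partial>\<mu>) = (\<integral>\<^sup>+x. F x \<partial>distr (density \<mu> (?Z 1)) path_space ?Y)" by simp
  also have "\<dots> = (\<integral>\<^sup>+x. F (?Y x) \<partial>density \<mu> (?Z 1))"
    by (rule nn_integral_distr) (use Y F in \<open>simp_all\<close>)
  also have "\<dots> = (\<integral>\<^sup>+x. ?Z 1 x * F (?Y x) \<partial>\<mu>)"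
    by (rule nn_integral_density[OF Z]) measurable
  also have "\<dots> = (\<integral>\<^sup>+x. F (?Y x) * ?Z 1 x \<partial>\<mu>)"
    by (simp add: mult.commute)
  finally show ?thesis using uv by (simp add: ramp_def max_def min_def)
qed

text \<open>The interval lies on one side of \<open>t\<close>. Before \<open>t\<close> only
  \<open>x\<close> is seen; after \<open>t\<close> the path \<open>x\<close> is frozen and the
  Markov property of \<open>x'\<close> applies.\<close>

lemma gaussian_step_concat:
  assumes t: "0 \<le> t" "t \<le> 1" and ab: "0 \<le> a" "a < b" "b \<le> 1" "{t} \<inter> {a<..<b} = {}"
  shows "gaussian_step (\<mu> \<Otimes>\<^sub>M \<mu>) (\<lambda>(x, x'). path_concat t x x') (\<lambda>_ _. 1) a b"
  unfolding gaussian_step_def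
proof (intro allI impI, elim conjE)
  interpret P: pair_prob_space \<mu> \<mu> ..
  fix J :: "real set" and F :: "(real \<Rightarrow> real ^ 'n) \<Rightarrow> ennreal"
  assume J: "finite J" "J \<subseteq> {0..a}" "a \<in> J"
    and F: "F \<in> borel_measurable (PiM (insert b J) (\<lambda>_. borel :: (real ^ 'n) measure))"
  let ?Y = "\<lambda>p. path_concat t (fst p) (snd p)"
  have J1: "J \<subseteq> {0..1}" "insert b J \<subseteq> {0..1}" using J ab by auto
  have Y: "?Y \<in> \<mu> \<Otimes>\<^sub>M \<mu> \<rightarrow>\<^sub>M path_space"
    by (rule measurable_path_concat) (use t in auto)
  have m1: "(\<lambda>p. F (restrict (?Y p) (insert b J))) \<in> borel_measurable (\<mu> \<Otimes>\<^sub>M \<mu>)"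
    by (intro measurable_compose[OF _ F] restrict_path_measurable Y) (use J1 in auto)
  have m2: "(\<lambda>(p, z). F ((restrict (?Y p) J)(b := ?Y p a + z))) \<in> borel_measurable ((\<mu> \<Otimes>\<^sub>M \<mu>) \<Otimes>\<^sub>M borel)"
    unfolding case_prod_beta using ab
    by (intro measurable_compose[OF _ F] measurable_fun_upd[where J = J])
      (auto intro!: restrict_path_measurable[OF J1(1)] borel_measurable_add measurable_path_eval_comp
        measurable_compose[OF measurable_fst Y])
  have m3: "(\<lambda>p. \<integral>\<^sup>+z. F ((restrict (?Y p) J)(b := ?Y p a + z)) \<partial>gauss (b - a)) \<in> borel_measurable (\<mu> \<Otimes>\<^sub>M \<mu>)"
    by (rule nn_integral_gauss_measurable[OF _ _ m2]) (use ab in auto)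
  have "(\<integral>\<^sup>+p. F (restrict (?Y p) (insert b J)) \<partial>(\<mu> \<Otimes>\<^sub>M \<mu>))
    = (\<integral>\<^sup>+p. \<integral>\<^sup>+z. F ((restrict (?Y p) J)(b := ?Y p a + z)) \<partial>gauss (b - a) \<partial>(\<mu> \<Otimes>\<^sub>M \<mu>))"
  proof (cases "b \<le> t")
    case True
    have eq: "restrict (path_concat t x x') (insert b J) = restrict x (insert b J)"
       "restrict (path_concat t x x') J = restrict x J" "path_concat t x x' a = x a" for x x' :: "'n cpath"
      using True J J1 ab by (auto simp: fun_eq_iff restrict_def path_concat_def min_def)
    have "(\<integral>\<^sup>+p. F (restrict (?Y p) (insert b J)) \<partial>(\<mu> \<Otimes>\<^sub>M \<mu>)) = (\<integral>\<^sup>+x. F (restrict x (insert b J)) \<partial>\<mu>)"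
      by (subst nn_integral_fst[symmetric, OF m1]) (simp add: eq emeasure_space_1)
    also have "\<dots> = (\<integral>\<^sup>+x. \<integral>\<^sup>+z. F ((restrict x J)(b := x a + z)) \<partial>gauss (b - a) \<partial>\<mu>)"
      using gaussian_stepD[OF gaussian_step_mu[OF ab(1-3)] J F] by simp
    also have "\<dots> = (\<integral>\<^sup>+p. \<integral>\<^sup>+z. F ((restrict (?Y p) J)(b := ?Y p a + z)) \<partial>gauss (b - a) \<partial>(\<mu> \<Otimes>\<^sub>M \<mu>))"
      by (subst nn_integral_fst[symmetric, OF m3]) (simp add: eq emeasure_space_1)
    finally show ?thesis .
  next
    case False
    then have ta: "t \<le> a" using ab by auto
    show ?thesis
    proof (subst (1 2) nn_integral_fst[symmetric], rule m3, rule m1, rule nn_integral_cong)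
      fix x assume x: "x \<in> space \<mu>"
      let ?\<Phi> = "\<lambda>(x', z). F ((restrict (path_concat t x x') J)(b := path_concat t x x' a + z))"
      have "(\<lambda>p. ((x, fst p), snd p)) \<in> path_space \<Otimes>\<^sub>M borel \<rightarrow>\<^sub>M (\<mu> \<Otimes>\<^sub>M \<mu>) \<Otimes>\<^sub>M (borel :: (real ^ 'n) measure)"
        using x by (intro measurable_Pair measurable_const) (auto simp: measurable_cong_sets[OF refl sets_mu])
      from measurable_compose[OF this m2] have \<Phi>m: "?\<Phi> \<in> borel_measurable (path_space \<Otimes>\<^sub>M borel)"
        by (simp add: case_prod_beta)
      have st: "restrict (path_concat t x (path_stop a x')) J = restrict (path_concat t x x') J"
        "path_concat t x (path_stop a x') a = path_concat t x x' a" for x'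
        using ta J J1 ab t by (auto simp: fun_eq_iff restrict_def path_concat_def path_stop_def min_def)
      have "(\<integral>\<^sup>+x'. F (restrict (path_concat t x x') (insert b J)) \<partial>\<mu>) = (\<integral>\<^sup>+x'. ?\<Phi> (path_stop a x', x' b - x' a) \<partial>\<mu>)"
      proof (rule nn_integral_cong)
        fix x' assume "x' \<in> space \<mu>"
        have "restrict (path_concat t x x') (insert b J) = (restrict (path_concat t x x') J)(b := path_concat t x x' a + (x' b - x' a))"
          using ta J J1 ab t by (auto simp: fun_eq_iff restrict_def path_concat_def min_def)
        then show "F (restrict (path_concat t x x') (insert b J)) = ?\<Phi> (path_stop a x', x' b - x' a)"
          by (simp only: prod.case st)
      qed
      also have "\<dots> = (\<integral>\<^sup>+x'. \<integral>\<^sup>+z. ?\<Phi> (path_stop a x', z) \<partial>gauss (b - a) \<partial>\<mu>)"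
        by (rule markov[OF ab(1-3) \<Phi>m])
      finally show "(\<integral>\<^sup>+x'. F (restrict (?Y (x, x')) (insert b J)) \<partial>\<mu>)
        = (\<integral>\<^sup>+x'. \<integral>\<^sup>+z. F ((restrict (?Y (x, x')) J)(b := ?Y (x, x') a + z)) \<partial>gauss (b - a) \<partial>\<mu>)"
        by (simp only: prod.case st fst_conv snd_conv)
    qed
  qed
  then show "(\<integral>\<^sup>+p. F (restrict (case p of (x, x') \<Rightarrow> path_concat t x x') (insert b J)) * 1 \<partial>(\<mu> \<Otimes>\<^sub>M \<mu>))
    = (\<integral>\<^sup>+p. (\<integral>\<^sup>+z. F ((restrict (case p of (x, x') \<Rightarrow> path_concat t x x') J)(b := (case p of (x, x') \<Rightarrow> path_concat t x x') a + z))
        \<partial>gauss (b - a)) * 1 \<partial>(\<mu> \<Otimes>\<^sub>M \<mu>))"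
    by (simp add: case_prod_beta)
qed

text \<open>Integrating out the second path therefore yields a conditional expectation given the
  first path up to \<open>t\<close>.\<close>

lemma distr_concat:
  assumes t: "0 \<le> t" "t \<le> 1"
  shows "distr (\<mu> \<Otimes>\<^sub>M \<mu>) path_space (\<lambda>(x, x'). path_concat t x x') = \<mu>"
proof -
  interpret P: pair_prob_space \<mu> \<mu> ..
  have Y: "(\<lambda>(x, x'). path_concat t x x') \<in> \<mu> \<Otimes>\<^sub>M \<mu> \<rightarrow>\<^sub>M path_space"
    unfolding case_prod_beta by (rule measurable_path_concat) (use t in auto)
  have "distr (density (\<mu> \<Otimes>\<^sub>M \<mu>) (\<lambda>_. 1)) path_space (\<lambda>(x, x'). path_concat t x x') = \<mu>"
  proof (rule law_eqI[where D = "{t}" and Z = "\<lambda>_ _. 1", OF Y])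
    have "AE p in \<mu> \<Otimes>\<^sub>M \<mu>. fst p 0 = 0"
    proof (rule P.AE_pair_measure)
      have "(\<lambda>p. fst p 0) \<in> borel_measurable (\<mu> \<Otimes>\<^sub>M \<mu>)"
        using measurable_compose[OF measurable_fst measurable_path_eval[of 0]]
        by (simp cong: measurable_cong_sets sets_pair_measure_cong add: sets_mu)
      then show "{p \<in> space (\<mu> \<Otimes>\<^sub>M \<mu>). fst p 0 = 0} \<in> sets (\<mu> \<Otimes>\<^sub>M \<mu>)" by measurable
    qed (use start in auto)
    then show "AE p in \<mu> \<Otimes>\<^sub>M \<mu>. (case p of (x, x') \<Rightarrow> path_concat t x x') 0 = 0"
      by eventually_elim (use t in \<open>auto simp: path_concat_apply min_def\<close>)
    show "(\<integral>\<^sup>+p. 1 \<partial>(\<mu> \<Otimes>\<^sub>M \<mu>)) = 1" by (simp add: P.emeasure_space_1)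
  qed (use t gaussian_step_concat[OF t] in auto)
  then show ?thesis by (simp add: density_1)
qed

end

section \<open>Averaging over the grid directions\<close>

text \<open>The substitution \<open>y = z + w\<close>, \<open>p = z + s w\<close> turns the convex
  combination of \<open>y\<close> and \<open>z\<close> into \<open>p\<close>. In this form the
  hypothesis is an inequality for almost every displacement \<open>w\<close>, which is how
  translations of a path supply it; Fubini is needed to return to almost every pair
  \<open>(y, z)\<close>.\<close>

theorem prekopa_leindler_directions:
  fixes f g h :: "real \<Rightarrow> real"
  assumes f: "integrable lborel f" and g: "integrable lborel g" and h: "integrable lborel h"
    and nn: "\<And>x. 0 \<le> f x" "\<And>x. 0 \<le> g x" "\<And>x. 0 \<le> h x"
    and bdd: "\<And>x. f x \<le> K" "\<And>x. g x \<le> K"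
    and s: "0 < s" "s < 1"
    and AE: "AE w in lborel. AE p in lborel. f (p + (1 - s) * w) powr s * g (p - s * w) powr (1 - s) \<le> h p"
  shows "(LINT x|lborel. f x) powr s * (LINT x|lborel. g x) powr (1 - s) \<le> (LINT x|lborel. h x)"
proof (rule prekopa_leindler_AE[OF f g h nn bdd s])
  have [measurable]: "f \<in> borel_measurable borel" "g \<in> borel_measurable borel" "h \<in> borel_measurable borel"
    using f g h by (auto dest!: borel_measurable_integrable)
  have AE1: "AE w in lborel. AE z in lborel. f (z + w) powr s * g z powr (1 - s) \<le> h (s * (z + w) + (1 - s) * z)"
    using AE
  proof (rule eventually_mono)
    fix w assume AEp: "AE p in lborel. f (p + (1 - s) * w) powr s * g (p - s * w) powr (1 - s) \<le> h p"
    have AEz: "AE z in lborel. f ((s * w + 1 * z) + (1 - s) * w) powr s * g ((s * w + 1 * z) - s * w) powr (1 - s) \<le> h (s * w + 1 * z)"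
      by (rule AE_borel_affine[OF _ _ AEp]) (simp, measurable)
    show "AE z in lborel. f (z + w) powr s * g z powr (1 - s) \<le> h (s * (z + w) + (1 - s) * z)"
      using AEz
    proof (rule eventually_mono)
      fix z assume z: "f ((s * w + 1 * z) + (1 - s) * w) powr s * g ((s * w + 1 * z) - s * w) powr (1 - s) \<le> h (s * w + 1 * z)"
      have e1: "(s * w + 1 * z) + (1 - s) * w = z + w" "(s * w + 1 * z) - s * w = z"
        and e2: "s * w + 1 * z = s * (z + w) + (1 - s) * z" by (simp_all add: algebra_simps)
      from z have "f (z + w) powr s * g z powr (1 - s) \<le> h (s * w + 1 * z)" by (simp only: e1)
      then show "f (z + w) powr s * g z powr (1 - s) \<le> h (s * (z + w) + (1 - s) * z)" unfolding e2 .
    qed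
  qed
  have meas: "{x \<in> space (lborel \<Otimes>\<^sub>M lborel). f (fst x + snd x) powr s * g (fst x) powr (1 - s)
        \<le> h (s * (fst x + snd x) + (1 - s) * fst x)} \<in> sets (lborel \<Otimes>\<^sub>M lborel)"
  proof (rule borel_measurable_le)
    have [measurable]: "(\<lambda>x. f (fst x + snd x)) \<in> borel_measurable (lborel \<Otimes>\<^sub>M lborel)"
      by (rule measurable_compose[where g = f and N = borel]) measurable
    have [measurable]: "(\<lambda>x. g (fst x)) \<in> borel_measurable (lborel \<Otimes>\<^sub>M (lborel :: real measure))"
      by (rule measurable_compose[where g = g and N = borel]) measurable
    show "(\<lambda>x. f (fst x + snd x) powr s * g (fst x) powr (1 - s)) \<in> borel_measurable (lborel \<Otimes>\<^sub>M lborel)"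
      by measurable
    show "(\<lambda>x. h (s * (fst x + snd x) + (1 - s) * fst x)) \<in> borel_measurable (lborel \<Otimes>\<^sub>M lborel)"
      by (rule measurable_compose[where g = h and N = borel]) measurable
  qed
  from lborel_pair.AE_commute[where P = "\<lambda>z w. f (z + w) powr s * g z powr (1 - s) \<le> h (s * (z + w) + (1 - s) * z)", OF meas] AE1
  have "AE z in lborel. AE w in lborel. f (z + w) powr s * g z powr (1 - s) \<le> h (s * (z + w) + (1 - s) * z)"
    by (rule iffD2)
  then show "AE z in lborel. AE y in lborel. f y powr s * g z powr (1 - s) \<le> h (s * y + (1 - s) * z)"
  proof (rule eventually_mono)
    fix z assume AEw: "AE w in lborel. f (z + w) powr s * g z powr (1 - s) \<le> h (s * (z + w) + (1 - s) * z)"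
    have "AE y in lborel. f (z + (- z + 1 * y)) powr s * g z powr (1 - s) \<le> h (s * (z + (- z + 1 * y)) + (1 - s) * z)"
    proof (rule AE_borel_affine[OF _ _ AEw])
      have [measurable]: "(\<lambda>w. f (z + w)) \<in> borel_measurable borel"
        by (rule measurable_compose[where g = f and N = borel]) measurable
      show "Measurable.pred borel (\<lambda>w. f (z + w) powr s * g z powr (1 - s) \<le> h (s * (z + w) + (1 - s) * z))"
        unfolding pred_def
      proof (rule borel_measurable_le)
        show "(\<lambda>w. f (z + w) powr s * g z powr (1 - s)) \<in> borel_measurable borel" by measurable
        show "(\<lambda>w. h (s * (z + w) + (1 - s) * z)) \<in> borel_measurable borel"
          by (rule measurable_compose[where g = h and N = borel]) measurable
      qed
    qed simp
    then show "AE y in lborel. f y powr s * g z powr (1 - s) \<le> h (s * y + (1 - s) * z)" by simp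
  qed
qed

section \<open>Resampling a single grid coordinate\<close>

abbreviation std_normal :: "real measure" where
  "std_normal \<equiv> density lborel std_normal_density"

lemma prob_space_std_normal: "prob_space std_normal"
  by (rule prob_space_normal_density) simp

abbreviation grid :: "nat \<Rightarrow> nat \<Rightarrow> real" where
  "grid m j \<equiv> real j / real m"

text \<open>The directions \<open>dir m k\<close> are orthonormal in the Cameron-Martin space, and \<open>coef m k\<close> are the
  corresponding coordinates.\<close>

definition dir :: "nat \<Rightarrow> nat \<times> 'n \<Rightarrow> real \<Rightarrow> real ^ 'n::finite" where
  "dir m k s = (sqrt (real m) * ramp (grid m (fst k)) (grid m (Suc (fst k))) s) *\<^sub>R axis (snd k) 1"

definition coef :: "nat \<Rightarrow> nat \<times> 'n \<Rightarrow> 'n::finite cpath \<Rightarrow> real" where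
  "coef m k x = sqrt (real m) * (x (grid m (Suc (fst k))) - x (grid m (fst k))) $ snd k"

text \<open>Resets the \<open>k\<close>-th coordinate to \<open>z\<close>. One component changes its
  increment over one grid interval and is translated afterwards; its increments over the other grid
  intervals and its deviation from linear interpolation stay as they were.\<close>

definition resample :: "nat \<Rightarrow> nat \<times> 'n \<Rightarrow> 'n::finite cpath \<Rightarrow> real \<Rightarrow> 'n cpath" where
  "resample m k x z = path_add x (\<lambda>s. (z - coef m k x) *\<^sub>R dir m k s)"

text \<open>Under Wiener measure this is the conditional expectation given everything except the
  \<open>k\<close>-th coordinate. Being defined at every path, it can be iterated and evaluated at
  translated paths.\<close>

definition avg :: "nat \<Rightarrow> nat \<times> 'n \<Rightarrow> ('n::finite cpath \<Rightarrow> real) \<Rightarrow> 'n cpath \<Rightarrow> real" where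
  "avg m k f x = (LINT z|std_normal. f (resample m k x z))"

lemma continuous_on_dir: "continuous_on A (dir m k)"
  unfolding dir_def by (intro continuous_intros continuous_on_ramp)

lemma grid_mem: "j < m \<Longrightarrow> grid m j \<in> {0..1}" "j < m \<Longrightarrow> grid m (Suc j) \<in> {0..1}"
  by auto

text \<open>Orthonormality of the directions: the two factors \<open>sqrt m\<close> cancel the
  length \<open>1 / m\<close> of a grid interval.\<close>

lemma dir_increment:
  assumes "fst k < m" "fst l < m"
  shows "sqrt (real m) * (dir m k (grid m (Suc (fst l))) - dir m k (grid m (fst l))) $ snd l = (if k = l then 1 else 0)"
proof -
  have m: "real m > 0" using assms by simp
  have r: "ramp (grid m (fst k)) (grid m (Suc (fst k))) (grid m (Suc (fst l))) - ramp (grid m (fst k)) (grid m (Suc (fst k))) (grid m (fst l))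
      = (if fst k = fst l then 1 / m else 0)"
  proof -
    have c: "real a / m \<le> real b / m \<longleftrightarrow> a \<le> b" for a b using m by (simp add: divide_le_cancel)
    consider "fst l < fst k" | "fst l = fst k" | "fst k < fst l" by linarith
    then show ?thesis
    proof cases
      case 1
      then have "ramp (grid m (fst k)) (grid m (Suc (fst k))) (grid m (Suc (fst l))) = 0"
        "ramp (grid m (fst k)) (grid m (Suc (fst k))) (grid m (fst l)) = 0"
        unfolding ramp_def using c[of "Suc (fst l)" "fst k"] c[of "fst l" "fst k"] by (auto simp: min_def max_def)
      then show ?thesis using 1 by simp
    next
      case 2
      then show ?thesis unfolding ramp_def using m by (auto simp: min_def max_def field_simps)
    next
      case 3
      then have "ramp (grid m (fst k)) (grid m (Suc (fst k))) (grid m (Suc (fst l))) = grid m (Suc (fst k)) - grid m (fst k)"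
        "ramp (grid m (fst k)) (grid m (Suc (fst k))) (grid m (fst l)) = grid m (Suc (fst k)) - grid m (fst k)"
        unfolding ramp_def using c[of "Suc (fst k)" "fst l"] c[of "Suc (fst k)" "Suc (fst l)"] c[of "fst k" "Suc (fst k)"]
        by (auto simp: min_def max_def)
      then show ?thesis using 3 by simp
    qed
  qed
  have "sqrt (real m) * ((sqrt (real m) * A) *\<^sub>R a - (sqrt (real m) * B) *\<^sub>R a) $ i = real m * (A - B) * a $ i"
    for A B :: real and a :: "real ^ 'a" and i
    by (simp add: right_diff_distrib left_diff_distrib mult.assoc[symmetric])
  then have "sqrt (real m) * (dir m k (grid m (Suc (fst l))) - dir m k (grid m (fst l))) $ snd l
     = real m * (ramp (grid m (fst k)) (grid m (Suc (fst k))) (grid m (Suc (fst l))) - ramp (grid m (fst k)) (grid m (Suc (fst k))) (grid m (fst l)))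
       * axis (snd k) 1 $ snd l"
    by (simp only: dir_def)
  also have "\<dots> = (if k = l then 1 else 0)"
    unfolding r using m by (auto simp: axis_def prod_eq_iff)
  finally show ?thesis .
qed

lemma coef_add:
  assumes "fst l < m"
  shows "coef m l (path_add x h) = coef m l x + sqrt (real m) * (h (grid m (Suc (fst l))) - h (grid m (fst l))) $ snd l"
  using grid_mem[OF assms] by (simp add: coef_def path_add_apply algebra_simps)

lemma coef_add_dir:
  assumes "fst l < m" "fst k < m"
  shows "coef m l (path_add x (\<lambda>s. r *\<^sub>R dir m k s)) = coef m l x + (if k = l then r else 0)"
proof -
  have "c * (r *\<^sub>R A - r *\<^sub>R B) $ i = r * (c * (A - B) $ i)" for c :: real and A B :: "real ^ 'a" and i
    by (simp add: right_diff_distrib)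
  then show ?thesis
    by (simp only: coef_add[OF assms(1)] dir_increment[OF assms(2,1)] if_distrib[of "(*) r"] mult_1_right mult_zero_right)
qed

lemma path_add_add: "path_add (path_add x h) g = path_add x (\<lambda>s. h s + g s)"
  by (auto simp: path_add_def fun_eq_iff)

lemma resample_space: "x \<in> space path_space \<Longrightarrow> resample m k x z \<in> space path_space"
  unfolding resample_def by (intro path_add_space continuous_intros continuous_on_dir)

lemma coef_measurable: "fst k < m \<Longrightarrow> coef m k \<in> borel_measurable path_space"
proof -
  assume k: "fst k < m"
  have [measurable]: "(\<lambda>x. x (grid m (Suc (fst k)))) \<in> borel_measurable (path_space :: 'a cpath measure)"
    "(\<lambda>x. x (grid m (fst k))) \<in> borel_measurable (path_space :: 'a cpath measure)"
    using grid_mem[OF k] by (auto intro!: measurable_path_eval)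
  have "(\<lambda>v. v $ snd k) \<in> borel_measurable (borel :: (real ^ 'a) measure)" by measurable
  then have [measurable]: "(\<lambda>x. (x (grid m (Suc (fst k))) - x (grid m (fst k))) $ snd k)
      \<in> borel_measurable (path_space :: 'a cpath measure)"
    by (rule measurable_compose[rotated]) measurable
  show ?thesis unfolding coef_def by measurable
qed

lemma resample_measurable:
  assumes k: "fst k < m" and Y: "Y \<in> M \<rightarrow>\<^sub>M path_space" and Z[measurable]: "Z \<in> borel_measurable M"
  shows "(\<lambda>\<omega>. resample m k (Y \<omega>) (Z \<omega>)) \<in> M \<rightarrow>\<^sub>M path_space"
  unfolding resample_def
proof (rule measurable_path_add[OF Y])
  have [measurable]: "(\<lambda>\<omega>. coef m k (Y \<omega>)) \<in> borel_measurable M"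
    by (rule measurable_compose[OF Y coef_measurable[OF k]])
  show "(\<lambda>\<omega>. (Z \<omega> - coef m k (Y \<omega>)) *\<^sub>R dir m k t) \<in> borel_measurable M" for t by measurable
qed (intro continuous_intros continuous_on_dir)

lemma resample_add_dir:
  assumes "fst k < m"
  shows "resample m k (path_add x (\<lambda>s. r *\<^sub>R dir m k s)) z = resample m k x z"
  unfolding resample_def path_add_add coef_add_dir[OF assms assms]
  by (rule arg_cong[where f = "path_add x"]) (simp add: fun_eq_iff algebra_simps)

context wiener
begin

text \<open>A drift of rate \<open>r sqrt m\<close> during a time \<open>1 / m\<close> has squared
  Cameron-Martin norm \<open>r\<^sup>2\<close>, and its stochastic integral is \<open>r\<close>
  times the coordinate.\<close>

lemma cameron_martin_dir:
  assumes k: "fst k < m" and F: "F \<in> borel_measurable path_space"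
  shows "(\<integral>\<^sup>+x. F (path_add x (\<lambda>s. r *\<^sub>R dir m k s)) * ennreal (exp (- r * coef m k x - r\<^sup>2 / 2)) \<partial>\<mu>) = (\<integral>\<^sup>+x. F x \<partial>\<mu>)"
proof -
  have m: "real m > 0" using k by simp
  let ?q = "(r * sqrt (real m)) *\<^sub>R axis (snd k) 1 :: real ^ 'n"
  have "(\<integral>\<^sup>+x. F (path_add x (\<lambda>s. ramp (grid m (fst k)) (grid m (Suc (fst k))) s *\<^sub>R ?q))
      * ennreal (exp (- (?q \<bullet> (x (grid m (Suc (fst k))) - x (grid m (fst k)))) - 1/2 * (norm ?q)\<^sup>2 * (grid m (Suc (fst k)) - grid m (fst k)))) \<partial>\<mu>)
    = (\<integral>\<^sup>+x. F x \<partial>\<mu>)"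
    using grid_mem[OF k] m by (intro cameron_martin F) (auto simp: divide_strict_right_mono)
  moreover have q1: "(\<lambda>s. ramp (grid m (fst k)) (grid m (Suc (fst k))) s *\<^sub>R ?q) = (\<lambda>s. r *\<^sub>R dir m k s)"
    by (simp add: dir_def fun_eq_iff mult_ac)
  moreover have q2: "?q \<bullet> (x (grid m (Suc (fst k))) - x (grid m (fst k))) = r * coef m k x" for x
    by (simp add: coef_def inner_axis' mult_ac)
  moreover have q3: "1/2 * (norm ?q)\<^sup>2 * (grid m (Suc (fst k)) - grid m (fst k)) = r\<^sup>2 / 2"
    using m by (simp add: power_mult_distrib norm_axis_1 field_simps)
  ultimately show ?thesis by (simp only: q1 q2 q3 mult_minus_left)
qed

text \<open>This replaces the statement that the coordinate is standard normal and independent of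
  the rest. The factor \<open>?\<phi> (coef m k x - r)\<close>, of integral 1 in \<open>r\<close>,
  is inserted; after Fubini, Cameron-Martin translates the path by \<open>r\<close> and the weights
  combine to \<open>?\<phi> (coef m k x + r)\<close>; the variable \<open>z = coef m k x + r\<close>
  is the resampled coordinate.\<close>

theorem nn_integral_resample:
  assumes k: "fst k < m" and F[measurable]: "F \<in> borel_measurable path_space"
  shows "(\<integral>\<^sup>+x. \<integral>\<^sup>+z. F (resample m k x z) \<partial>std_normal \<partial>\<mu>) = (\<integral>\<^sup>+x. F x \<partial>\<mu>)"
proof -
  interpret pair_sigma_finite \<mu> lborel ..
  let ?\<phi> = std_normal_density
  have [measurable]: "coef m k \<in> borel_measurable path_space" by (rule coef_measurable[OF k])
  have sm: "(\<lambda>(x, r). path_add x (\<lambda>s. r *\<^sub>R dir m k s)) \<in> path_space \<Otimes>\<^sub>M borel \<rightarrow>\<^sub>M (path_space :: 'n cpath measure)"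
    unfolding case_prod_beta by (rule measurable_path_add) (auto intro!: continuous_intros continuous_on_dir)
  note [measurable] = sm
  have [measurable]: "(\<lambda>x. path_add x (\<lambda>s. r *\<^sub>R dir m k s)) \<in> path_space \<rightarrow>\<^sub>M (path_space :: 'n cpath measure)" for r
    by (rule measurable_path_add) (auto intro!: continuous_intros continuous_on_dir)
  have \<phi>: "?\<phi> c * exp (- r * c - r\<^sup>2 / 2) = ?\<phi> (c + r)" for c r
    by (simp add: std_normal_density_def exp_add[symmetric] power2_eq_square field_simps)
  have one: "(\<integral>\<^sup>+r. ennreal (?\<phi> r) \<partial>lborel) = 1"
    using prob_space.emeasure_space_1[OF prob_space_std_normal] by (simp add: emeasure_density)
  have shift: "(\<integral>\<^sup>+r. g (c + r) \<partial>lborel) = (\<integral>\<^sup>+r. g r \<partial>lborel)" if "g \<in> borel_measurable borel" for g :: "real \<Rightarrow> ennreal" and c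
    using nn_integral_real_affine[OF that, of 1 c] by simp
  have one_refl: "(\<integral>\<^sup>+r. ennreal (?\<phi> (c - r)) \<partial>lborel) = 1" for c
    using nn_integral_real_affine[of "\<lambda>r. ennreal (?\<phi> r)" "-1" c] one by simp
  have "(\<integral>\<^sup>+x. F x \<partial>\<mu>) = (\<integral>\<^sup>+x. \<integral>\<^sup>+r. F x * ennreal (?\<phi> (coef m k x - r)) \<partial>lborel \<partial>\<mu>)"
    by (simp add: nn_integral_cmult one_refl)
  also have "\<dots> = (\<integral>\<^sup>+r. \<integral>\<^sup>+x. F x * ennreal (?\<phi> (coef m k x - r)) \<partial>\<mu> \<partial>lborel)"
    by (rule Fubini'[symmetric]) measurable
  also have "\<dots> = (\<integral>\<^sup>+r. \<integral>\<^sup>+x. F (path_add x (\<lambda>s. r *\<^sub>R dir m k s)) * ennreal (?\<phi> (coef m k x + r)) \<partial>\<mu> \<partial>lborel)"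
  proof (rule nn_integral_cong)
    fix r
    have "(\<integral>\<^sup>+x. F x * ennreal (?\<phi> (coef m k x - r)) \<partial>\<mu>)
      = (\<integral>\<^sup>+x. F (path_add x (\<lambda>s. r *\<^sub>R dir m k s)) * ennreal (?\<phi> (coef m k (path_add x (\<lambda>s. r *\<^sub>R dir m k s)) - r))
          * ennreal (exp (- r * coef m k x - r\<^sup>2 / 2)) \<partial>\<mu>)"
      by (rule cameron_martin_dir[OF k, symmetric]) measurable
    also have "\<dots> = (\<integral>\<^sup>+x. F (path_add x (\<lambda>s. r *\<^sub>R dir m k s)) * ennreal (?\<phi> (coef m k x + r)) \<partial>\<mu>)"
    proof (rule nn_integral_cong)
      fix x
      have "coef m k (path_add x (\<lambda>s. r *\<^sub>R dir m k s)) - r = coef m k x"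
        by (simp add: coef_add_dir[OF k k])
      moreover have "ennreal (?\<phi> (coef m k x)) * ennreal (exp (- r * coef m k x - r\<^sup>2 / 2)) = ennreal (?\<phi> (coef m k x + r))"
        unfolding \<phi>[symmetric] by (rule ennreal_mult[symmetric]) auto
      ultimately show "F (path_add x (\<lambda>s. r *\<^sub>R dir m k s)) * ennreal (?\<phi> (coef m k (path_add x (\<lambda>s. r *\<^sub>R dir m k s)) - r))
          * ennreal (exp (- r * coef m k x - r\<^sup>2 / 2)) = F (path_add x (\<lambda>s. r *\<^sub>R dir m k s)) * ennreal (?\<phi> (coef m k x + r))"
        by (simp only: mult.assoc)
    qed
    finally show "(\<integral>\<^sup>+x. F x * ennreal (?\<phi> (coef m k x - r)) \<partial>\<mu>)
      = (\<integral>\<^sup>+x. F (path_add x (\<lambda>s. r *\<^sub>R dir m k s)) * ennreal (?\<phi> (coef m k x + r)) \<partial>\<mu>)" .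
  qed
  also have "\<dots> = (\<integral>\<^sup>+x. \<integral>\<^sup>+r. F (path_add x (\<lambda>s. r *\<^sub>R dir m k s)) * ennreal (?\<phi> (coef m k x + r)) \<partial>lborel \<partial>\<mu>)"
    by (rule Fubini') measurable
  also have "\<dots> = (\<integral>\<^sup>+x. \<integral>\<^sup>+z. F (resample m k x z) \<partial>std_normal \<partial>\<mu>)"
  proof (rule nn_integral_cong)
    fix x assume x: "x \<in> space \<mu>"
    have [measurable]: "(\<lambda>z. resample m k x z) \<in> borel \<rightarrow>\<^sub>M path_space"
      using x by (intro resample_measurable[OF k]) (auto simp: space_mu)
    have "(\<integral>\<^sup>+r. F (path_add x (\<lambda>s. r *\<^sub>R dir m k s)) * ennreal (?\<phi> (coef m k x + r)) \<partial>lborel)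
       = (\<integral>\<^sup>+r. F (resample m k x (coef m k x + r)) * ennreal (?\<phi> (coef m k x + r)) \<partial>lborel)"
      by (simp add: resample_def)
    also have "\<dots> = (\<integral>\<^sup>+z. F (resample m k x z) * ennreal (?\<phi> z) \<partial>lborel)"
      by (rule shift) measurable
    also have "\<dots> = (\<integral>\<^sup>+z. F (resample m k x z) \<partial>std_normal)"
      by (subst nn_integral_density) (auto simp: mult.commute)
    finally show "(\<integral>\<^sup>+r. F (path_add x (\<lambda>s. r *\<^sub>R dir m k s)) * ennreal (?\<phi> (coef m k x + r)) \<partial>lborel)
       = (\<integral>\<^sup>+z. F (resample m k x z) \<partial>std_normal)" .
  qed
  finally show ?thesis by simp
qed

end

section \<open>Averages of bounded functions\<close>

definition bdd_meas :: "('n::finite cpath \<Rightarrow> real) \<Rightarrow> bool" where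
  "bdd_meas f \<longleftrightarrow> f \<in> borel_measurable path_space \<and> (\<exists>C. \<forall>x\<in>space path_space. \<bar>f x\<bar> \<le> C)"

lemma bdd_measI: "f \<in> borel_measurable path_space \<Longrightarrow> (\<And>x. x \<in> space path_space \<Longrightarrow> \<bar>f x\<bar> \<le> C) \<Longrightarrow> bdd_meas f"
  by (auto simp: bdd_meas_def)

lemma bdd_meas_measurable: "bdd_meas f \<Longrightarrow> f \<in> borel_measurable path_space"
  by (simp add: bdd_meas_def)

lemma bdd_meas_diff: "bdd_meas f \<Longrightarrow> bdd_meas g \<Longrightarrow> bdd_meas (\<lambda>x. f x - g x)"
proof -
  assume "bdd_meas f" "bdd_meas g"
  then obtain C D where "f \<in> borel_measurable path_space" "\<forall>x\<in>space path_space. \<bar>f x\<bar> \<le> C"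
     "g \<in> borel_measurable path_space" "\<forall>x\<in>space path_space. \<bar>g x\<bar> \<le> D"
    unfolding bdd_meas_def by blast
  then show ?thesis
    by (intro bdd_measI[of _ "C + D"]) (auto intro: order_trans[OF abs_triangle_ineq4] add_mono)
qed

lemma bdd_meas_abs: "bdd_meas f \<Longrightarrow> bdd_meas (\<lambda>x. \<bar>f x\<bar>)"
  by (auto simp: bdd_meas_def)

lemma bdd_meas_mult: "bdd_meas f \<Longrightarrow> bdd_meas g \<Longrightarrow> bdd_meas (\<lambda>x. f x * g x)"
proof -
  assume "bdd_meas f" "bdd_meas g"
  then obtain C D where *: "f \<in> borel_measurable path_space" "\<forall>x\<in>space path_space. \<bar>f x\<bar> \<le> C"
     "g \<in> borel_measurable path_space" "\<forall>x\<in>space path_space. \<bar>g x\<bar> \<le> D"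
    unfolding bdd_meas_def by blast
  have "\<bar>f x * g x\<bar> \<le> C * D" if "x \<in> space path_space" for x
    unfolding abs_mult using * that by (intro mult_mono) (auto intro: order_trans[OF abs_ge_zero])
  with * show ?thesis by (intro bdd_measI[of _ "C * D"]) auto
qed

lemma bdd_meas_stop: "bdd_meas f \<Longrightarrow> 0 \<le> t \<Longrightarrow> bdd_meas (\<lambda>x. f (path_stop t x))"
  using measurable_compose[OF measurable_path_stop[of "\<lambda>x. x" path_space "\<lambda>_. t"], of f borel]
  unfolding bdd_meas_def by (auto intro: path_stop_space)

lemma resample_fixed_measurable:
  "fst k < m \<Longrightarrow> x \<in> space path_space \<Longrightarrow> (\<lambda>z. resample m k x z) \<in> borel \<rightarrow>\<^sub>M path_space"
  by (intro resample_measurable) auto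

lemma resample_pair_measurable:
  "fst k < m \<Longrightarrow> (\<lambda>p. resample m k (fst p) (snd p)) \<in> path_space \<Otimes>\<^sub>M borel \<rightarrow>\<^sub>M path_space"
  by (intro resample_measurable) auto

lemma integrable_resample:
  assumes f: "bdd_meas f" and k: "fst k < m" and x: "x \<in> space path_space"
  shows "integrable std_normal (\<lambda>z. f (resample m k x z))"
proof -
  interpret G: prob_space std_normal by (rule prob_space_std_normal)
  obtain C where C: "\<forall>x\<in>space path_space. \<bar>f x\<bar> \<le> C" and [measurable]: "f \<in> borel_measurable path_space"
    using f by (auto simp: bdd_meas_def)
  have [measurable]: "(\<lambda>z. resample m k x z) \<in> borel \<rightarrow>\<^sub>M path_space"
    by (rule resample_fixed_measurable[OF k x])
  show ?thesis
    by (rule G.integrable_const_bound[of _ C]) (use C resample_space[OF x, of m k] in auto)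
qed

lemma bdd_meas_avg:
  assumes f: "bdd_meas f" and k: "fst k < m"
  shows "bdd_meas (avg m k f)"
proof -
  interpret G: prob_space std_normal by (rule prob_space_std_normal)
  obtain C where C: "\<forall>x\<in>space path_space. \<bar>f x\<bar> \<le> C" and [measurable]: "f \<in> borel_measurable path_space"
    using f by (auto simp: bdd_meas_def)
  show ?thesis
  proof (rule bdd_measI)
    have "(\<lambda>p. f (resample m k (fst p) (snd p))) \<in> borel_measurable (path_space \<Otimes>\<^sub>M borel)"
      by (rule measurable_compose[OF resample_pair_measurable[OF k]]) measurable
    then have "(\<lambda>(x, z). f (resample m k x z)) \<in> borel_measurable (path_space \<Otimes>\<^sub>M std_normal)"
      by (simp add: case_prod_beta cong: measurable_cong_sets sets_pair_measure_cong)
    then show "avg m k f \<in> borel_measurable path_space"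
      unfolding avg_def by (rule G.borel_measurable_lebesgue_integral)
    fix x :: "'a cpath" assume x: "x \<in> space path_space"
    have "\<bar>avg m k f x\<bar> \<le> (LINT z|std_normal. \<bar>f (resample m k x z)\<bar>)"
      unfolding avg_def by (rule integral_abs_bound)
    also have "\<dots> \<le> (LINT z|std_normal. C)"
      using C resample_space[OF x, of m k] by (intro integral_mono integrable_abs integrable_resample[OF f k x]) auto
    also have "\<dots> = C" using G.prob_space by simp
    finally show "\<bar>avg m k f x\<bar> \<le> C" .
  qed
qed

lemma avg_mono:
  assumes "bdd_meas f" "bdd_meas g" "fst k < m" "x \<in> space path_space"
    and "\<And>x. x \<in> space path_space \<Longrightarrow> f x \<le> g x"
  shows "avg m k f x \<le> avg m k g x"
  unfolding avg_def using assms(1-4)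
  by (intro integral_mono integrable_resample assms(5) resample_space)

lemma avg_cong:
  assumes "x \<in> space path_space" "\<And>x. x \<in> space path_space \<Longrightarrow> f x = g x"
  shows "avg m k f x = avg m k g x"
  unfolding avg_def using assms by (intro Bochner_Integration.integral_cong refl) (simp add: resample_space)

lemma abs_avg_le: "\<bar>avg m k f x\<bar> \<le> avg m k (\<lambda>x. \<bar>f x\<bar>) x"
  unfolding avg_def by (rule integral_abs_bound)

lemma avg_diff:
  assumes "bdd_meas f" "bdd_meas g" "fst k < m" "x \<in> space path_space"
  shows "avg m k (\<lambda>x. f x - g x) x = avg m k f x - avg m k g x"
  unfolding avg_def using assms by (intro Bochner_Integration.integral_diff integrable_resample)

lemma path_stop_resample:
  assumes "0 \<le> t" "t \<le> grid m (fst k)"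
  shows "path_stop t (resample m k x z) = path_stop t x"
proof (rule path_eqI)
  fix s :: real assume s: "s \<in> {0..1}"
  then have "min s t \<in> {0..1}" using assms by auto
  moreover have "dir m k (min s t) = 0" using assms by (auto simp: dir_def ramp_def)
  ultimately show "path_stop t (resample m k x z) s = path_stop t x s"
    using s by (simp add: path_stop_apply resample_def path_add_apply)
qed auto

lemma avg_mult_stop:
  assumes "0 \<le> t" "t \<le> grid m (fst k)"
  shows "avg m k (\<lambda>x. f x * g (path_stop t x)) x = avg m k f x * g (path_stop t x)"
  unfolding avg_def path_stop_resample[OF assms] by simp

lemma avg_add_dir_same:
  "fst k < m \<Longrightarrow> avg m k f (path_add x (\<lambda>s. r *\<^sub>R dir m k s)) = avg m k f x"
  unfolding avg_def resample_add_dir ..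

lemma resample_add_dir_other:
  assumes "fst k < m" "fst l < m" "k \<noteq> l"
  shows "resample m l (path_add x (\<lambda>s. r *\<^sub>R dir m k s)) z = path_add (resample m l x z) (\<lambda>s. r *\<^sub>R dir m k s)"
  unfolding resample_def path_add_add coef_add_dir[OF assms(2,1)]
  using assms by (intro arg_cong[where f = "path_add x"]) (simp add: fun_eq_iff algebra_simps)

text \<open>Translations along one direction commute with resampling another, so an invariance once
  gained survives all further averages.\<close>

lemma avg_invariant:
  assumes "fst k < m" "fst l < m" "x \<in> space path_space"
    and inv: "\<And>x. x \<in> space path_space \<Longrightarrow> f (path_add x (\<lambda>s. r *\<^sub>R dir m k s)) = f x"
  shows "avg m l f (path_add x (\<lambda>s. r *\<^sub>R dir m k s)) = avg m l f x"
proof (cases "k = l")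
  case False
  then show ?thesis
    unfolding avg_def using assms resample_add_dir_other[OF assms(1,2) False]
    by (simp add: inv resample_space)
next
  case True
  then show ?thesis using avg_add_dir_same[OF assms(2), of f x r] by simp
qed

text \<open>For such a function, averaging over all later directions removes the future altogether;
  in general the path inside the grid intervals remains visible.\<close>

definition grid_fun :: "nat \<Rightarrow> ('n::finite cpath \<Rightarrow> 'b) \<Rightarrow> bool" where
  "grid_fun m f \<longleftrightarrow> (\<forall>x\<in>space path_space. \<forall>y\<in>space path_space. (\<forall>j\<le>m. x (grid m j) = y (grid m j)) \<longrightarrow> f x = f y)"

lemma grid_fun_avg:
  assumes "grid_fun m f" "fst k < m"
  shows "grid_fun m (avg m k f)"
  unfolding grid_fun_def
proof (intro ballI impI)
  fix x y :: "'a cpath" assume xy: "x \<in> space path_space" "y \<in> space path_space" "\<forall>j\<le>m. x (grid m j) = y (grid m j)"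
  have c: "coef m k x = coef m k y" using xy(3) assms(2) by (simp add: coef_def Suc_leI less_imp_le del: of_nat_Suc)
  have "f (resample m k x z) = f (resample m k y z)" for z
  proof -
    have "resample m k x z (grid m j) = resample m k y z (grid m j)" if "j \<le> m" for j
      using xy(3) that assms(2) unfolding resample_def c by (simp add: path_add_apply)
    then show ?thesis
      using assms(1) xy(1,2) by (simp add: grid_fun_def resample_space)
  qed
  then show "avg m k f x = avg m k f y" by (simp add: avg_def)
qed

definition iter_avg :: "nat \<Rightarrow> (nat \<times> 'n) list \<Rightarrow> ('n::finite cpath \<Rightarrow> real) \<Rightarrow> 'n cpath \<Rightarrow> real" where
  "iter_avg m ks f = foldr (avg m) ks f"

lemma iter_avg_simps [simp]:
  "iter_avg m [] f = f" "iter_avg m (k # ks) f = avg m k (iter_avg m ks f)"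
  by (simp_all add: iter_avg_def)

lemma bdd_meas_iter_avg:
  "bdd_meas f \<Longrightarrow> \<forall>k\<in>set ks. fst k < m \<Longrightarrow> bdd_meas (iter_avg m ks f)"
  by (induction ks) (auto intro: bdd_meas_avg)

lemma iter_avg_mono:
  assumes "bdd_meas f" "bdd_meas g" "\<forall>k\<in>set ks. fst k < m" "\<And>x. x \<in> space path_space \<Longrightarrow> f x \<le> g x"
    and "x \<in> space path_space"
  shows "iter_avg m ks f x \<le> iter_avg m ks g x"
  using assms(3,5) by (induction ks arbitrary: x) (auto intro!: avg_mono bdd_meas_iter_avg assms)

lemma abs_iter_avg_le:
  assumes "bdd_meas f" "\<forall>k\<in>set ks. fst k < m" "x \<in> space path_space"
  shows "\<bar>iter_avg m ks f x\<bar> \<le> iter_avg m ks (\<lambda>x. \<bar>f x\<bar>) x"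
  using assms(2,3)
proof (induction ks arbitrary: x)
  case (Cons k ks)
  have "\<bar>iter_avg m (k # ks) f x\<bar> \<le> avg m k (\<lambda>x. \<bar>iter_avg m ks f x\<bar>) x"
    by (simp add: abs_avg_le)
  also have "\<dots> \<le> avg m k (iter_avg m ks (\<lambda>x. \<bar>f x\<bar>)) x"
    using Cons assms(1) by (intro avg_mono bdd_meas_abs bdd_meas_iter_avg) auto
  finally show ?case by simp
qed simp

lemma iter_avg_diff:
  assumes "bdd_meas f" "bdd_meas g" "\<forall>k\<in>set ks. fst k < m" "x \<in> space path_space"
  shows "iter_avg m ks (\<lambda>x. f x - g x) x = iter_avg m ks f x - iter_avg m ks g x"
  using assms(3,4)
proof (induction ks arbitrary: x)
  case (Cons k ks)
  have "iter_avg m (k # ks) (\<lambda>x. f x - g x) x = avg m k (\<lambda>x. iter_avg m ks f x - iter_avg m ks g x) x"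
    using Cons by (auto intro: avg_cong)
  also have "\<dots> = avg m k (iter_avg m ks f) x - avg m k (iter_avg m ks g) x"
    using Cons assms by (intro avg_diff bdd_meas_iter_avg) auto
  finally show ?case by simp
qed simp

lemma iter_avg_mult_stop:
  assumes "0 \<le> t" "\<forall>k\<in>set ks. t \<le> grid m (fst k)"
  shows "iter_avg m ks (\<lambda>x. f x * g (path_stop t x)) x = iter_avg m ks f x * g (path_stop t x)"
  using assms(2)
proof (induction ks arbitrary: x)
  case (Cons k ks)
  then have "iter_avg m (k # ks) (\<lambda>x. f x * g (path_stop t x)) x
      = avg m k (\<lambda>x. iter_avg m ks f x * g (path_stop t x)) x"
    by (auto intro!: arg_cong[where f = "\<lambda>f. avg m k f x"] ext)
  then show ?case using Cons assms(1) by (simp add: avg_mult_stop)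
qed simp

lemma iter_avg_invariant:
  assumes "\<forall>k\<in>set ks. fst k < m" "k \<in> set ks" "x \<in> space path_space"
  shows "iter_avg m ks f (path_add x (\<lambda>s. r *\<^sub>R dir m k s)) = iter_avg m ks f x"
  using assms
proof (induction ks arbitrary: x)
  case (Cons l ks)
  show ?case
  proof (cases "k \<in> set ks")
    case True
    then show ?thesis using Cons by (auto intro!: avg_invariant)
  next
    case False
    then have "k = l" using Cons.prems(2) by simp
    then show ?thesis
      using Cons.prems(1) avg_add_dir_same[of l m "iter_avg m ks f" x r] by simp
  qed
qed simp

lemma grid_fun_iter_avg:
  "grid_fun m f \<Longrightarrow> \<forall>k\<in>set ks. fst k < m \<Longrightarrow> grid_fun m (iter_avg m ks f)"
  by (induction ks) (auto intro: grid_fun_avg)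

section \<open>Translations by step functions and the condition along the grid\<close>

definition step_path :: "nat \<Rightarrow> (nat \<times> 'n \<Rightarrow> real) \<Rightarrow> real \<Rightarrow> real ^ 'n::finite" where
  "step_path m y s = (\<Sum>k\<in>{..<m} \<times> UNIV. y k *\<^sub>R dir m k s)"

lemma continuous_on_step_path: "continuous_on A (step_path m y)"
  unfolding step_path_def by (intro continuous_intros continuous_on_dir)

lemma step_path_upd:
  assumes "fst k < m"
  shows "step_path m (y(k := w)) s = step_path m (y(k := 0)) s + w *\<^sub>R dir m k s"
proof -
  have k: "k \<in> {..<m} \<times> UNIV" "finite ({..<m} \<times> (UNIV :: 'a set))" using assms by (auto simp: mem_Times_iff)
  show ?thesis
    unfolding step_path_def by (subst (1 2) sum.remove[OF k(2,1)]) (auto intro!: sum.cong)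
qed

lemma sum_squares_upd:
  fixes m :: nat
  assumes "fst k < m"
  shows "(\<Sum>l\<in>{..<m} \<times> (UNIV :: 'n::finite set). ((y(k := w)) l)\<^sup>2)
    = (\<Sum>l\<in>{..<m} \<times> UNIV. ((y(k := 0)) l)\<^sup>2) + (w::real)\<^sup>2"
proof -
  have k: "k \<in> {..<m} \<times> UNIV" "finite ({..<m} \<times> (UNIV :: 'n set))" using assms by (auto simp: mem_Times_iff)
  show ?thesis
    by (subst (1 2) sum.remove[OF k(2,1)]) (auto intro!: sum.cong)
qed

lemma coef_add_step_path:
  assumes "fst k < m"
  shows "coef m k (path_add x (\<lambda>s. r *\<^sub>R step_path m y s)) = coef m k x + r * y k"
proof -
  have k: "k \<in> {..<m} \<times> UNIV" "finite ({..<m} \<times> (UNIV :: 'a set))" using assms by (auto simp: mem_Times_iff)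
  have "c * (r *\<^sub>R step_path m y a - r *\<^sub>R step_path m y b) $ i
    = r * (\<Sum>l\<in>{..<m} \<times> UNIV. y l * (c * (dir m l a - dir m l b) $ i))" for c a b :: real and i
    by (simp add: step_path_def scaleR_diff_right[symmetric] sum_subtractf[symmetric] sum_distrib_left
        mult_ac right_diff_distrib)
  then have "coef m k (path_add x (\<lambda>s. r *\<^sub>R step_path m y s))
    = coef m k x + r * (\<Sum>l\<in>{..<m} \<times> UNIV. y l * (sqrt (real m) * (dir m l (grid m (Suc (fst k))) - dir m l (grid m (fst k))) $ snd k))"
    by (simp only: coef_add[OF assms])
  also have "(\<Sum>l\<in>{..<m} \<times> UNIV. y l * (sqrt (real m) * (dir m l (grid m (Suc (fst k))) - dir m l (grid m (fst k))) $ snd k))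
    = (\<Sum>l\<in>{..<m} \<times> UNIV. if l = k then y l else 0)"
  proof (rule sum.cong[OF refl])
    fix l :: "nat \<times> 'a" assume "l \<in> {..<m} \<times> UNIV"
    then have "fst l < m" by auto
    then show "y l * (sqrt (real m) * (dir m l (grid m (Suc (fst k))) - dir m l (grid m (fst k))) $ snd k)
        = (if l = k then y l else 0)"
      by (simp only: dir_increment[OF _ assms]) simp
  qed
  also have "\<dots> = y k" using k by simp
  finally show ?thesis .
qed

text \<open>The Prekopa-Leindler condition along the grid directions.  Both shifts are taken relative to their
  convex combination, so that \<open>A\<close> is evaluated at the unshifted path and the Gaussian weights combine to
  \<open>exp (- s (1 - s) |h|\<^sup>2 / 2)\<close>.\<close>

definition pl_condition :: "'n::finite cpath measure \<Rightarrow> nat \<Rightarrow> real \<Rightarrow>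
    ('n cpath \<Rightarrow> real) \<Rightarrow> ('n cpath \<Rightarrow> real) \<Rightarrow> ('n cpath \<Rightarrow> real) \<Rightarrow> bool" where
  "pl_condition \<mu> m s A B C \<longleftrightarrow> (\<forall>y. AE x in \<mu>.
     exp (- 1/2 * s * (1 - s) * (\<Sum>k\<in>{..<m} \<times> UNIV. (y k)\<^sup>2))
       * (B (path_add x (\<lambda>t. (1 - s) *\<^sub>R step_path m y t)) powr s
       * C (path_add x (\<lambda>t. (- s) *\<^sub>R step_path m y t)) powr (1 - s)) \<le> A x)"

text \<open>The identity \<open>s (p + (1 - s) w)\<^sup>2 + (1 - s) (p - s w)\<^sup>2 = p\<^sup>2 +
  s (1 - s) w\<^sup>2\<close> in the exponent.\<close>

lemma std_normal_density_convex:
  "std_normal_density (p + (1 - s) * w) powr s * std_normal_density (p - s * w) powr (1 - s)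
    = std_normal_density p * exp (- 1/2 * s * (1 - s) * w\<^sup>2)"
proof -
  have eq: "std_normal_density x powr r = (1 / sqrt (2 * pi)) powr r * exp (r * (- x\<^sup>2 / 2))" for x r
    by (simp add: std_normal_density_def powr_mult powr_def[of "exp _"] powr_divide)
  have a: "(1 / sqrt (2 * pi)) powr s * (1 / sqrt (2 * pi)) powr (1 - s) = 1 / sqrt (2 * pi)"
    by (simp add: powr_add[symmetric])
  have b: "exp (s * (- (p + (1 - s) * w)\<^sup>2 / 2)) * exp ((1 - s) * (- (p - s * w)\<^sup>2 / 2))
     = exp (- p\<^sup>2 / 2) * exp (- 1/2 * s * (1 - s) * w\<^sup>2)"
    unfolding exp_add[symmetric] by (simp add: power2_eq_square field_simps)
  have c: "(a * b) * (c * d) = (a * c) * (b * d)" for a b c d :: real by simp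
  show ?thesis
    unfolding eq c a b by (simp add: std_normal_density_def)
qed

lemma AE_std_normalD:
  assumes "AE z in std_normal. P z"
  shows "AE z in lborel. P z"
proof -
  have "AE z in lborel. 0 < ennreal (std_normal_density z) \<longrightarrow> P z"
    using assms by (subst (asm) AE_density) auto
  then show ?thesis by eventually_elim (simp add: normal_density_pos)
qed

lemma integrable_lborel_resample:
  assumes "bdd_meas f" "fst k < m" "x \<in> space path_space"
  shows "integrable lborel (\<lambda>z. f (resample m k x z) * std_normal_density z)"
    and "(LINT z|lborel. f (resample m k x z) * std_normal_density z) = avg m k f x"
proof -
  have [measurable]: "(\<lambda>z. f (resample m k x z)) \<in> borel_measurable borel"
    by (rule measurable_compose[OF resample_fixed_measurable[OF assms(2,3)] bdd_meas_measurable[OF assms(1)]])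
  show "integrable lborel (\<lambda>z. f (resample m k x z) * std_normal_density z)"
    using integrable_resample[OF assms] by (simp add: integrable_density mult.commute)
  show "(LINT z|lborel. f (resample m k x z) * std_normal_density z) = avg m k f x"
    unfolding avg_def by (subst integral_density) (auto simp: mult.commute)
qed

lemma measurable_shift_resample_density:
  assumes k: "fst k < m" and f: "bdd_meas f" and Y: "Y \<in> M \<rightarrow>\<^sub>M path_space" and Z[measurable]: "Z \<in> borel_measurable M"
  shows "(\<lambda>\<omega>. f (resample m k (path_add (Y \<omega>) (\<lambda>t. r *\<^sub>R step_path m y t)) (Z \<omega>)) * std_normal_density (Z \<omega>)) \<in> borel_measurable M"
proof (rule borel_measurable_times)
  have Y': "(\<lambda>\<omega>. path_add (Y \<omega>) (\<lambda>t. r *\<^sub>R step_path m y t)) \<in> M \<rightarrow>\<^sub>M path_space"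
    by (rule measurable_path_add[OF Y]) (auto intro!: continuous_intros continuous_on_step_path)
  show "(\<lambda>\<omega>. f (resample m k (path_add (Y \<omega>) (\<lambda>t. r *\<^sub>R step_path m y t)) (Z \<omega>))) \<in> borel_measurable M"
    by (rule measurable_compose[OF resample_measurable[OF k Y' Z] bdd_meas_measurable[OF f]])
qed measurable

lemma measurable_resample_density:
  assumes k: "fst k < m" and f: "bdd_meas f" and Y: "Y \<in> M \<rightarrow>\<^sub>M path_space" and Z[measurable]: "Z \<in> borel_measurable M"
  shows "(\<lambda>\<omega>. f (resample m k (Y \<omega>) (Z \<omega>)) * std_normal_density (Z \<omega>)) \<in> borel_measurable M"
proof -
  have [measurable]: "(\<lambda>\<omega>. f (resample m k (Y \<omega>) (Z \<omega>))) \<in> borel_measurable M"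
    by (rule measurable_compose[OF resample_measurable[OF k Y Z] bdd_meas_measurable[OF f]])
  show ?thesis by measurable
qed

text \<open>General path, coordinate and displacement, because Fubini is applied to this predicate
  on three different product spaces.\<close>

lemma measurable_pl_predicate:
  assumes k: "fst k < m" and bm: "bdd_meas A" "bdd_meas B" "bdd_meas C"
    and Y: "Y \<in> M \<rightarrow>\<^sub>M path_space" and [measurable]: "Z \<in> borel_measurable M" "W \<in> borel_measurable M"
  shows "{\<omega> \<in> space M.
    (B (resample m k (path_add (Y \<omega>) (\<lambda>t. (1 - s) *\<^sub>R step_path m y t)) (Z \<omega> + (1 - s) * W \<omega>)) * std_normal_density (Z \<omega> + (1 - s) * W \<omega>)) powr s
    * (C (resample m k (path_add (Y \<omega>) (\<lambda>t. (- s) *\<^sub>R step_path m y t)) (Z \<omega> - s * W \<omega>)) * std_normal_density (Z \<omega> - s * W \<omega>)) powr (1 - s)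
    \<le> (A (resample m k (Y \<omega>) (Z \<omega>)) * std_normal_density (Z \<omega>)) / c} \<in> sets M"
proof (rule borel_measurable_le)
  note [measurable] = measurable_shift_resample_density[OF k bm(2) Y, of "\<lambda>\<omega>. Z \<omega> + (1 - s) * W \<omega>" "1 - s" y]
    measurable_shift_resample_density[OF k bm(3) Y, of "\<lambda>\<omega>. Z \<omega> - s * W \<omega>" "- s" y]
    measurable_resample_density[OF k bm(1) Y, of Z]
  show "(\<lambda>\<omega>. (B (resample m k (path_add (Y \<omega>) (\<lambda>t. (1 - s) *\<^sub>R step_path m y t)) (Z \<omega> + (1 - s) * W \<omega>)) * std_normal_density (Z \<omega> + (1 - s) * W \<omega>)) powr s
    * (C (resample m k (path_add (Y \<omega>) (\<lambda>t. (- s) *\<^sub>R step_path m y t)) (Z \<omega> - s * W \<omega>)) * std_normal_density (Z \<omega> - s * W \<omega>)) powr (1 - s)) \<in> borel_measurable M"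
    by (intro borel_measurable_times powr_real_measurable borel_measurable_const
        measurable_shift_resample_density[OF k bm(2) Y] measurable_shift_resample_density[OF k bm(3) Y]) measurable
  show "(\<lambda>\<omega>. (A (resample m k (Y \<omega>) (Z \<omega>)) * std_normal_density (Z \<omega>)) / c) \<in> borel_measurable M"
    by (intro borel_measurable_divide borel_measurable_const measurable_resample_density[OF k bm(1) Y]) measurable
qed

context wiener
begin

lemma distr_resample:
  assumes k: "fst k < m"
  shows "distr (\<mu> \<Otimes>\<^sub>M std_normal) path_space (\<lambda>p. resample m k (fst p) (snd p)) = \<mu>"
proof (rule measure_eqI)
  interpret G: prob_space std_normal by (rule prob_space_std_normal)
  have R[measurable]: "(\<lambda>p. resample m k (fst p) (snd p)) \<in> \<mu> \<Otimes>\<^sub>M std_normal \<rightarrow>\<^sub>M path_space"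
    using resample_pair_measurable[OF k] by (simp cong: measurable_cong_sets sets_pair_measure_cong add: sets_mu)
  show "sets (distr (\<mu> \<Otimes>\<^sub>M std_normal) path_space (\<lambda>p. resample m k (fst p) (snd p))) = sets \<mu>"
    by (simp add: sets_mu)
  fix S assume "S \<in> sets (distr (\<mu> \<Otimes>\<^sub>M std_normal) path_space (\<lambda>p. resample m k (fst p) (snd p)))"
  then have S[measurable]: "S \<in> sets path_space" by simp
  have "emeasure (distr (\<mu> \<Otimes>\<^sub>M std_normal) path_space (\<lambda>p. resample m k (fst p) (snd p))) S
    = (\<integral>\<^sup>+p. indicator S (resample m k (fst p) (snd p)) \<partial>(\<mu> \<Otimes>\<^sub>M std_normal))"
    by (simp add: nn_integral_indicator[symmetric] nn_integral_distr del: nn_integral_indicator)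
  also have "\<dots> = (\<integral>\<^sup>+x. \<integral>\<^sup>+z. indicator S (resample m k x z) \<partial>std_normal \<partial>\<mu>)"
    by (subst G.nn_integral_fst[symmetric]) auto
  also have "\<dots> = (\<integral>\<^sup>+x. indicator S x \<partial>\<mu>)"
    by (rule nn_integral_resample[OF k]) measurable
  also have "\<dots> = emeasure \<mu> S" by (simp add: sets_mu)
  finally show "emeasure (distr (\<mu> \<Otimes>\<^sub>M std_normal) path_space (\<lambda>p. resample m k (fst p) (snd p))) S = emeasure \<mu> S" .
qed

lemma resample_measurable_mu:
  "fst k < m \<Longrightarrow> (\<lambda>p. resample m k (fst p) (snd p)) \<in> \<mu> \<Otimes>\<^sub>M std_normal \<rightarrow>\<^sub>M path_space"
  using resample_pair_measurable[of k m] by (simp cong: measurable_cong_sets sets_pair_measure_cong add: sets_mu)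

lemma bdd_meas_integrable: "bdd_meas f \<Longrightarrow> integrable \<mu> f"
proof -
  assume "bdd_meas f"
  then obtain C where "\<forall>x\<in>space path_space. \<bar>f x\<bar> \<le> C" "f \<in> borel_measurable path_space"
    by (auto simp: bdd_meas_def)
  then show ?thesis
    by (intro integrable_const_bound[of _ C]) (auto simp: space_mu measurable_cong_sets[OF sets_mu refl])
qed

lemma integral_avg:
  assumes f: "bdd_meas f" and k: "fst k < m"
  shows "(LINT x|\<mu>. avg m k f x) = (LINT x|\<mu>. f x)"
proof -
  interpret G: prob_space std_normal by (rule prob_space_std_normal)
  interpret P: pair_prob_space \<mu> std_normal ..
  obtain C where C: "\<forall>x\<in>space path_space. \<bar>f x\<bar> \<le> C" and fm[measurable]: "f \<in> borel_measurable path_space"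
    using f by (auto simp: bdd_meas_def)
  note [measurable] = resample_measurable_mu[OF k]
  have "integrable (\<mu> \<Otimes>\<^sub>M std_normal) (\<lambda>p. f (resample m k (fst p) (snd p)))"
  proof (rule P.integrable_const_bound[of _ C])
    show "AE p in \<mu> \<Otimes>\<^sub>M std_normal. norm (f (resample m k (fst p) (snd p))) \<le> C"
      using C measurable_space[OF resample_measurable_mu[OF k]] by (intro AE_I2) auto
  qed measurable
  then have "(LINT x|\<mu>. avg m k f x) = (LINT p|(\<mu> \<Otimes>\<^sub>M std_normal). f (resample m k (fst p) (snd p)))"
    unfolding avg_def using P.integral_fst'[of "\<lambda>p. f (resample m k (fst p) (snd p))"] by simp
  also have "\<dots> = (LINT x|distr (\<mu> \<Otimes>\<^sub>M std_normal) path_space (\<lambda>p. resample m k (fst p) (snd p)). f x)"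
    by (rule integral_distr[symmetric]) measurable
  also have "\<dots> = (LINT x|\<mu>. f x)" by (simp only: distr_resample[OF k])
  finally show ?thesis .
qed

lemma integral_iter_avg:
  assumes "bdd_meas f" "\<forall>k\<in>set ks. fst k < m"
  shows "(LINT x|\<mu>. iter_avg m ks f x) = (LINT x|\<mu>. f x)"
  using assms(2) by (induction ks) (simp_all add: integral_avg bdd_meas_iter_avg[OF assms(1)])

lemma AE_resample:
  assumes k: "fst k < m" and P: "AE x in \<mu>. P x"
  shows "AE p in \<mu> \<Otimes>\<^sub>M std_normal. P (resample m k (fst p) (snd p))"
  by (rule AE_distrD[OF resample_measurable_mu[OF k]]) (simp only: distr_resample[OF k] P)

text \<open>The component of the translation along \<open>k\<close> can be absorbed into the new
  coordinate; the remaining components commute with resampling.\<close>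

lemma resample_shift:
  assumes k: "fst k < m"
  shows "path_add (resample m k x p) (\<lambda>t. r *\<^sub>R step_path m (y(k := w)) t)
    = resample m k (path_add x (\<lambda>t. r *\<^sub>R step_path m (y(k := 0)) t)) (p + r * w)"
  unfolding resample_def path_add_add coef_add_step_path[OF k] step_path_upd[OF k, of y w]
  by (intro arg_cong[where f = "path_add x"]) (simp add: fun_eq_iff algebra_simps)

lemma avg_step_path:
  assumes k: "fst k < m"
  shows "avg m k f (path_add x (\<lambda>t. r *\<^sub>R step_path m y t)) = avg m k f (path_add x (\<lambda>t. r *\<^sub>R step_path m (y(k := 0)) t))"
proof -
  have "path_add x (\<lambda>t. r *\<^sub>R step_path m y t)
    = path_add (path_add x (\<lambda>t. r *\<^sub>R step_path m (y(k := 0)) t)) (\<lambda>t. (r * y k) *\<^sub>R dir m k t)"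
    unfolding path_add_add using step_path_upd[OF k, of y "y k"]
    by (intro arg_cong[where f = "path_add x"]) (simp add: fun_eq_iff algebra_simps)
  then show ?thesis by (simp add: avg_add_dir_same[OF k])
qed

text \<open>For almost every path \<open>x\<close>, the one-dimensional inequality is applied to the
  functions of the coordinate in direction \<open>k\<close>, multiplied by the Gaussian density. The
  component \<open>w\<close> of the shift along \<open>k\<close> is the displacement, and its share
  of the exponential weight is exactly what the convexity defect of the density provides.\<close>

theorem pl_condition_avg:
  assumes pl: "pl_condition \<mu> m s A B C" and k: "fst k < m" and s: "0 < s" "s < 1"
    and bm: "bdd_meas A" "bdd_meas B" "bdd_meas C"
    and nn: "\<And>x. x \<in> space path_space \<Longrightarrow> 0 \<le> A x" "\<And>x. x \<in> space path_space \<Longrightarrow> 0 \<le> B x"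
      "\<And>x. x \<in> space path_space \<Longrightarrow> 0 \<le> C x"
  shows "pl_condition \<mu> m s (avg m k A) (avg m k B) (avg m k C)"
  unfolding pl_condition_def
proof (intro allI)
  fix y :: "nat \<times> 'n \<Rightarrow> real"
  let ?\<phi> = std_normal_density
  let ?N = "\<lambda>y. \<Sum>k\<in>{..<m} \<times> (UNIV :: 'n set). (y k)\<^sup>2 :: real"
  let ?y0 = "y(k := 0)"
  let ?xb = "\<lambda>x. path_add x (\<lambda>t. (1 - s) *\<^sub>R step_path m ?y0 t)"
  let ?xc = "\<lambda>x. path_add x (\<lambda>t. (- s) *\<^sub>R step_path m ?y0 t)"
  \<comment> \<open>The share of the other components in the weight is constant in \<open>w\<close>
    and in the coordinate, and is moved to the side of \<open>A\<close>.\<close>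
  let ?\<kappa> = "exp (- 1/2 * s * (1 - s) * ?N ?y0)"
  let ?b = "\<lambda>x z. B (resample m k (?xb x) z) * ?\<phi> z"
  let ?c = "\<lambda>x z. C (resample m k (?xc x) z) * ?\<phi> z"
  let ?a = "\<lambda>x z. (A (resample m k x z) * ?\<phi> z) / ?\<kappa>"
  let ?P = "\<lambda>w q. ?b (fst q) (snd q + (1 - s) * w) powr s * ?c (fst q) (snd q - s * w) powr (1 - s) \<le> ?a (fst q) (snd q)"
  interpret G: prob_space std_normal by (rule prob_space_std_normal)
  interpret PG: pair_prob_space \<mu> std_normal ..
  interpret PL: pair_sigma_finite \<mu> lborel ..
  interpret LPL: pair_sigma_finite lborel "\<mu> \<Otimes>\<^sub>M lborel" ..
  have xb: "x \<in> space path_space \<Longrightarrow> ?xb x \<in> space path_space" and xc: "x \<in> space path_space \<Longrightarrow> ?xc x \<in> space path_space" for x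
    by (auto intro!: path_add_space continuous_intros continuous_on_step_path)
  have bnn: "x \<in> space path_space \<Longrightarrow> 0 \<le> ?b x z" and cnn: "x \<in> space path_space \<Longrightarrow> 0 \<le> ?c x z" and ann: "x \<in> space path_space \<Longrightarrow> 0 \<le> ?a x z" for x z
    using nn resample_space[of _ m k] xb xc by auto
  \<comment> \<open>The condition is applied to the shift \<open>y(k := w)\<close> at a resampled
    path, which is legitimate because resampling preserves the law. The null set of pairs of path
    and coordinate still depends on \<open>w\<close>.\<close>
  have AEw: "AE q in \<mu> \<Otimes>\<^sub>M lborel. ?P w q" for w
  proof -
    have "AE x in \<mu>. exp (- 1/2 * s * (1 - s) * ?N (y(k := w)))
       * (B (path_add x (\<lambda>t. (1 - s) *\<^sub>R step_path m (y(k := w)) t)) powr s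
       * C (path_add x (\<lambda>t. (- s) *\<^sub>R step_path m (y(k := w)) t)) powr (1 - s)) \<le> A x"
      using pl unfolding pl_condition_def by blast
    from AE_resample[OF k this]
    have "AE p in \<mu> \<Otimes>\<^sub>M std_normal. exp (- 1/2 * s * (1 - s) * (?N ?y0 + w\<^sup>2))
       * (B (resample m k (?xb (fst p)) (snd p + (1 - s) * w)) powr s
       * C (resample m k (?xc (fst p)) (snd p + (- s) * w)) powr (1 - s)) \<le> A (resample m k (fst p) (snd p))"
      by (simp only: resample_shift[OF k] sum_squares_upd[OF k, of y w])
    then have "AE x in \<mu>. AE z in std_normal. exp (- 1/2 * s * (1 - s) * (?N ?y0 + w\<^sup>2))
       * (B (resample m k (?xb x) (z + (1 - s) * w)) powr s
       * C (resample m k (?xc x) (z + (- s) * w)) powr (1 - s)) \<le> A (resample m k x z)"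
      using PG.AE_pair by fastforce
    then have "AE x in \<mu>. AE z in lborel. ?P w (x, z)"
    proof (rule AE_mp[OF _ AE_I2[OF impI]])
      fix x assume x: "x \<in> space \<mu>" and "AE z in std_normal. exp (- 1/2 * s * (1 - s) * (?N ?y0 + w\<^sup>2))
       * (B (resample m k (?xb x) (z + (1 - s) * w)) powr s
       * C (resample m k (?xc x) (z + (- s) * w)) powr (1 - s)) \<le> A (resample m k x z)"
      then have "AE z in lborel. exp (- 1/2 * s * (1 - s) * (?N ?y0 + w\<^sup>2))
       * (B (resample m k (?xb x) (z + (1 - s) * w)) powr s
       * C (resample m k (?xc x) (z + (- s) * w)) powr (1 - s)) \<le> A (resample m k x z)"
        by (intro AE_std_normalD)
      then show "AE z in lborel. ?P w (x, z)"
      proof eventually_elim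
        case (elim z)
        let ?B = "B (resample m k (?xb x) (z + (1 - s) * w))" and ?C = "C (resample m k (?xc x) (z - s * w))"
        have "?b x (z + (1 - s) * w) powr s * ?c x (z - s * w) powr (1 - s)
          = (?B powr s * ?C powr (1 - s)) * (?\<phi> (z + (1 - s) * w) powr s * ?\<phi> (z - s * w) powr (1 - s))"
          using x nn resample_space[of _ m k] xb xc by (simp add: powr_mult space_mu mult_ac)
        also have "\<dots> = (exp (- 1/2 * s * (1 - s) * w\<^sup>2) * (?B powr s * ?C powr (1 - s))) * ?\<phi> z"
          unfolding std_normal_density_convex by (simp add: mult_ac)
        also have "\<dots> = (exp (- 1/2 * s * (1 - s) * (?N ?y0 + w\<^sup>2)) * (?B powr s * ?C powr (1 - s))) * ?\<phi> z / ?\<kappa>"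
        proof -
          have "exp (- 1/2 * s * (1 - s) * (n + w\<^sup>2)) = exp (- 1/2 * s * (1 - s) * n) * exp (- 1/2 * s * (1 - s) * w\<^sup>2)" for n
            by (simp only: mult_exp_exp distrib_left)
          moreover have "e * X * p = (e' * e * X) * p / e'" if "e' \<noteq> 0" for e e' X p :: real
            using that by simp
          ultimately show ?thesis by (metis exp_not_eq_zero)
        qed
        also have "\<dots> \<le> A (resample m k x z) * ?\<phi> z / ?\<kappa>"
          using elim by (intro divide_right_mono mult_right_mono) auto
        finally show ?case by simp
      qed
    qed
    note AExz = this
    have mq: "{q \<in> space (\<mu> \<Otimes>\<^sub>M lborel). ?P w q} \<in> sets (\<mu> \<Otimes>\<^sub>M lborel)"
    proof -
      have "{q \<in> space (\<mu> \<Otimes>\<^sub>M lborel). ?P w (fst q, snd q)} \<in> sets (\<mu> \<Otimes>\<^sub>M lborel)"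
        unfolding fst_conv snd_conv
        by (rule measurable_pl_predicate[OF k bm, where Y = fst and Z = snd and W = "\<lambda>_. w" and s = s and y = ?y0 and c = ?\<kappa>])
          (simp_all add: measurable_cong_sets[OF refl sets_mu, symmetric])
      then show ?thesis by (simp only: prod.collapse)
    qed
    show ?thesis by (rule PL.AE_pair_measure[where P = "?P w", OF mq AExz])
  qed
  \<comment> \<open>Fubini makes one null set of pairs serve almost every displacement.\<close>
  have "AE q in \<mu> \<Otimes>\<^sub>M lborel. AE w in lborel. ?P w q"
  proof -
    have "{z \<in> space (lborel \<Otimes>\<^sub>M (\<mu> \<Otimes>\<^sub>M lborel)). ?P (fst z) (snd z)} \<in> sets (lborel \<Otimes>\<^sub>M (\<mu> \<Otimes>\<^sub>M lborel))"
    proof -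
      have "{z \<in> space (lborel \<Otimes>\<^sub>M (\<mu> \<Otimes>\<^sub>M lborel)). ?P (fst z) (fst (snd z), snd (snd z))} \<in> sets (lborel \<Otimes>\<^sub>M (\<mu> \<Otimes>\<^sub>M lborel))"
        unfolding fst_conv snd_conv
        by (rule measurable_pl_predicate[OF k bm, where Y = "\<lambda>z. fst (snd z)" and Z = "\<lambda>z. snd (snd z)" and W = fst and s = s and y = ?y0 and c = ?\<kappa>])
          (simp_all add: measurable_cong_sets[OF refl sets_mu, symmetric])
      then show ?thesis by (simp only: prod.collapse)
    qed
    from LPL.AE_commute[where P = ?P, OF this] AEw show ?thesis by simp
  qed
  then have "AE x in \<mu>. AE p in lborel. AE w in lborel. ?P w (x, p)"
    by (rule PL.AE_pair)
  then show "AE x in \<mu>. exp (- 1/2 * s * (1 - s) * ?N y)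
       * (avg m k B (path_add x (\<lambda>t. (1 - s) *\<^sub>R step_path m y t)) powr s
       * avg m k C (path_add x (\<lambda>t. (- s) *\<^sub>R step_path m y t)) powr (1 - s)) \<le> avg m k A x"
  proof (rule AE_mp[OF _ AE_I2[OF impI]])
    fix x assume "x \<in> space \<mu>" and AEpw: "AE p in lborel. AE w in lborel. ?P w (x, p)"
    then have x: "x \<in> space path_space" by (simp add: space_mu)
    have AEwp: "AE w in lborel. AE p in lborel. ?P w (x, p)"
    proof -
      have "{z \<in> space (lborel \<Otimes>\<^sub>M lborel). ?P (fst z) (x, snd z)} \<in> sets (lborel \<Otimes>\<^sub>M lborel)"
        unfolding fst_conv snd_conv
        by (rule measurable_pl_predicate[OF k bm, where Y = "\<lambda>_. x" and Z = snd and W = fst and s = s and y = ?y0 and c = ?\<kappa>]) (use x in simp_all)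
      from lborel_pair.AE_commute[where P = "\<lambda>w p. ?P w (x, p)", OF this] AEpw show ?thesis by (rule iffD2)
    qed
    obtain KB KC where K: "\<forall>x\<in>space path_space. \<bar>B x\<bar> \<le> KB" "\<forall>x\<in>space path_space. \<bar>C x\<bar> \<le> KC"
      using bm by (auto simp: bdd_meas_def)
    have \<phi>1: "?\<phi> z \<le> 1" for z
    proof -
      have "1 \<le> sqrt (2 * pi)" using pi_ge_two by (intro real_le_rsqrt) simp
      then have "1 / sqrt (2 * pi) * exp (- z\<^sup>2 / 2) \<le> 1 * 1"
        by (intro mult_mono) auto
      then show ?thesis by (simp add: std_normal_density_def)
    qed
    have "(LINT z|lborel. ?b x z) powr s * (LINT z|lborel. ?c x z) powr (1 - s) \<le> (LINT z|lborel. ?a x z)"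
    proof (rule prekopa_leindler_directions[where K = "max KB KC", OF _ _ _ _ _ _ _ _ s])
      show "?b x z \<le> max KB KC" "?c x z \<le> max KB KC" for z
      proof -
        have "?b x z \<le> KB * 1" "?c x z \<le> KC * 1"
          using K resample_space[OF xb[OF x], of m k z] resample_space[OF xc[OF x], of m k z] \<phi>1[of z]
          by (intro mult_mono; force)+
        then show "?b x z \<le> max KB KC" "?c x z \<le> max KB KC" by auto
      qed
      show "AE w in lborel. AE p in lborel. ?b x (p + (1 - s) * w) powr s * ?c x (p - s * w) powr (1 - s) \<le> ?a x p"
        using AEwp by simp
    qed (use bnn[OF x] cnn[OF x] ann[OF x] integrable_lborel_resample[OF _ k] bm x xb[OF x] xc[OF x] in auto)
    also have "\<dots> = avg m k A x / ?\<kappa>"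
      using integrable_lborel_resample[OF bm(1) k x] by simp
    finally have 1: "?\<kappa> * (avg m k B (?xb x) powr s * avg m k C (?xc x) powr (1 - s)) \<le> avg m k A x"
      using integrable_lborel_resample(2)[OF bm(2) k xb[OF x]] integrable_lborel_resample(2)[OF bm(3) k xc[OF x]]
      by (simp add: field_simps)
    \<comment> \<open>The averages do not depend on \<open>y k\<close>, whereas the weight decreases
      with its size; so the inequality for \<open>?y0\<close> is the strongest one and implies that
      for \<open>y\<close>.\<close>
    have "?N ?y0 \<le> ?N y" using sum_squares_upd[OF k, of y "y k"] by simp
    then have "exp (- 1/2 * s * (1 - s) * ?N y) \<le> ?\<kappa>" using s by (simp add: mult_left_mono)
    then have "exp (- 1/2 * s * (1 - s) * ?N y) * (avg m k B (?xb x) powr s * avg m k C (?xc x) powr (1 - s))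
      \<le> ?\<kappa> * (avg m k B (?xb x) powr s * avg m k C (?xc x) powr (1 - s))"
      by (intro mult_right_mono) auto
    also have "\<dots> \<le> avg m k A x" by (rule 1)
    finally show "exp (- 1/2 * s * (1 - s) * ?N y)
       * (avg m k B (path_add x (\<lambda>t. (1 - s) *\<^sub>R step_path m y t)) powr s
       * avg m k C (path_add x (\<lambda>t. (- s) *\<^sub>R step_path m y t)) powr (1 - s)) \<le> avg m k A x"
      by (simp only: avg_step_path[OF k, of _ _ _ y])
  qed
qed

end

section \<open>Averages over all directions after a grid time\<close>

definition dirs :: "nat \<Rightarrow> nat \<Rightarrow> (nat \<times> 'n::finite) list" where
  "dirs m l = (SOME ks. set ks = {l..<m} \<times> UNIV)"

lemma set_dirs: "set (dirs m l :: (nat \<times> 'n::finite) list) = {l..<m} \<times> UNIV"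
  unfolding dirs_def by (rule someI_ex) (rule finite_list, simp)

lemma dirs_less: "\<forall>k\<in>set (dirs m l :: (nat \<times> 'n::finite) list). fst k < m"
  by (auto simp: set_dirs)

lemma dirs_grid_le: "0 < m \<Longrightarrow> \<forall>k\<in>set (dirs m l :: (nat \<times> 'n::finite) list). grid m l \<le> grid m (fst k)"
  by (auto simp: set_dirs divide_right_mono)

lemma bdd_meas_iter_avg_dirs: "bdd_meas f \<Longrightarrow> bdd_meas (iter_avg m (dirs m l) f)"
  by (rule bdd_meas_iter_avg[OF _ dirs_less])

lemma iter_avg_add_sum:
  assumes "\<forall>k\<in>set ks. fst k < m" "finite K" "K \<subseteq> set ks" "x \<in> space path_space"
  shows "iter_avg m ks f (path_add x (\<lambda>s. \<Sum>k\<in>K. c k *\<^sub>R dir m k s)) = iter_avg m ks f x"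
  using assms(2-4)
proof (induction K)
  case empty
  have "path_add x (\<lambda>s. \<Sum>k\<in>{}. c k *\<^sub>R dir m k s) = x"
    using empty.prems by (intro path_eqI) (auto simp: path_add_apply space_path_space_iff)
  then show ?case by simp
next
  case (insert k K)
  have sp: "path_add x (\<lambda>s. \<Sum>k\<in>K. c k *\<^sub>R dir m k s) \<in> space path_space"
    using insert.prems by (intro path_add_space continuous_intros continuous_on_dir)
  have "path_add x (\<lambda>s. \<Sum>k\<in>insert k K. c k *\<^sub>R dir m k s)
    = path_add (path_add x (\<lambda>s. \<Sum>k\<in>K. c k *\<^sub>R dir m k s)) (\<lambda>s. c k *\<^sub>R dir m k s)"
    using insert.hyps by (simp add: path_add_add add.commute)
  then show ?case
    using insert iter_avg_invariant[OF assms(1) _ sp, of k f "c k"] by simp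
qed

lemma vec_sum_axis: "(\<Sum>i\<in>UNIV. (v $ i) *\<^sub>R axis i 1) = (v :: real ^ 'n::finite)"
  by (simp add: vec_eq_iff axis_def if_distrib cong: if_cong)

lemma sum_increments_to_grid:
  fixes f :: "nat \<Rightarrow> 'a::real_vector"
  assumes "l \<le> m"
  shows "(\<Sum>j\<in>{l..<m}. if j < p then f (Suc j) - f j else 0) = (if l \<le> p then f (min p m) - f l else 0)"
  using assms
proof (induction m rule: dec_induct)
  case (step n)
  then show ?case by (cases "n < p") (auto simp: min_def le_Suc_eq)
qed (simp add: min_def)

text \<open>Removing all increments after time \<open>grid m l\<close> turns the path, seen on the grid, into the stopped path.\<close>

lemma iter_avg_dirs_stop:
  assumes f: "grid_fun m f" and l: "l \<le> m" "0 < m" and x: "x \<in> space path_space"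
  shows "iter_avg m (dirs m l) f x = iter_avg m (dirs m l) f (path_stop (grid m l) x)"
proof -
  let ?K = "{l..<m} \<times> (UNIV :: 'a set)"
  let ?x = "path_add x (\<lambda>s. \<Sum>k\<in>?K. (- coef m k x) *\<^sub>R dir m k s)"
  have "iter_avg m (dirs m l) f x = iter_avg m (dirs m l) f ?x"
    by (rule iter_avg_add_sum[symmetric]) (use x in \<open>auto simp: set_dirs\<close>)
  also have "\<dots> = iter_avg m (dirs m l) f (path_stop (grid m l) x)"
  proof -
    have "?x (grid m p) = path_stop (grid m l) x (grid m p)" if p: "p \<le> m" for p
    proof -
      have g: "grid m p \<in> {0..1}" using p l by auto
      have r: "ramp (grid m j) (grid m (Suc j)) (grid m p) = (if j < p then 1 / real m else 0)" for j
      proof (cases "j < p")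
        case True
        then have "grid m (Suc j) \<le> grid m p" using l by (intro divide_right_mono) auto
        moreover have "grid m (Suc j) - grid m j = 1 / real m" by (simp add: diff_divide_distrib[symmetric])
        ultimately show ?thesis using True unfolding ramp_def by (simp add: min_def del: of_nat_Suc)
      next
        case False
        then have "grid m p \<le> grid m j" using l by (intro divide_right_mono) auto
        then have "min (grid m p) (grid m (Suc j)) - grid m j \<le> 0" by linarith
        then show ?thesis using False unfolding ramp_def by simp
      qed
      have "(\<Sum>k\<in>?K. (- coef m k x) *\<^sub>R dir m k (grid m p))
        = (\<Sum>j\<in>{l..<m}. \<Sum>i\<in>UNIV. (- coef m (j, i) x) *\<^sub>R dir m (j, i) (grid m p))"
        by (simp add: sum.cartesian_product case_prod_beta)
      also have "\<dots> = (\<Sum>j\<in>{l..<m}. if j < p then - (x (grid m (Suc j)) - x (grid m j)) else 0)"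
      proof (rule sum.cong[OF refl])
        fix j
        have "(- coef m (j, i) x) *\<^sub>R dir m (j, i) (grid m p)
          = (if j < p then - (((x (grid m (Suc j)) - x (grid m j)) $ i) *\<^sub>R axis i 1) else 0)" for i
        proof -
          have "- (sqrt (real m) * v) * (sqrt (real m) * (1 / real m)) = - v" for v
          proof -
            have "- (sqrt (real m) * v) * (sqrt (real m) * (1 / real m)) = - ((sqrt (real m) * sqrt (real m)) * v / real m)"
            proof -
              have "- (q * v) * (q * i) = - ((q * q) * v * i)" for q i :: real by algebra
              from this[of "sqrt (real m)" "1 / real m"] show ?thesis by simp
            qed
            then show ?thesis using l by simp
          qed
          then show ?thesis
            unfolding dir_def coef_def fst_conv snd_conv r by (cases "j < p") (simp_all only: scaleR_scaleR, simp_all add: scaleR_minus_left[symmetric] del: scaleR_minus_left)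
        qed
        moreover have "(\<Sum>i\<in>UNIV. - ((v $ i) *\<^sub>R axis i 1)) = - v" for v :: "real ^ 'a"
          by (simp only: sum_negf vec_sum_axis)
        ultimately show "(\<Sum>i\<in>UNIV. (- coef m (j, i) x) *\<^sub>R dir m (j, i) (grid m p))
          = (if j < p then - (x (grid m (Suc j)) - x (grid m j)) else 0)"
          by (cases "j < p") (simp_all only: if_True if_False sum.neutral_const)
      qed
      also have "\<dots> = (if l \<le> p then - x (grid m p) + x (grid m l) else 0)"
      proof -
        have "(\<Sum>j\<in>{l..<m}. if j < p then - (x (grid m (Suc j)) - x (grid m j)) else 0)
          = (\<Sum>j\<in>{l..<m}. if j < p then - x (grid m (Suc j)) - - x (grid m j) else 0)"
          by (rule sum.cong) auto
        also have "\<dots> = (if l \<le> p then - x (grid m (min p m)) - - x (grid m l) else 0)"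
          by (rule sum_increments_to_grid[OF l(1), where f = "\<lambda>j. - x (grid m j)"])
        finally show ?thesis using p by (simp only: min_absorb1 diff_minus_eq_add)
      qed
      finally have "?x (grid m p) = (if l \<le> p then x (grid m l) else x (grid m p))"
        using g by (simp add: path_add_apply)
      moreover have "min (grid m p) (grid m l) = (if l \<le> p then grid m l else grid m p)"
        using l by (auto simp: min_def divide_le_cancel)
      ultimately show ?thesis using g by (simp add: path_stop_apply)
    qed
    moreover have "?x \<in> space path_space" "path_stop (grid m l) x \<in> space path_space"
      using x by (auto intro!: path_stop_space path_add_space continuous_intros continuous_on_dir)
    ultimately show ?thesis
      using grid_fun_iter_avg[OF f dirs_less, of l] unfolding grid_fun_def by blast
  qed
  finally show ?thesis .
qed

lemma path_concat_stop:
  "0 \<le> t \<Longrightarrow> t \<le> r \<Longrightarrow> path_concat t (path_stop r x) x' = path_concat t x x'"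
  by (rule path_eqI) (auto simp: path_concat_apply path_stop_apply min_def)

lemma path_stop_concat:
  "0 \<le> t \<Longrightarrow> path_stop t (path_concat t x x') = path_stop t x"
  by (rule path_eqI) (auto simp: path_concat_apply path_stop_apply min_def)

context wiener
begin

text \<open>The explicit version of the conditional expectation given the past up to
  \<open>t\<close>. It is a function of \<open>t\<close> and the path, so a random time may be
  inserted.\<close>

definition future_avg :: "('n cpath \<Rightarrow> real) \<Rightarrow> real \<Rightarrow> 'n cpath \<Rightarrow> real" where
  "future_avg f t x = (LINT x'|\<mu>. f (path_concat t x x'))"

lemma future_avg_measurable:
  assumes f: "bdd_meas f" and Y: "Y \<in> M \<rightarrow>\<^sub>M path_space" and T: "T \<in> borel_measurable M"
    and T0: "\<And>\<omega>. \<omega> \<in> space M \<Longrightarrow> 0 \<le> T \<omega>"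
  shows "(\<lambda>\<omega>. future_avg f (T \<omega>) (Y \<omega>)) \<in> borel_measurable M"
  unfolding future_avg_def
proof (rule borel_measurable_lebesgue_integral)
  have snd: "snd \<in> M \<Otimes>\<^sub>M \<mu> \<rightarrow>\<^sub>M path_space"
    using measurable_snd[of M \<mu>] by (simp add: measurable_cong_sets[OF refl sets_mu])
  have "(\<lambda>p. path_concat (T (fst p)) (Y (fst p)) (snd p)) \<in> M \<Otimes>\<^sub>M \<mu> \<rightarrow>\<^sub>M path_space"
    by (rule measurable_path_concat[OF measurable_compose[OF measurable_fst Y] snd measurable_compose[OF measurable_fst T]])
      (use T0 in \<open>auto simp: space_pair_measure\<close>)
  from measurable_compose[OF this bdd_meas_measurable[OF f]]
  show "(\<lambda>(\<omega>, x'). f (path_concat (T \<omega>) (Y \<omega>) x')) \<in> borel_measurable (M \<Otimes>\<^sub>M \<mu>)"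
    by (simp add: case_prod_beta)
qed

lemma future_avg_bdd:
  assumes "\<And>x. x \<in> space path_space \<Longrightarrow> \<bar>f x\<bar> \<le> C" "bdd_meas f" "x \<in> space path_space" "0 \<le> t"
  shows "\<bar>future_avg f t x\<bar> \<le> C"
proof -
  have m: "(\<lambda>x'. f (path_concat t x x')) \<in> borel_measurable \<mu>"
    by (rule measurable_compose[OF measurable_path_concat[where Y = "\<lambda>_. x" and T = "\<lambda>_. t"] bdd_meas_measurable[OF assms(2)]])
      (use assms in \<open>auto simp: measurable_cong_sets[OF sets_mu refl]\<close>)
  have b: "\<bar>f (path_concat t x x')\<bar> \<le> C" if "x' \<in> space \<mu>" for x'
    using assms(1)[OF path_concat_space[OF assms(3) _ assms(4)]] that by (simp add: space_mu)
  have int: "integrable \<mu> (\<lambda>x'. f (path_concat t x x'))"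
    by (rule integrable_const_bound[of _ C]) (use b m in auto)
  have "\<bar>future_avg f t x\<bar> \<le> (LINT x'|\<mu>. \<bar>f (path_concat t x x')\<bar>)"
    unfolding future_avg_def by (rule integral_abs_bound)
  also have "\<dots> \<le> (LINT x'|\<mu>. C)"
    using int b by (intro integral_mono) auto
  finally show ?thesis by (simp add: prob_space)
qed

text \<open>Concatenation leaves the path up to \<open>t\<close> unchanged and preserves Wiener
  measure; this is the defining property of conditioning on the stopped path.\<close>

lemma integral_future_avg:
  assumes f: "bdd_meas f" and g: "bdd_meas g" and t: "0 \<le> t" "t \<le> 1"
  shows "(LINT x|\<mu>. future_avg f t x * g (path_stop t x)) = (LINT x|\<mu>. f x * g (path_stop t x))"
proof -
  interpret P: pair_prob_space \<mu> \<mu> ..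
  let ?h = "\<lambda>x. f x * g (path_stop t x)"
  have h: "bdd_meas ?h" by (intro bdd_meas_mult f bdd_meas_stop[OF g t(1)])
  obtain C where C: "\<forall>x\<in>space path_space. \<bar>?h x\<bar> \<le> C" using h by (auto simp: bdd_meas_def)
  have Y: "(\<lambda>(x, x'). path_concat t x x') \<in> \<mu> \<Otimes>\<^sub>M \<mu> \<rightarrow>\<^sub>M path_space"
    unfolding case_prod_beta
    by (rule measurable_path_concat)
      (use t measurable_fst[of \<mu> \<mu>] measurable_snd[of \<mu> \<mu>] in \<open>auto simp: measurable_cong_sets[OF refl sets_mu]\<close>)
  have hm: "(\<lambda>p. ?h (case p of (x, x') \<Rightarrow> path_concat t x x')) \<in> borel_measurable (\<mu> \<Otimes>\<^sub>M \<mu>)"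
    by (rule measurable_compose[OF Y bdd_meas_measurable[OF h]])
  have "integrable (\<mu> \<Otimes>\<^sub>M \<mu>) (\<lambda>p. ?h (case p of (x, x') \<Rightarrow> path_concat t x x'))"
    by (rule P.integrable_const_bound[of _ C]) (use C measurable_space[OF Y] hm in \<open>auto simp del: abs_mult\<close>)
  from P.integral_fst'[OF this]
  have "(LINT x|\<mu>. LINT x'|\<mu>. ?h (path_concat t x x')) = (LINT p|(\<mu> \<Otimes>\<^sub>M \<mu>). ?h (case p of (x, x') \<Rightarrow> path_concat t x x'))"
    by simp
  also have "\<dots> = (LINT x|distr (\<mu> \<Otimes>\<^sub>M \<mu>) path_space (\<lambda>(x, x'). path_concat t x x'). ?h x)"
    by (rule integral_distr[OF Y bdd_meas_measurable[OF h], symmetric])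
  also have "\<dots> = (LINT x|\<mu>. ?h x)" by (simp only: distr_concat[OF t])
  finally show ?thesis
    by (simp add: path_stop_concat[OF t(1)] future_avg_def)
qed

lemma integral_iter_avg_stop:
  assumes f: "bdd_meas f" and g: "bdd_meas g" and m: "0 < m"
  shows "(LINT x|\<mu>. iter_avg m (dirs m l) f x * g (path_stop (grid m l) x)) = (LINT x|\<mu>. f x * g (path_stop (grid m l) x))"
proof -
  have "(LINT x|\<mu>. iter_avg m (dirs m l) f x * g (path_stop (grid m l) x))
    = (LINT x|\<mu>. iter_avg m (dirs m l) (\<lambda>x. f x * g (path_stop (grid m l) x)) x)"
    by (simp only: iter_avg_mult_stop[OF _ dirs_grid_le[OF m]] divide_nonneg_nonneg of_nat_0_le_iff)
  also have "\<dots> = (LINT x|\<mu>. f x * g (path_stop (grid m l) x))"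
    by (rule integral_iter_avg[OF _ dirs_less]) (intro bdd_meas_mult f bdd_meas_stop[OF g], simp)
  finally show ?thesis .
qed

text \<open>Both sides depend on the stopped path alone and have the same integrals against bounded
  functions of it. Testing with the sign of their difference gives \<open>L^1\<close> distance
  0.\<close>

lemma iter_avg_dirs_eq_future_avg:
  assumes f: "bdd_meas f" and gf: "grid_fun m f" and l: "l \<le> m" "0 < m"
  shows "AE x in \<mu>. iter_avg m (dirs m l) f x = future_avg f (grid m l) x"
proof -
  let ?t = "grid m l"
  let ?H = "iter_avg m (dirs m l) f" and ?K = "future_avg f ?t"
  have t: "0 \<le> ?t" "?t \<le> 1" using l by auto
  have H: "bdd_meas ?H" by (rule bdd_meas_iter_avg_dirs[OF f])
  have K: "bdd_meas ?K"
  proof -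
    obtain C where "\<forall>x\<in>space path_space. \<bar>f x\<bar> \<le> C" using f by (auto simp: bdd_meas_def)
    then show ?thesis
      by (intro bdd_measI[of _ C] future_avg_bdd future_avg_measurable f) (use t f in auto)
  qed
  let ?g = "\<lambda>x. sgn (?H x - ?K x)"
  have g: "bdd_meas ?g"
    by (rule bdd_measI[of _ 1])
      (use bdd_meas_measurable[OF H] bdd_meas_measurable[OF K] in \<open>auto simp: abs_sgn_eq\<close>)
  have gs: "?g (path_stop ?t x) = ?g x" if "x \<in> space path_space" for x
    using iter_avg_dirs_stop[OF gf l that] path_concat_stop[OF t(1) order_refl, of x] by (simp add: future_avg_def)
  have "(LINT x|\<mu>. \<bar>?H x - ?K x\<bar>) = (LINT x|\<mu>. ?H x * ?g (path_stop ?t x) - ?K x * ?g (path_stop ?t x))"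
  proof (rule Bochner_Integration.integral_cong[OF refl])
    fix x assume "x \<in> space \<mu>"
    then have "?g (path_stop ?t x) = ?g x" by (intro gs) (simp add: space_mu)
    then show "\<bar>?H x - ?K x\<bar> = ?H x * ?g (path_stop ?t x) - ?K x * ?g (path_stop ?t x)"
      by (simp only: left_diff_distrib[symmetric]) (simp add: abs_sgn)
  qed
  also have "\<dots> = (LINT x|\<mu>. ?H x * ?g (path_stop ?t x)) - (LINT x|\<mu>. ?K x * ?g (path_stop ?t x))"
    by (intro Bochner_Integration.integral_diff bdd_meas_integrable bdd_meas_mult H K bdd_meas_stop[OF g t(1)])
  also have "\<dots> = 0"
    unfolding integral_iter_avg_stop[OF f g l(2)] integral_future_avg[OF f g t] by simp
  finally have "(LINT x|\<mu>. \<bar>?H x - ?K x\<bar>) = 0" .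
  moreover have "integrable \<mu> (\<lambda>x. \<bar>?H x - ?K x\<bar>)"
    by (intro bdd_meas_integrable bdd_meas_abs bdd_meas_diff H K)
  ultimately have "AE x in \<mu>. \<bar>?H x - ?K x\<bar> = 0"
    by (subst (asm) integral_nonneg_eq_0_iff_AE) auto
  then show ?thesis by eventually_elim simp
qed

lemma pl_condition_iter_avg:
  assumes pl: "pl_condition \<mu> m s A B C" and s: "0 < s" "s < 1"
    and bm: "bdd_meas A" "bdd_meas B" "bdd_meas C"
    and nn: "\<And>x. x \<in> space path_space \<Longrightarrow> 0 \<le> A x" "\<And>x. x \<in> space path_space \<Longrightarrow> 0 \<le> B x"
      "\<And>x. x \<in> space path_space \<Longrightarrow> 0 \<le> C x"
    and ks: "\<forall>k\<in>set ks. fst k < m"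
  shows "pl_condition \<mu> m s (iter_avg m ks A) (iter_avg m ks B) (iter_avg m ks C)"
  using ks
proof (induction ks)
  case (Cons k ks)
  have nn': "0 \<le> iter_avg m ks f x" if "bdd_meas f" "\<And>x. x \<in> space path_space \<Longrightarrow> 0 \<le> f x" "x \<in> space path_space" for f x
  proof -
    have "iter_avg m ks (\<lambda>x. \<bar>f x\<bar>) x \<le> iter_avg m ks f x"
      using Cons.prems that by (intro iter_avg_mono bdd_meas_abs) auto
    moreover have "\<bar>iter_avg m ks f x\<bar> \<le> iter_avg m ks (\<lambda>x. \<bar>f x\<bar>) x"
      using Cons.prems that by (intro abs_iter_avg_le) auto
    ultimately show ?thesis by linarith
  qed
  show ?case
    unfolding iter_avg_simps
    by (intro pl_condition_avg s bdd_meas_iter_avg bm nn' nn) (use Cons in auto)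
qed (use pl in simp)

lemma pl_conditionD:
  assumes "pl_condition \<mu> m s A B C"
  shows "AE x in \<mu>. B x powr s * C x powr (1 - s) \<le> A x"
proof -
  have z: "path_add x (\<lambda>t. r *\<^sub>R step_path m (\<lambda>_. 0) t) = x" if "x \<in> space path_space" for x and r :: real
    using that by (intro path_eqI) (auto simp: path_add_apply step_path_def space_path_space_iff)
  have "AE x in \<mu>. exp (- 1/2 * s * (1 - s) * (\<Sum>k\<in>{..<m} \<times> (UNIV :: 'n set). (0::real)\<^sup>2))
       * (B (path_add x (\<lambda>t. (1 - s) *\<^sub>R step_path m (\<lambda>_. 0) t)) powr s
       * C (path_add x (\<lambda>t. (- s) *\<^sub>R step_path m (\<lambda>_. 0) t)) powr (1 - s)) \<le> A x"
    using assms[unfolded pl_condition_def, rule_format, of "\<lambda>_. 0"] .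
  then show ?thesis
    by (rule AE_mp[OF _ AE_I2[OF impI]]) (simp only: z space_mu, simp)
qed

end

section \<open>Averages over the future of a stopping time\<close>

text \<open>The filtration enters through \<beta>: \<open>beta_adapted\<close> and
  \<open>F_generated\<close> say that up to null sets the events of \<open>F t\<close> are those of
  the path of \<beta> stopped at \<open>t\<close>. By \<open>F_full\<close> this includes every
  event of \<open>M\<close> at time 1.\<close>

locale stopped_brownian = prob_space M + filtration "space M" F
  for M :: "'a measure" and F :: "real \<Rightarrow> 'a measure" +
  fixes \<beta> :: "'a \<Rightarrow> 'n::finite cpath" and \<tau> :: "'a \<Rightarrow> real"
  assumes F_sub: "\<And>t. sets (F t) \<subseteq> sets M"
    and F_full: "\<And>t. 1 \<le> t \<Longrightarrow> sets (F t) = sets M"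
    and beta_measurable: "\<beta> \<in> M \<rightarrow>\<^sub>M path_space"
    and beta_law: "wiener (distr M path_space \<beta>)"
    and beta_adapted: "\<And>t. t \<in> {0..1} \<Longrightarrow> (\<lambda>w. path_stop t (\<beta> w)) \<in> F t \<rightarrow>\<^sub>M path_space"
    and F_generated: "\<And>t S. t \<in> {0..1} \<Longrightarrow> S \<in> sets (F t) \<Longrightarrow>
      \<exists>T\<in>sets path_space. AE w in M. w \<in> S \<longleftrightarrow> path_stop t (\<beta> w) \<in> T"
    and stopping: "stopping_time F \<tau>"
    and tau_nonneg: "\<And>w. w \<in> space M \<Longrightarrow> 0 \<le> \<tau> w"
begin

abbreviation law :: "'n cpath measure" where
  "law \<equiv> distr M path_space \<beta>"

abbreviation F\<tau> :: "'a measure" where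
  "F\<tau> \<equiv> pre_sigma \<tau>"

sublocale W: wiener law by (rule beta_law)

lemma beta_space: "w \<in> space M \<Longrightarrow> \<beta> w \<in> space path_space"
  by (rule measurable_space[OF beta_measurable])

lemma tau_le_sets: "{w \<in> space M. \<tau> w \<le> t} \<in> sets (F t)"
  using stopping_timeD[OF stopping, of t] by (simp add: pred_def space_F)

lemma tau_measurable: "\<tau> \<in> borel_measurable M"
  using tau_le_sets F_sub by (intro borel_measurableI_le) blast

lemma stopped_sets_le: "S \<in> sets F\<tau> \<Longrightarrow> {w \<in> S. \<tau> w \<le> t} \<in> sets (F t)"
  by (rule sets_pre_sigmaD[OF stopping])

lemma stopped_sets_M:
  assumes S: "S \<in> sets F\<tau>"
  shows "S \<in> sets M"
proof -
  have "S = (\<Union>n::nat. {w \<in> S. \<tau> w \<le> real n})"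
    using real_arch_simple by auto
  moreover have "{w \<in> S. \<tau> w \<le> real n} \<in> sets M" for n
    using stopped_sets_le[OF S] F_sub by blast
  ultimately show ?thesis by (metis (no_types, lifting) sets.countable_UN image_subsetI)
qed

lemma subalgebra_F\<tau>: "subalgebra M F\<tau>"
  unfolding subalgebra_def using stopped_sets_M by (auto simp: space_pre_sigma)

sublocale C: finite_measure_subalgebra M F\<tau>
  by unfold_locales (rule subalgebra_F\<tau>)

text \<open>Rounding up, not down, makes \<open>level m w = l\<close> an event of time
  \<open>grid m l\<close>. The cap at \<open>m\<close> takes care of the values of \<tau> above 1,
  which stand for infinity.\<close>

definition level :: "nat \<Rightarrow> 'a \<Rightarrow> nat" where
  "level m w = min m (nat \<lceil>real m * \<tau> w\<rceil>)"

lemma level_le: "level m w \<le> m"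
  by (simp add: level_def)

lemma nat_ceiling_le_iff:
  assumes "0 < m" "w \<in> space M"
  shows "nat \<lceil>real m * \<tau> w\<rceil> \<le> l \<longleftrightarrow> \<tau> w \<le> grid m l"
proof -
  have "nat \<lceil>real m * \<tau> w\<rceil> \<le> l \<longleftrightarrow> real m * \<tau> w \<le> real l"
    by (simp add: nat_le_iff ceiling_le_iff)
  then show ?thesis using assms by (simp add: pos_le_divide_eq mult.commute)
qed

lemma if_sets: "X \<in> sets N \<Longrightarrow> (if b then {} else X) \<in> sets N"
  by simp

lemma level_sets:
  assumes S: "S \<in> sets F\<tau>" and l: "l \<le> m" "0 < m"
  shows "{w \<in> S. level m w = l} \<in> sets (F (grid m l))"
proof (cases "l = m")
  \<comment> \<open>The last level collects all large values of \<tau>; it belongs to time 1, where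
    \<open>F_full\<close> provides every event.\<close>
  case True
  have [measurable]: "\<tau> \<in> borel_measurable M" by (rule tau_measurable)
  have "(\<lambda>w. level m w) \<in> M \<rightarrow>\<^sub>M count_space UNIV"
    unfolding level_def by measurable
  then have "{w \<in> space M. level m w = l} \<in> sets M" by measurable
  then have "S \<inter> {w \<in> space M. level m w = l} \<in> sets M"
    using stopped_sets_M[OF S] by auto
  moreover have "S \<inter> {w \<in> space M. level m w = l} = {w \<in> S. level m w = l}"
    using sets.sets_into_space[OF stopped_sets_M[OF S]] by auto
  ultimately show ?thesis using True l F_full[of "grid m l"] by simp
next
  case False
  have SM: "S \<subseteq> space M" using sets.sets_into_space[OF stopped_sets_M[OF S]] .
  have eq: "{w \<in> S. level m w = l} = {w \<in> S. \<tau> w \<le> grid m l} - (if l = 0 then {} else {w \<in> S. \<tau> w \<le> grid m (l - 1)})"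
  proof -
    have *: "level m w = l \<longleftrightarrow> \<tau> w \<le> grid m l \<and> (l = 0 \<or> \<not> \<tau> w \<le> grid m (l - 1))" if "w \<in> S" for w
    proof -
      have w: "w \<in> space M" using SM that by auto
      have "min m n = l \<longleftrightarrow> n \<le> l \<and> (l = 0 \<or> \<not> n \<le> l - 1)" for n
        using False l by (cases "l = 0") (auto simp: min_def)
      then have "level m w = l \<longleftrightarrow> nat \<lceil>real m * \<tau> w\<rceil> \<le> l \<and> (l = 0 \<or> \<not> nat \<lceil>real m * \<tau> w\<rceil> \<le> l - 1)"
        unfolding level_def .
      then show ?thesis unfolding nat_ceiling_le_iff[OF l(2) w] .
    qed
    have split: "{w \<in> S. P w} = {w \<in> S. Q w} - (if b then {} else {w \<in> S. R w})"
      if "\<And>w. w \<in> S \<Longrightarrow> P w \<longleftrightarrow> Q w \<and> (b \<or> \<not> R w)" for P Q R and b :: bool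
      using that by auto
    show ?thesis by (rule split[OF *])
  qed
  have "{w \<in> S. \<tau> w \<le> grid m (l - 1)} \<in> sets (F (grid m l))"
  proof -
    have "grid m (l - 1) \<le> grid m l" by (intro divide_right_mono) auto
    from subsetD[OF sets_F_mono[OF this] stopped_sets_le[OF S]] show ?thesis .
  qed
  then have "(if l = 0 then {} else {w \<in> S. \<tau> w \<le> grid m (l - 1)}) \<in> sets (F (grid m l))"
    by (rule if_sets)
  then show ?thesis unfolding eq by (rule sets.Diff[OF stopped_sets_le[OF S]])
qed

text \<open>Not an \<open>F\<tau>\<close>-measurable function yet: it sees the path between \<tau>
  and its rounding, and later deviations from linear interpolation inside grid intervals. Both
  effects fade out only as the mesh tends to 0.\<close>

definition approx :: "nat \<Rightarrow> ('n cpath \<Rightarrow> real) \<Rightarrow> 'a \<Rightarrow> real" where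
  "approx m f w = iter_avg m (dirs m (level m w)) f (\<beta> w)"

lemma bdd_comp_integrable:
  assumes "bdd_meas f"
  shows "integrable M (\<lambda>w. f (\<beta> w))"
  by (rule integrable_distr[OF beta_measurable W.bdd_meas_integrable[OF assms]])

lemma bdd_comp_integral:
  assumes "bdd_meas f"
  shows "(LINT w|M. f (\<beta> w)) = (LINT x|law. f x)"
  by (rule integral_distr[OF beta_measurable bdd_meas_measurable[OF assms], symmetric])

lemma integrable_indicator_mult:
  assumes "S \<in> sets M" "integrable M g"
  shows "integrable M (\<lambda>w. indicator S w * g w :: real)"
  using integrable_mult_indicator[OF assms] by simp

lemma approx_sum:
  assumes "S \<subseteq> space M"
  shows "indicator S w * approx m f w = (\<Sum>l\<le>m. indicator {w \<in> S. level m w = l} w * iter_avg m (dirs m l) f (\<beta> w))"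
proof -
  have "(\<Sum>l\<le>m. indicator {w \<in> S. level m w = l} w * iter_avg m (dirs m l) f (\<beta> w))
    = (\<Sum>l\<le>m. if l = level m w then indicator S w * iter_avg m (dirs m l) f (\<beta> w) else 0)"
    by (rule sum.cong) (auto simp: indicator_def)
  then show ?thesis using level_le[of m w] by (simp add: approx_def)
qed

lemma approx_integrable:
  assumes f: "bdd_meas f" and m: "0 < m"
  shows "integrable M (approx m f)"
proof -
  have top: "space M \<in> sets F\<tau>" using sets.top[of F\<tau>] by (simp add: space_pre_sigma)
  have "integrable M (\<lambda>w. \<Sum>l\<le>m. indicator {w \<in> space M. level m w = l} w * iter_avg m (dirs m l) f (\<beta> w))"
    using level_sets[OF top _ m] F_sub
    by (intro Bochner_Integration.integrable_sum integrable_indicator_mult bdd_comp_integrable bdd_meas_iter_avg_dirs f) blast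
  then have "integrable M (\<lambda>w. indicator (space M) w * approx m f w)"
    by (simp only: approx_sum[OF order_refl])
  then show ?thesis
    by (rule Bochner_Integration.integrable_cong[THEN iffD1, rotated -1]) auto
qed

text \<open>On \<open>level m w = l\<close> the event is almost surely a set of paths stopped at
  \<open>grid m l\<close>, against which averages over later directions keep all integrals.
  Summation over \<open>l\<close> gives the claim.\<close>

lemma integral_approx_indicator:
  assumes f: "bdd_meas f" and m: "0 < m" and S: "S \<in> sets F\<tau>"
  shows "(LINT w|M. indicator S w * approx m f w) = (LINT w|M. indicator S w * f (\<beta> w))"
proof -
  have SM: "S \<subseteq> space M" using sets.sets_into_space[OF stopped_sets_M[OF S]] .
  let ?D = "\<lambda>l. {w \<in> S. level m w = l}"
  have DM: "?D l \<in> sets M" if "l \<le> m" for l using level_sets[OF S that m] F_sub by blast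
  have int: "integrable M (\<lambda>w. indicator (?D l) w * g (\<beta> w))" if "l \<le> m" "bdd_meas g" for g l
    using that by (intro integrable_indicator_mult DM bdd_comp_integrable)
  have each: "(LINT w|M. indicator (?D l) w * iter_avg m (dirs m l) f (\<beta> w)) = (LINT w|M. indicator (?D l) w * f (\<beta> w))"
    if l: "l \<le> m" for l
  proof -
    have g01: "grid m l \<in> {0..1}" using l m by auto
    obtain T where T: "T \<in> sets path_space" "AE w in M. w \<in> ?D l \<longleftrightarrow> path_stop (grid m l) (\<beta> w) \<in> T"
      using F_generated[OF g01 level_sets[OF S l m]] by blast
    have bT: "bdd_meas (indicator T :: 'n cpath \<Rightarrow> real)" using T(1) by (intro bdd_measI[of _ 1]) auto
    have key: "(LINT w|M. indicator (?D l) w * g (\<beta> w)) = (LINT x|law. g x * indicator T (path_stop (grid m l) x))"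
      if g: "bdd_meas g" for g
    proof -
      have b: "bdd_meas (\<lambda>x. g x * indicator T (path_stop (grid m l) x))"
        by (intro bdd_meas_mult g bdd_meas_stop[OF bT]) simp
      have "(LINT w|M. indicator (?D l) w * g (\<beta> w)) = (LINT w|M. g (\<beta> w) * indicator T (path_stop (grid m l) (\<beta> w)))"
      proof (rule integral_cong_AE)
        show "(\<lambda>w. indicator (?D l) w * g (\<beta> w)) \<in> borel_measurable M"
          using int[OF l g] by auto
        show "(\<lambda>w. g (\<beta> w) * indicator T (path_stop (grid m l) (\<beta> w))) \<in> borel_measurable M"
          using bdd_comp_integrable[OF b] by auto
        show "AE w in M. indicator (?D l) w * g (\<beta> w) = g (\<beta> w) * indicator T (path_stop (grid m l) (\<beta> w))"
          using T(2) by eventually_elim (auto simp: indicator_def)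
      qed
      then show ?thesis by (simp add: bdd_comp_integral[OF b])
    qed
    show ?thesis
      unfolding key[OF bdd_meas_iter_avg_dirs[OF f]] key[OF f] by (rule W.integral_iter_avg_stop[OF f bT m])
  qed
  have "(LINT w|M. indicator S w * approx m f w) = (\<Sum>l\<le>m. (LINT w|M. indicator (?D l) w * iter_avg m (dirs m l) f (\<beta> w)))"
    unfolding approx_sum[OF SM] by (intro Bochner_Integration.integral_sum int bdd_meas_iter_avg_dirs f) simp
  also have "\<dots> = (\<Sum>l\<le>m. (LINT w|M. indicator (?D l) w * f (\<beta> w)))"
    by (intro sum.cong refl each) simp
  also have "\<dots> = (LINT w|M. (\<Sum>l\<le>m. indicator (?D l) w * f (\<beta> w)))"
    by (intro Bochner_Integration.integral_sum[symmetric] int f) simp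
  also have "(\<lambda>w. \<Sum>l\<le>m. indicator (?D l) w * f (\<beta> w)) = (\<lambda>w. indicator S w * f (\<beta> w))"
  proof
    fix w
    have "(\<Sum>l\<le>m. indicator (?D l) w * f (\<beta> w)) = (\<Sum>l\<le>m. if l = level m w then indicator S w * f (\<beta> w) else 0)"
      by (rule sum.cong) (auto simp: indicator_def)
    then show "(\<Sum>l\<le>m. indicator (?D l) w * f (\<beta> w)) = indicator S w * f (\<beta> w)"
      using level_le[of m w] by simp
  qed
  finally show ?thesis .
qed

lemma integral_approx:
  assumes f: "bdd_meas f" and m: "0 < m"
  shows "(LINT w|M. approx m f w) = (LINT w|M. f (\<beta> w))"
proof -
  have top: "space M \<in> sets F\<tau>" using sets.top[of F\<tau>] by (simp add: space_pre_sigma)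
  have "(LINT w|M. indicator (space M) w * g w) = (LINT w|M. g w)" for g :: "'a \<Rightarrow> real"
    by (rule Bochner_Integration.integral_cong) auto
  with integral_approx_indicator[OF f m top] show ?thesis by simp
qed

text \<open>The averages are positive and preserve the integral, hence contract \<open>L^1\<close>,
  uniformly in \<open>m\<close>. This is what carries convergence over to limits of
  functions.\<close>

lemma approx_contraction:
  assumes f: "bdd_meas f" "bdd_meas g" and m: "0 < m"
  shows "(LINT w|M. \<bar>approx m f w - approx m g w\<bar>) \<le> (LINT x|law. \<bar>f x - g x\<bar>)"
proof -
  have d: "bdd_meas (\<lambda>x. \<bar>f x - g x\<bar>)" by (intro bdd_meas_abs bdd_meas_diff f)
  have "(LINT w|M. \<bar>approx m f w - approx m g w\<bar>) \<le> (LINT w|M. approx m (\<lambda>x. \<bar>f x - g x\<bar>) w)"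
  proof (intro integral_mono integrable_abs Bochner_Integration.integrable_diff approx_integrable d f m)
    fix w assume "w \<in> space M"
    then show "\<bar>approx m f w - approx m g w\<bar> \<le> approx m (\<lambda>x. \<bar>f x - g x\<bar>) w"
      unfolding approx_def
      using abs_iter_avg_le[OF bdd_meas_diff[OF f] dirs_less beta_space] iter_avg_diff[OF f dirs_less beta_space] by simp
  qed
  also have "\<dots> = (LINT x|law. \<bar>f x - g x\<bar>)"
    by (simp add: integral_approx[OF d m] bdd_comp_integral[OF d])
  finally show ?thesis .
qed

section \<open>Convergence of the averages in \<open>L^1\<close>\<close>

definition cexp :: "('n cpath \<Rightarrow> real) \<Rightarrow> 'a \<Rightarrow> real" where
  "cexp f = real_cond_exp M F\<tau> (\<lambda>w. f (\<beta> w))"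

lemma cexp_integrable: "bdd_meas f \<Longrightarrow> integrable M (cexp f)"
  unfolding cexp_def by (intro C.real_cond_exp_int bdd_comp_integrable)

lemma cexp_contraction:
  assumes f: "bdd_meas f" "bdd_meas g"
  shows "(LINT w|M. \<bar>cexp f w - cexp g w\<bar>) \<le> (LINT x|law. \<bar>f x - g x\<bar>)"
proof -
  let ?h = "\<lambda>w. f (\<beta> w) - g (\<beta> w)"
  have d: "bdd_meas (\<lambda>x. \<bar>f x - g x\<bar>)" by (intro bdd_meas_abs bdd_meas_diff f)
  have hi: "integrable M ?h" using bdd_comp_integrable[OF bdd_meas_diff[OF f]] .
  have ai: "integrable M (\<lambda>w. \<bar>?h w\<bar>)" using hi by (rule integrable_abs)
  have "AE w in M. \<bar>cexp f w - cexp g w\<bar> \<le> real_cond_exp M F\<tau> (\<lambda>w. \<bar>?h w\<bar>) w"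
  proof -
    have "AE w in M. real_cond_exp M F\<tau> ?h w \<le> real_cond_exp M F\<tau> (\<lambda>w. \<bar>?h w\<bar>) w"
      by (rule C.real_cond_exp_mono[OF _ hi ai]) auto
    moreover have "AE w in M. real_cond_exp M F\<tau> (\<lambda>w. - 1 * ?h w) w \<le> real_cond_exp M F\<tau> (\<lambda>w. \<bar>?h w\<bar>) w"
      by (rule C.real_cond_exp_mono[OF _ Bochner_Integration.integrable_mult_right ai]) (use hi in \<open>auto intro!: AE_I2\<close>)
    moreover have "AE w in M. real_cond_exp M F\<tau> (\<lambda>w. - 1 * ?h w) w = - 1 * real_cond_exp M F\<tau> ?h w"
      by (rule C.real_cond_exp_cmult[OF hi])
    moreover have "AE w in M. real_cond_exp M F\<tau> ?h w = cexp f w - cexp g w"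
      unfolding cexp_def by (rule C.real_cond_exp_diff) (intro bdd_comp_integrable f)+
    ultimately show ?thesis by eventually_elim auto
  qed
  then have "(LINT w|M. \<bar>cexp f w - cexp g w\<bar>) \<le> (LINT w|M. real_cond_exp M F\<tau> (\<lambda>w. \<bar>?h w\<bar>) w)"
    by (intro integral_mono_AE integrable_abs Bochner_Integration.integrable_diff cexp_integrable f C.real_cond_exp_int ai)
  also have "\<dots> = (LINT x|law. \<bar>f x - g x\<bar>)"
    using C.real_cond_exp_int(2)[OF ai] bdd_comp_integral[OF d] by simp
  finally show ?thesis .
qed

text \<open>The index \<open>Suc m\<close> excludes the empty grid, for which \<open>grid\<close>
  would divide by 0.\<close>

definition avg_converges :: "('n cpath \<Rightarrow> real) \<Rightarrow> bool" where
  "avg_converges f \<longleftrightarrow> bdd_meas f \<and> (\<lambda>m. LINT w|M. \<bar>approx (Suc m) f w - cexp f w\<bar>) \<longlonglongrightarrow> 0"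

lemma L1_triangle:
  fixes f g h :: "'a \<Rightarrow> real"
  assumes "integrable M f" "integrable M g" "integrable M h"
  shows "(LINT w|M. \<bar>f w - h w\<bar>) \<le> (LINT w|M. \<bar>f w - g w\<bar>) + (LINT w|M. \<bar>g w - h w\<bar>)"
proof -
  have "(LINT w|M. \<bar>f w - h w\<bar>) \<le> (LINT w|M. \<bar>f w - g w\<bar> + \<bar>g w - h w\<bar>)"
    using assms by (intro integral_mono) auto
  then show ?thesis using assms by (simp add: Bochner_Integration.integral_add)
qed

text \<open>Both contractions hold with a bound independent of \<open>m\<close>, so an argument with
  three thirds of \<open>e\<close> applies.\<close>

lemma avg_converges_limit:
  assumes f: "bdd_meas f" and g: "\<And>i. avg_converges (g i)"
    and lim: "(\<lambda>i. LINT x|law. \<bar>f x - g i x\<bar>) \<longlonglongrightarrow> 0"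
  shows "avg_converges f"
  unfolding avg_converges_def
proof (intro conjI f LIMSEQ_I)
  fix e :: real assume e: "0 < e"
  have gb: "bdd_meas (g i)" for i using g by (simp add: avg_converges_def)
  obtain i where i: "(LINT x|law. \<bar>f x - g i x\<bar>) < e / 3"
    using order_tendstoD(2)[OF lim, of "e / 3"] e by (auto simp: eventually_sequentially)
  have "(\<lambda>m. LINT w|M. \<bar>approx (Suc m) (g i) w - cexp (g i) w\<bar>) \<longlonglongrightarrow> 0" using g by (simp add: avg_converges_def)
  then obtain N where N: "\<And>m. N \<le> m \<Longrightarrow> (LINT w|M. \<bar>approx (Suc m) (g i) w - cexp (g i) w\<bar>) < e / 3"
    using order_tendstoD(2)[of _ 0 sequentially "e / 3"] e by (auto simp: eventually_sequentially)
  have "(LINT w|M. \<bar>approx (Suc m) f w - cexp f w\<bar>) < e" if "N \<le> m" for m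
  proof -
    have "(LINT w|M. \<bar>approx (Suc m) f w - cexp f w\<bar>)
      \<le> (LINT w|M. \<bar>approx (Suc m) f w - approx (Suc m) (g i) w\<bar>) + (LINT w|M. \<bar>approx (Suc m) (g i) w - cexp f w\<bar>)"
      by (intro L1_triangle approx_integrable cexp_integrable f gb) auto
    also have "(LINT w|M. \<bar>approx (Suc m) (g i) w - cexp f w\<bar>)
      \<le> (LINT w|M. \<bar>approx (Suc m) (g i) w - cexp (g i) w\<bar>) + (LINT w|M. \<bar>cexp (g i) w - cexp f w\<bar>)"
      by (intro L1_triangle approx_integrable cexp_integrable f gb) auto
    also have "(LINT w|M. \<bar>cexp (g i) w - cexp f w\<bar>) \<le> (LINT x|law. \<bar>f x - g i x\<bar>)"
      using cexp_contraction[OF f gb[of i]] by (simp add: abs_minus_commute)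
    also have "(LINT w|M. \<bar>approx (Suc m) f w - approx (Suc m) (g i) w\<bar>) \<le> (LINT x|law. \<bar>f x - g i x\<bar>)"
      by (intro approx_contraction f gb) simp
    finally show ?thesis using i N[OF that] by linarith
  qed
  then show "\<exists>N. \<forall>m\<ge>N. norm ((LINT w|M. \<bar>approx (Suc m) f w - cexp f w\<bar>) - 0) < e"
    by (intro exI[of _ N]) auto
qed

lemma avg_converges_diff:
  assumes f: "avg_converges f" and g: "avg_converges g"
  shows "avg_converges (\<lambda>x. f x - g x)"
  unfolding avg_converges_def
proof
  have b: "bdd_meas f" "bdd_meas g" using f g by (auto simp: avg_converges_def)
  show bd: "bdd_meas (\<lambda>x. f x - g x)" by (intro bdd_meas_diff b)
  have ce: "AE w in M. cexp (\<lambda>x. f x - g x) w = cexp f w - cexp g w"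
    unfolding cexp_def by (rule C.real_cond_exp_diff) (intro bdd_comp_integrable b)+
  have le: "(LINT w|M. \<bar>approx (Suc m) (\<lambda>x. f x - g x) w - cexp (\<lambda>x. f x - g x) w\<bar>)
    \<le> (LINT w|M. \<bar>approx (Suc m) f w - cexp f w\<bar>) + (LINT w|M. \<bar>approx (Suc m) g w - cexp g w\<bar>)" for m
  proof -
    have "(LINT w|M. \<bar>approx (Suc m) (\<lambda>x. f x - g x) w - cexp (\<lambda>x. f x - g x) w\<bar>)
      \<le> (LINT w|M. \<bar>approx (Suc m) f w - cexp f w\<bar> + \<bar>approx (Suc m) g w - cexp g w\<bar>)"
    proof (rule integral_mono_AE)
      show "AE w in M. \<bar>approx (Suc m) (\<lambda>x. f x - g x) w - cexp (\<lambda>x. f x - g x) w\<bar>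
          \<le> \<bar>approx (Suc m) f w - cexp f w\<bar> + \<bar>approx (Suc m) g w - cexp g w\<bar>"
        using ce AE_space
      proof eventually_elim
        case (elim w)
        have "approx (Suc m) (\<lambda>x. f x - g x) w = approx (Suc m) f w - approx (Suc m) g w"
          unfolding approx_def using iter_avg_diff[OF b dirs_less beta_space] elim by simp
        then show ?case using elim by simp
      qed
    qed (intro integrable_abs Bochner_Integration.integrable_add Bochner_Integration.integrable_diff approx_integrable cexp_integrable b bd; simp)+
    also have "\<dots> = (LINT w|M. \<bar>approx (Suc m) f w - cexp f w\<bar>) + (LINT w|M. \<bar>approx (Suc m) g w - cexp g w\<bar>)"
      by (intro Bochner_Integration.integral_add integrable_abs Bochner_Integration.integrable_diff approx_integrable cexp_integrable b) auto
    finally show ?thesis .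
  qed
  have lim: "(\<lambda>m. (LINT w|M. \<bar>approx (Suc m) f w - cexp f w\<bar>) + (LINT w|M. \<bar>approx (Suc m) g w - cexp g w\<bar>)) \<longlonglongrightarrow> 0"
    using f g unfolding avg_converges_def by (auto intro: tendsto_add_zero)
  show "(\<lambda>m. LINT w|M. \<bar>approx (Suc m) (\<lambda>x. f x - g x) w - cexp (\<lambda>x. f x - g x) w\<bar>) \<longlonglongrightarrow> 0"
  proof (rule tendsto_sandwich[OF _ _ tendsto_const lim])
    show "\<forall>\<^sub>F m in sequentially. 0 \<le> (LINT w|M. \<bar>approx (Suc m) (\<lambda>x. f x - g x) w - cexp (\<lambda>x. f x - g x) w\<bar>)"
      by (intro always_eventually allI Bochner_Integration.integral_nonneg abs_ge_zero)
  qed (intro always_eventually allI le)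
qed

text \<open>The map \<open>s\<close> allows the same product to be taken at the given times and at
  their roundings to the grid.\<close>

lemma prod_eval_bdd_meas:
  fixes g :: "real \<Rightarrow> real ^ 'n \<Rightarrow> real"
  assumes J: "finite J" "\<And>t. t \<in> J \<Longrightarrow> s t \<in> {0..1}" and g: "\<And>t. continuous_on UNIV (g t)" "\<And>t v. 0 \<le> g t v" "\<And>t v. g t v \<le> 1"
  shows "bdd_meas (\<lambda>x. \<Prod>t\<in>J. g t (x (s t)))" "0 \<le> (\<Prod>t\<in>J. g t (x (s t)))" "(\<Prod>t\<in>J. g t (x (s t))) \<le> 1"
proof -
  show b: "0 \<le> (\<Prod>t\<in>J. g t (x (s t)))" "(\<Prod>t\<in>J. g t (x (s t))) \<le> 1" for x :: "real \<Rightarrow> real ^ 'n"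
    using g(2,3) by (auto intro: prod_nonneg prod_le_1)
  have "(\<lambda>x. g t (x (s t))) \<in> borel_measurable path_space" if "t \<in> J" for t
    by (rule measurable_compose[OF measurable_path_eval[OF J(2)[OF that]] borel_measurable_continuous_onI[OF g(1)]])
  then show "bdd_meas (\<lambda>x. \<Prod>t\<in>J. g t (x (s t)))"
    using b by (intro bdd_measI[of _ 1] borel_measurable_prod) (auto simp: abs_le_iff intro: order_trans[of _ 0])
qed

lemma level_tendsto:
  assumes w: "w \<in> space M"
  shows "(\<lambda>m. grid (Suc m) (level (Suc m) w)) \<longlonglongrightarrow> min (\<tau> w) 1"
proof -
  have "(\<lambda>m. real (nat \<lceil>real (Suc m) * \<tau> w\<rceil>) / real (Suc m)) \<longlonglongrightarrow> \<tau> w"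
  proof (rule tendsto_sandwich)
    have "\<tau> w \<le> real (nat \<lceil>real (Suc m) * \<tau> w\<rceil>) / real (Suc m)"
      and "real (nat \<lceil>real (Suc m) * \<tau> w\<rceil>) / real (Suc m) \<le> \<tau> w + 1 / real (Suc m)" for m
    proof -
      have "0 \<le> real (Suc m) * \<tau> w" using tau_nonneg[OF w] by simp
      then have 1: "real (Suc m) * \<tau> w \<le> real (nat \<lceil>real (Suc m) * \<tau> w\<rceil>)"
        and 2: "real (nat \<lceil>real (Suc m) * \<tau> w\<rceil>) \<le> real (Suc m) * \<tau> w + 1" by linarith+
      show "\<tau> w \<le> real (nat \<lceil>real (Suc m) * \<tau> w\<rceil>) / real (Suc m)"
        using 1 by (simp only: pos_le_divide_eq of_nat_0_less_iff zero_less_Suc mult.commute)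
      have "real (nat \<lceil>real (Suc m) * \<tau> w\<rceil>) / real (Suc m) \<le> (real (Suc m) * \<tau> w + 1) / real (Suc m)"
        using 2 by (rule divide_right_mono) simp
      then show "real (nat \<lceil>real (Suc m) * \<tau> w\<rceil>) / real (Suc m) \<le> \<tau> w + 1 / real (Suc m)"
        by (simp add: add_divide_distrib)
    qed
    then show "\<forall>\<^sub>F m in sequentially. \<tau> w \<le> real (nat \<lceil>real (Suc m) * \<tau> w\<rceil>) / real (Suc m)"
      "\<forall>\<^sub>F m in sequentially. real (nat \<lceil>real (Suc m) * \<tau> w\<rceil>) / real (Suc m) \<le> \<tau> w + 1 / real (Suc m)"
      by auto
    show "(\<lambda>m. \<tau> w + 1 / real (Suc m)) \<longlonglongrightarrow> \<tau> w"
      using tendsto_add[OF tendsto_const LIMSEQ_Suc[OF lim_1_over_n]] by simp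
  qed simp
  then have "(\<lambda>m. min (real (nat \<lceil>real (Suc m) * \<tau> w\<rceil>) / real (Suc m)) 1) \<longlonglongrightarrow> min (\<tau> w) 1"
    by (intro tendsto_min tendsto_const)
  moreover have "grid (Suc m) (level (Suc m) w) = min (real (nat \<lceil>real (Suc m) * \<tau> w\<rceil>) / real (Suc m)) 1" for m
  proof -
    have "real (min a b) / real a = min (real b / real a) 1" if "0 < a" for a b :: nat
      using that by (auto simp: min_def)
    from this[OF zero_less_Suc] show ?thesis unfolding level_def .
  qed
  ultimately show ?thesis by simp
qed

lemma path_concat_tendsto:
  fixes x x' :: "'n cpath"
  assumes x: "x \<in> space path_space" "x' \<in> space path_space"
    and s: "s \<longlonglongrightarrow> s0" "\<And>m. s m \<in> {0..1::real}" "s0 \<in> {0..1}"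
    and t: "t \<longlonglongrightarrow> t0" "\<And>m. t m \<in> {0..1::real}" "t0 \<in> {0..1}"
  shows "(\<lambda>m. path_concat (t m) x x' (s m)) \<longlonglongrightarrow> path_concat t0 x x' s0"
proof -
  have c: "continuous_on {0..1} x" "continuous_on {0..1} x'" using x by (auto simp: space_path_space_iff)
  have lim: "(\<lambda>m. y (r m)) \<longlonglongrightarrow> y r0" if "continuous_on {0..1} y" "r \<longlonglongrightarrow> r0" "\<And>m. r m \<in> {0..1}" "r0 \<in> {0..1}"
    for y :: "real \<Rightarrow> real ^ 'n" and r r0
    by (rule continuous_on_tendsto_compose[OF that(1,2,4)]) (use that(3) in simp)
  have mn: "(\<lambda>m. min (s m) (t m)) \<longlonglongrightarrow> min s0 t0" "\<And>m. min (s m) (t m) \<in> {0..1}" "min s0 t0 \<in> {0..1}"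
    using s t by (auto intro: tendsto_min simp: min_le_iff_disj)
  show ?thesis
    unfolding path_concat_apply[OF s(2)] path_concat_apply[OF s(3)]
    by (intro tendsto_add tendsto_diff lim[of x "\<lambda>m. min (s m) (t m)"] lim[of x' s]
        lim[of x' "\<lambda>m. min (s m) (t m)"] c mn s)
qed

text \<open>On the event \<open>\<tau> w \<le> t\<close> concatenation at \<tau> reads the path only
  up to \<open>t\<close>, so the function agrees there with one that is measurable at time
  \<open>t\<close>. For \<open>t \<ge> 1\<close> every event is available, and for
  \<open>t < 0\<close> the event is empty.\<close>

lemma future_avg_stopped_measurable:
  assumes f: "bdd_meas f"
  shows "(\<lambda>w. W.future_avg f (min (\<tau> w) 1) (\<beta> w)) \<in> borel_measurable F\<tau>" (is "?L \<in> _")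
proof (rule borel_measurableI_le, rule sets_pre_sigmaI[OF stopping])
  fix y t
  have [measurable]: "\<tau> \<in> borel_measurable M" by (rule tau_measurable)
  have LM: "?L \<in> borel_measurable M"
    by (rule W.future_avg_measurable[OF f beta_measurable]) (use tau_nonneg in auto)
  show "{\<omega> \<in> {x \<in> space F\<tau>. ?L x \<le> y}. \<tau> \<omega> \<le> t} \<in> sets (F t)"
  proof (cases "t < 1")
    case False
    have "{x \<in> space M. ?L x \<le> y \<and> \<tau> x \<le> t} \<in> sets M" using LM by measurable
    moreover have "{\<omega> \<in> {x \<in> space F\<tau>. ?L x \<le> y}. \<tau> \<omega> \<le> t} = {x \<in> space M. ?L x \<le> y \<and> \<tau> x \<le> t}"
      by (auto simp: space_pre_sigma)
    ultimately show ?thesis using F_full[of t] False by simp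
  next
    case t1: True
    show ?thesis
    proof (cases "0 \<le> t")
      case False
      then have "{\<omega> \<in> {x \<in> space F\<tau>. ?L x \<le> y}. \<tau> \<omega> \<le> t} = {}"
        using tau_nonneg by (force simp: space_pre_sigma)
      then show ?thesis by (simp only: sets.empty_sets)
    next
      case True
      \<comment> \<open>Both the time and the path are stopped at \<open>t\<close>, which makes this
        measurable at time \<open>t\<close> on the whole space.\<close>
      let ?L' = "\<lambda>w. W.future_avg f (min (\<tau> w) t) (path_stop t (\<beta> w))"
      have mt: "(\<lambda>w. min (\<tau> w) t) \<in> borel_measurable (F t)"
      proof (rule borel_measurableI_le)
        fix c
        show "{w \<in> space (F t). min (\<tau> w) t \<le> c} \<in> sets (F t)"
        proof (cases "t \<le> c")
          case True
          then have "{w \<in> space (F t). min (\<tau> w) t \<le> c} = space (F t)" by auto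
          then show ?thesis by simp
        next
          case False
          then have "{w \<in> space (F t). min (\<tau> w) t \<le> c} = {w \<in> space M. \<tau> w \<le> c}"
            by (auto simp: space_F min_le_iff_disj)
          then show ?thesis using tau_le_sets[of c] sets_F_mono[of c t] False by auto
        qed
      qed
      have L': "?L' \<in> borel_measurable (F t)"
        by (rule W.future_avg_measurable[OF f beta_adapted mt]) (use True t1 tau_nonneg in \<open>auto simp: space_F\<close>)
      have eq: "?L w = ?L' w" if "w \<in> space M" "\<tau> w \<le> t" for w
        using that t1 True tau_nonneg[OF that(1)]
        by (simp add: W.future_avg_def path_concat_stop min_absorb1)
      have "{\<omega> \<in> {x \<in> space F\<tau>. ?L x \<le> y}. \<tau> \<omega> \<le> t} = {w \<in> space (F t). ?L' w \<le> y} \<inter> {w \<in> space M. \<tau> w \<le> t}"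
        using eq by (auto simp: space_pre_sigma space_F)
      then show ?thesis using L' tau_le_sets[of t] by auto
    qed
  qed
qed

text \<open>Rounding the times of the cylinder function to the grid gives functions of grid values,
  for which the averages are future averages at the rounded stopping time. Continuity of paths lets
  both roundings disappear in the limit. The limit \<open>L\<close> is then recognized as the
  conditional expectation, which is the strong Markov property of \<beta> at \<tau>.\<close>

lemma avg_converges_cylinder:
  fixes g :: "real \<Rightarrow> real ^ 'n \<Rightarrow> real"
  assumes J: "finite J" "J \<subseteq> {0..1}" and g: "\<And>t. continuous_on UNIV (g t)" "\<And>t v. 0 \<le> g t v" "\<And>t v. g t v \<le> 1"
  shows "avg_converges (\<lambda>x. \<Prod>t\<in>J. g t (x t))"
proof -
  define f where "f = (\<lambda>x. \<Prod>t\<in>J. g t (x t))"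
  \<comment> \<open>Rounded down, so that the times remain in \<open>[0, 1]\<close>.\<close>
  define s where "s m t = grid (Suc m) (nat \<lfloor>real (Suc m) * t\<rfloor>)" for m t
  define fm where "fm m x = (\<Prod>t\<in>J. g t (x (s m t)))" for m x
  have s01: "s m t \<in> {0..1}" if "t \<in> J" for m t
  proof -
    have t: "0 \<le> t" "t \<le> 1" using J that by auto
    have "grid (Suc m) (nat \<lfloor>real (Suc m) * t\<rfloor>) \<le> t" by (rule nat_floor_approx(2)[OF t(1)]) simp
    then have "grid (Suc m) (nat \<lfloor>real (Suc m) * t\<rfloor>) \<le> 1" using t(2) by (rule order_trans)
    then show ?thesis unfolding s_def atLeastAtMost_iff by (intro conjI divide_nonneg_nonneg of_nat_0_le_iff)
  qed
  have slim: "(\<lambda>m. s m t) \<longlonglongrightarrow> t" if "t \<in> J" for t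
    unfolding s_def using J that by (intro nat_floor_approx_tendsto) auto
  have f: "bdd_meas f" and f01: "0 \<le> f x" "f x \<le> 1" for x
    using prod_eval_bdd_meas[where s = "\<lambda>t. t" and J = J and g = g, OF J(1) subsetD[OF J(2)] g] by (auto simp: f_def)
  have fm: "bdd_meas (fm m)" and fm01: "0 \<le> fm m x" "fm m x \<le> 1" for m x
    using prod_eval_bdd_meas[where s = "s m" and J = J and g = g, OF J(1) s01 g] by (auto simp: fm_def[abs_def])
  have gf: "grid_fun (Suc m) (fm m)" for m
    unfolding grid_fun_def
  proof (intro ballI impI)
    fix x y :: "'n cpath" assume xy: "\<forall>j\<le>Suc m. x (grid (Suc m) j) = y (grid (Suc m) j)"
    have "x (s m t) = y (s m t)" if "t \<in> J" for t
    proof -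
      have "real (Suc m) * t \<le> real (Suc m) * 1" using J that by (intro mult_left_mono) auto
      moreover have "nat \<lfloor>z\<rfloor> \<le> n" if "z \<le> real n * 1" for z n using that by linarith
      ultimately have "nat \<lfloor>real (Suc m) * t\<rfloor> \<le> Suc m" by blast
      then show ?thesis unfolding s_def using xy by blast
    qed
    then show "fm m x = fm m y" unfolding fm_def by (intro prod.cong) auto
  qed
  let ?T = "\<lambda>w. min (\<tau> w) 1"
  define L where "L w = W.future_avg f (?T w) (\<beta> w)" for w
  have T01: "?T w \<in> {0..1}" if "w \<in> space M" for w using tau_nonneg[OF that] by auto
  let ?t = "\<lambda>m w. grid (Suc m) (level (Suc m) w)"
  have t01: "?t m w \<in> {0..1}" for m w using level_le[of "Suc m" w] by (auto simp: divide_le_eq simp del: of_nat_Suc)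
  \<comment> \<open>The level is random, so the null sets of all grid times are collected before
    \<open>level (Suc m) w\<close> is inserted.\<close>
  have Fm: "AE w in M. approx (Suc m) (fm m) w = W.future_avg (fm m) (?t m w) (\<beta> w)" for m
  proof -
    have "AE w in M. \<forall>l\<le>Suc m. iter_avg (Suc m) (dirs (Suc m) l) (fm m) (\<beta> w) = W.future_avg (fm m) (grid (Suc m) l) (\<beta> w)"
      unfolding AE_all_countable
    proof (intro allI)
      fix l
      show "AE w in M. l \<le> Suc m \<longrightarrow> iter_avg (Suc m) (dirs (Suc m) l) (fm m) (\<beta> w) = W.future_avg (fm m) (grid (Suc m) l) (\<beta> w)"
      proof (cases "l \<le> Suc m")
        case True
        from AE_distrD[OF beta_measurable W.iter_avg_dirs_eq_future_avg[OF fm gf True]]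
        show ?thesis by simp
      qed simp
    qed
    then show ?thesis by eventually_elim (use level_le in \<open>simp add: approx_def\<close>)
  qed
  have conv: "(\<lambda>m. W.future_avg (fm m) (?t m w) (\<beta> w)) \<longlonglongrightarrow> L w" if w: "w \<in> space M" for w
    unfolding L_def W.future_avg_def
  proof (rule integral_dominated_convergence[where w = "\<lambda>_. 1"])
    have bw: "\<beta> w \<in> space path_space" by (rule beta_space[OF w])
    have cm: "(\<lambda>x'. path_concat t (\<beta> w) x') \<in> law \<rightarrow>\<^sub>M path_space" if "0 \<le> t" for t
      using bw that measurable_ident_sets[OF W.sets_mu]
      by (intro measurable_path_concat[where Y = "\<lambda>_. \<beta> w" and T = "\<lambda>_. t"]) auto
    show "(\<lambda>x'. f (path_concat (?T w) (\<beta> w) x')) \<in> borel_measurable law"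
      using T01[OF w] by (intro measurable_compose[OF cm bdd_meas_measurable[OF f]]) auto
    show "(\<lambda>x'. fm m (path_concat (?t m w) (\<beta> w) x')) \<in> borel_measurable law" for m
      using t01[of m w] by (intro measurable_compose[OF cm bdd_meas_measurable[OF fm]]) auto
    show "AE x' in law. (\<lambda>m. fm m (path_concat (?t m w) (\<beta> w) x')) \<longlonglongrightarrow> f (path_concat (?T w) (\<beta> w) x')"
    proof (rule AE_I2)
      fix x' assume "x' \<in> space law"
      then have x': "x' \<in> space path_space" by simp
      show "(\<lambda>m. fm m (path_concat (?t m w) (\<beta> w) x')) \<longlonglongrightarrow> f (path_concat (?T w) (\<beta> w) x')"
        unfolding fm_def f_def
      proof (rule tendsto_prod)
        fix t assume t: "t \<in> J"
        have "(\<lambda>m. path_concat (?t m w) (\<beta> w) x' (s m t)) \<longlonglongrightarrow> path_concat (?T w) (\<beta> w) x' t"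
          by (rule path_concat_tendsto[OF bw x' slim[OF t] s01[OF t] _ level_tendsto[OF w] t01 T01[OF w]]) (use J t in auto)
        then show "(\<lambda>m. g t (path_concat (?t m w) (\<beta> w) x' (s m t))) \<longlonglongrightarrow> g t (path_concat (?T w) (\<beta> w) x' t)"
          by (intro continuous_on_tendsto_compose[OF g(1)]) auto
      qed
    qed
  qed (use fm01 in auto)
  have Lm: "L \<in> borel_measurable F\<tau>" unfolding L_def by (rule future_avg_stopped_measurable[OF f])
  have LM: "L \<in> borel_measurable M" by (rule measurable_from_subalg[OF subalgebra_F\<tau> Lm])
  have Lb: "\<bar>L w\<bar> \<le> 1" if "w \<in> space M" for w
    unfolding L_def using T01[OF that] f01 by (intro W.future_avg_bdd[OF _ f beta_space[OF that]]) auto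
  have Li: "integrable M L"
    by (rule integrable_const_bound[of _ 1]) (use Lb LM in auto)
  have am: "approx (Suc m) h \<in> borel_measurable M" if "bdd_meas h" for m h
    using approx_integrable[OF that, of "Suc m"] by auto
  have lim1: "(\<lambda>m. LINT w|M. \<bar>approx (Suc m) (fm m) w - L w\<bar>) \<longlonglongrightarrow> (LINT w|M. 0)"
  proof (rule integral_dominated_convergence[where w = "\<lambda>_. 2"])
    have "AE w in M. \<forall>m. approx (Suc m) (fm m) w = W.future_avg (fm m) (?t m w) (\<beta> w)"
      unfolding AE_all_countable by (intro allI Fm)
    then show "AE w in M. (\<lambda>m. \<bar>approx (Suc m) (fm m) w - L w\<bar>) \<longlonglongrightarrow> 0"
      using AE_space
    proof eventually_elim
      case (elim w)
      then have "(\<lambda>m. approx (Suc m) (fm m) w) \<longlonglongrightarrow> L w" using conv by simp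
      then show ?case by (simp add: LIM_zero tendsto_rabs_zero)
    qed
    show "AE w in M. norm \<bar>approx (Suc m) (fm m) w - L w\<bar> \<le> 2" for m
      using Fm[of m] AE_space
    proof eventually_elim
      case (elim w)
      have "\<bar>W.future_avg (fm m) (?t m w) (\<beta> w)\<bar> \<le> 1"
        using t01[of m w] fm01 by (intro W.future_avg_bdd[OF _ fm beta_space[OF elim(2)]]) auto
      then show ?case using Lb[OF elim(2)] elim(1) by simp
    qed
    show "(\<lambda>w. \<bar>approx (Suc m) (fm m) w - L w\<bar>) \<in> borel_measurable M" for m
      using am[OF fm] LM by measurable
  qed auto
  have lim2: "(\<lambda>m. LINT x|law. \<bar>f x - fm m x\<bar>) \<longlonglongrightarrow> (LINT x|law. 0)"
  proof (rule integral_dominated_convergence[where w = "\<lambda>_. 1"])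
    show "AE x in law. (\<lambda>m. \<bar>f x - fm m x\<bar>) \<longlonglongrightarrow> 0"
    proof (rule AE_I2)
      fix x assume "x \<in> space law"
      then have c: "continuous_on {0..1} x" by (simp add: space_path_space_iff)
      have "(\<lambda>m. fm m x) \<longlonglongrightarrow> f x"
        unfolding fm_def f_def
      proof (rule tendsto_prod)
        fix t assume t: "t \<in> J"
        have "(\<lambda>m. x (s m t)) \<longlonglongrightarrow> x t"
          by (rule continuous_on_tendsto_compose[OF c slim[OF t]]) (use s01[OF t] J t in auto)
        then show "(\<lambda>m. g t (x (s m t))) \<longlonglongrightarrow> g t (x t)"
          by (intro continuous_on_tendsto_compose[OF g(1)]) auto
      qed
      then have "(\<lambda>m. f x - fm m x) \<longlonglongrightarrow> f x - f x" by (intro tendsto_diff tendsto_const)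
      then show "(\<lambda>m. \<bar>f x - fm m x\<bar>) \<longlonglongrightarrow> 0" by (simp add: tendsto_rabs_zero)
    qed
    show "AE x in law. norm \<bar>f x - fm m x\<bar> \<le> 1" for m
    proof (rule AE_I2)
      fix x
      show "norm \<bar>f x - fm m x\<bar> \<le> 1" using f01[of x] fm01[of m x] by (simp add: abs_le_iff)
    qed
    show "(\<lambda>x. \<bar>f x - fm m x\<bar>) \<in> borel_measurable law" for m
      using bdd_meas_measurable[OF f] bdd_meas_measurable[OF fm[of m]] by simp
  qed auto
  \<comment> \<open>Replacing the rounded function by \<open>f\<close> inside the average costs at
    most their \<open>L^1\<close> distance, by contraction.\<close>
  have lim: "(\<lambda>m. LINT w|M. \<bar>approx (Suc m) f w - L w\<bar>) \<longlonglongrightarrow> 0"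
  proof (rule tendsto_sandwich[OF _ _ tendsto_const])
    show "(\<lambda>m. (LINT x|law. \<bar>f x - fm m x\<bar>) + (LINT w|M. \<bar>approx (Suc m) (fm m) w - L w\<bar>)) \<longlonglongrightarrow> 0"
      using tendsto_add[OF lim2 lim1] by simp
    show "\<forall>\<^sub>F m in sequentially. 0 \<le> (LINT w|M. \<bar>approx (Suc m) f w - L w\<bar>)"
      by (intro always_eventually allI Bochner_Integration.integral_nonneg abs_ge_zero)
    show "\<forall>\<^sub>F m in sequentially. (LINT w|M. \<bar>approx (Suc m) f w - L w\<bar>)
        \<le> (LINT x|law. \<bar>f x - fm m x\<bar>) + (LINT w|M. \<bar>approx (Suc m) (fm m) w - L w\<bar>)"
    proof (intro always_eventually allI)
      fix m
      have "(LINT w|M. \<bar>approx (Suc m) f w - L w\<bar>)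
        \<le> (LINT w|M. \<bar>approx (Suc m) f w - approx (Suc m) (fm m) w\<bar>) + (LINT w|M. \<bar>approx (Suc m) (fm m) w - L w\<bar>)"
        by (intro L1_triangle approx_integrable f fm Li) auto
      also have "(LINT w|M. \<bar>approx (Suc m) f w - approx (Suc m) (fm m) w\<bar>) \<le> (LINT x|law. \<bar>f x - fm m x\<bar>)"
        by (intro approx_contraction f fm) simp
      finally show "(LINT w|M. \<bar>approx (Suc m) f w - L w\<bar>)
        \<le> (LINT x|law. \<bar>f x - fm m x\<bar>) + (LINT w|M. \<bar>approx (Suc m) (fm m) w - L w\<bar>)" by simp
    qed
  qed
  \<comment> \<open>Integrals of the averages over events of \<open>F\<tau>\<close> do not depend on
    \<open>m\<close> and equal those of \<open>f\<close>; by \<open>L^1\<close> convergence they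
    also equal those of \<open>L\<close>.\<close>
  have "AE w in M. cexp f w = L w"
    unfolding cexp_def
  proof (rule C.real_cond_exp_charact[OF _ bdd_comp_integrable[OF f] Li Lm])
    fix S assume S: "S \<in> sets F\<tau>"
    have SM: "S \<in> sets M" by (rule stopped_sets_M[OF S])
    have ai: "integrable M (approx (Suc m) f)" for m by (rule approx_integrable[OF f]) simp
    have "\<bar>(LINT w|M. indicator S w * f (\<beta> w)) - (LINT w|M. indicator S w * L w)\<bar> \<le> (LINT w|M. \<bar>approx (Suc m) f w - L w\<bar>)" for m
    proof -
      have "(LINT w|M. indicator S w * f (\<beta> w)) - (LINT w|M. indicator S w * L w)
        = (LINT w|M. indicator S w * approx (Suc m) f w - indicator S w * L w)"
        unfolding integral_approx_indicator[OF f zero_less_Suc[of m] S, symmetric]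
        by (intro Bochner_Integration.integral_diff[symmetric] integrable_indicator_mult SM ai Li)
      also have "\<bar>\<dots>\<bar> \<le> (LINT w|M. \<bar>indicator S w * approx (Suc m) f w - indicator S w * L w\<bar>)"
        by (rule integral_abs_bound)
      also have "\<dots> \<le> (LINT w|M. \<bar>approx (Suc m) f w - L w\<bar>)"
        by (intro integral_mono integrable_abs Bochner_Integration.integrable_diff integrable_indicator_mult SM ai Li)
          (auto simp: indicator_def)
      finally show ?thesis .
    qed
    then have "\<bar>(LINT w|M. indicator S w * f (\<beta> w)) - (LINT w|M. indicator S w * L w)\<bar> \<le> 0"
      by (intro LIMSEQ_le_const[OF lim]) auto
    then show "(LINT w:S|M. f (\<beta> w)) = (LINT w:S|M. L w)"
      by (simp add: set_lebesgue_integral_def)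
  qed
  then have "(LINT w|M. \<bar>approx (Suc m) f w - L w\<bar>) = (LINT w|M. \<bar>approx (Suc m) f w - cexp f w\<bar>)" for m
    using am[OF f] LM cexp_integrable[OF f]
    by (intro integral_cong_AE) (auto elim: eventually_mono)
  then show ?thesis using lim f unfolding avg_converges_def f_def by simp
qed

lemma avg_converges_bdd: "avg_converges f \<Longrightarrow> bdd_meas f"
  by (simp add: avg_converges_def)

lemma law_lim_zero:
  assumes f: "bdd_meas f" and g: "\<And>i. bdd_meas (g i)"
    and C: "\<And>i x. x \<in> space path_space \<Longrightarrow> \<bar>f x - g i x\<bar> \<le> C"
    and lim: "\<And>x. x \<in> space path_space \<Longrightarrow> (\<lambda>i. g i x) \<longlonglongrightarrow> f x"
  shows "(\<lambda>i. LINT x|law. \<bar>f x - g i x\<bar>) \<longlonglongrightarrow> 0"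
proof -
  have "(\<lambda>i. LINT x|law. \<bar>f x - g i x\<bar>) \<longlonglongrightarrow> (LINT x|law. 0)"
  proof (rule integral_dominated_convergence[where w = "\<lambda>_. C"])
    show "AE x in law. (\<lambda>i. \<bar>f x - g i x\<bar>) \<longlonglongrightarrow> 0"
    proof (rule AE_I2)
      fix x assume "x \<in> space law"
      then have "(\<lambda>i. f x - g i x) \<longlonglongrightarrow> f x - f x" by (intro tendsto_diff tendsto_const lim) simp
      then show "(\<lambda>i. \<bar>f x - g i x\<bar>) \<longlonglongrightarrow> 0" by (simp add: tendsto_rabs_zero)
    qed
    show "AE x in law. norm \<bar>f x - g i x\<bar> \<le> C" for i
      by (rule AE_I2) (use C in simp)
    show "(\<lambda>x. \<bar>f x - g i x\<bar>) \<in> borel_measurable law" for i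
      using bdd_meas_measurable[OF f] bdd_meas_measurable[OF g[of i]] by simp
  qed auto
  then show ?thesis by simp
qed

text \<open>The constant sequence \<open>f\<close> in \<open>avg_converges_limit\<close>: values off
  the path space have no influence on the distance.\<close>

lemma avg_converges_cong:
  assumes f: "avg_converges f" and eq: "\<And>x. x \<in> space path_space \<Longrightarrow> g x = f x"
  shows "avg_converges g"
proof (rule avg_converges_limit)
  have "g \<in> borel_measurable path_space"
    using bdd_meas_measurable[OF avg_converges_bdd[OF f]] eq by (simp cong: measurable_cong)
  moreover obtain C where "\<forall>x\<in>space path_space. \<bar>f x\<bar> \<le> C" using avg_converges_bdd[OF f] by (auto simp: bdd_meas_def)
  ultimately show gb: "bdd_meas g" using eq by (intro bdd_measI[of _ C]) auto
  show "avg_converges f" by (rule f)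
  show "(\<lambda>i::nat. LINT x|law. \<bar>g x - f x\<bar>) \<longlonglongrightarrow> 0"
    by (rule law_lim_zero[where C = 0, OF gb avg_converges_bdd[OF f]]) (auto simp: eq)
qed

lemma avg_converges_indicator_cylinder:
  assumes A: "A \<in> path_cylinders"
  shows "avg_converges (indicator A)"
proof -
  obtain J U where J: "finite J" "J \<subseteq> {0..1}" and U: "\<And>t. open (U t)"
    and AJ: "A = {x \<in> space path_space. \<forall>t\<in>J. x t \<in> U t}"
    using A unfolding path_cylinders_def by blast
  have Am: "A \<in> sets path_space" using path_cylinders_subset A by blast
  \<comment> \<open>Continuous functions tending to the indicator of \<open>U t\<close>. The full
    space is treated apart because the distance to its empty complement is 0 by convention.\<close>
  define h where "h k t v = (if U t = UNIV then 1 else min 1 (real k * infdist v (- U t)))" for k :: nat and t and v :: "real ^ 'n"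
  have hc: "continuous_on UNIV (h k t)" for k t
    unfolding h_def by (cases "U t = UNIV") (auto intro!: continuous_intros)
  have h01: "0 \<le> h k t v" "h k t v \<le> 1" for k t v
    by (auto simp: h_def infdist_nonneg)
  have hlim: "(\<lambda>k. h k t v) \<longlonglongrightarrow> indicator (U t) v" for t v
  proof (cases "U t = UNIV")
    case False
    then have ne: "- U t \<noteq> {}" by auto
    have cl: "closed (- U t)" using U by auto
    show ?thesis
    proof (cases "v \<in> U t")
      case True
      then have "infdist v (- U t) > 0"
        using in_closed_iff_infdist_zero[OF cl ne, of v] infdist_nonneg[of v "- U t"] by auto
      then obtain n :: nat where n: "1 < real n * infdist v (- U t)"
        using ex_less_of_nat_mult by blast
      have "h k t v = 1" if "n \<le> k" for k
      proof -
        have "real n * infdist v (- U t) \<le> real k * infdist v (- U t)"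
          using that by (intro mult_right_mono) (auto simp: infdist_nonneg)
        then show ?thesis using n False by (simp add: h_def)
      qed
      then have "eventually (\<lambda>k. h k t v = indicator (U t) v) sequentially"
        using True by (auto simp: eventually_sequentially)
      then show ?thesis by (rule tendsto_eventually)
    next
      case vU: False
      then have "infdist v (- U t) = 0" using in_closed_iff_infdist_zero[OF cl ne, of v] by auto
      then show ?thesis using False vU by (simp add: h_def)
    qed
  qed (simp add: h_def)
  let ?f = "\<lambda>k x. \<Prod>t\<in>J. h k t (x t)"
  have avg_converges: "avg_converges (?f k)" for k by (rule avg_converges_cylinder[OF J hc h01])
  have f01: "0 \<le> ?f k x" "?f k x \<le> 1" for k x using h01 by (auto intro: prod_nonneg prod_le_1)
  have bA: "bdd_meas (indicator A :: 'n cpath \<Rightarrow> real)" using Am by (intro bdd_measI[of _ 1]) auto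
  show ?thesis
  proof (rule avg_converges_limit[OF bA avg_converges], rule law_lim_zero[where C = 1, OF bA avg_converges_bdd[OF avg_converges]])
    fix k and x :: "'n cpath"
    show "\<bar>indicator A x - ?f k x\<bar> \<le> 1" using f01[of k x] by (auto simp: indicator_def)
  next
    fix x :: "'n cpath" assume x: "x \<in> space path_space"
    have "(\<lambda>k. ?f k x) \<longlonglongrightarrow> (\<Prod>t\<in>J. indicator (U t) (x t))"
      by (intro tendsto_prod hlim)
    also have "(\<Prod>t\<in>J. indicator (U t) (x t)) = (indicator A x :: real)"
      using x J(1) unfolding AJ by (auto simp: indicator_def)
    finally show "(\<lambda>k. ?f k x) \<longlonglongrightarrow> indicator A x" .
  qed
qed

lemma avg_converges_one: "avg_converges (\<lambda>_. 1)"
  using avg_converges_cylinder[of "{}" "\<lambda>_ _. 1"] by simp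

lemma avg_converges_zero: "avg_converges (\<lambda>_. 0)"
  using avg_converges_diff[OF avg_converges_one avg_converges_one] by simp

lemma avg_converges_add: "avg_converges f \<Longrightarrow> avg_converges g \<Longrightarrow> avg_converges (\<lambda>x. f x + g x)"
  using avg_converges_diff[of f "\<lambda>x. 0 - g x"] avg_converges_diff[OF avg_converges_zero, of g] by simp

lemma avg_converges_sum: "(\<And>i. i < n \<Longrightarrow> avg_converges (f i)) \<Longrightarrow> avg_converges (\<lambda>x. \<Sum>i<(n::nat). f i x)"
  by (induction n) (auto intro: avg_converges_zero avg_converges_add)

lemma avg_converges_cmult:
  assumes f: "avg_converges f"
  shows "avg_converges (\<lambda>x. c * f x)"
proof -
  have fb: "bdd_meas f" by (rule avg_converges_bdd[OF f])
  have b: "bdd_meas (\<lambda>x. c * f x)"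
    by (rule bdd_meas_mult[OF bdd_measI[of _ "\<bar>c\<bar>"] fb]) auto
  have it: "iter_avg m ks (\<lambda>x. c * f x) = (\<lambda>x. c * iter_avg m ks f x)" for m and ks :: "(nat \<times> 'n) list"
    by (induction ks) (simp_all add: avg_def fun_eq_iff)
  have "AE w in M. cexp (\<lambda>x. c * f x) w = c * cexp f w"
    unfolding cexp_def by (rule C.real_cond_exp_cmult[OF bdd_comp_integrable[OF fb]])
  then have "(LINT w|M. \<bar>approx (Suc m) (\<lambda>x. c * f x) w - cexp (\<lambda>x. c * f x) w\<bar>)
    = (LINT w|M. \<bar>c\<bar> * \<bar>approx (Suc m) f w - cexp f w\<bar>)" for m
  proof (intro integral_cong_AE)
    show "AE w in M. \<bar>approx (Suc m) (\<lambda>x. c * f x) w - cexp (\<lambda>x. c * f x) w\<bar> = \<bar>c\<bar> * \<bar>approx (Suc m) f w - cexp f w\<bar>"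
      if "AE w in M. cexp (\<lambda>x. c * f x) w = c * cexp f w"
      using that by eventually_elim (simp add: approx_def it abs_mult[symmetric] right_diff_distrib)
  qed (use approx_integrable[OF b] approx_integrable[OF fb] cexp_integrable[OF b] cexp_integrable[OF fb] in auto)
  moreover have "(\<lambda>m. \<bar>c\<bar> * (LINT w|M. \<bar>approx (Suc m) f w - cexp f w\<bar>)) \<longlonglongrightarrow> 0"
    using f unfolding avg_converges_def by (auto intro: tendsto_mult_right_zero)
  ultimately show ?thesis using b unfolding avg_converges_def by simp
qed

text \<open>The sets in question form a Dynkin class containing the cylinders: complements by
  linearity, disjoint unions by the closure under bounded pointwise limits.\<close>

lemma avg_converges_indicator:
  assumes A: "A \<in> sets path_space"
  shows "avg_converges (indicator A)"
proof -
  have Asig: "A \<in> sigma_sets (space path_space) path_cylinders" using A by (simp add: sets_path_space)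
  have "path_cylinders \<subseteq> Pow (space path_space)"
    using path_cylinders_subset sets.space_closed by blast
  from Int_stable_path_cylinders this Asig show ?thesis
  proof (induct A rule: sigma_sets_induct_disjoint)
    case (basic A)
    then show ?case by (rule avg_converges_indicator_cylinder)
  next
    case empty
    then show ?case using avg_converges_zero by (simp add: indicator_def[abs_def])
  next
    case (compl A)
    show ?case
      by (rule avg_converges_cong[OF avg_converges_diff[OF avg_converges_one compl(2)]]) (auto simp: indicator_def)
  next
    case (union B)
    have Bs: "B i \<in> sets path_space" for i using union(2) by (auto simp: sets_path_space)
    have UB: "(\<Union>i. B i) \<in> sets path_space" using Bs by auto
    have b: "bdd_meas (indicator (\<Union>i. B i) :: 'n cpath \<Rightarrow> real)" using UB by (intro bdd_measI[of _ 1]) auto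
    have g: "avg_converges (\<lambda>x. \<Sum>i<n. indicator (B i) x)" for n by (rule avg_converges_sum) (rule union(3))
    have eq: "(\<Sum>i<n. indicator (B i) x) = (indicator (\<Union>i<n. B i) x :: real)" for n x
      using union(1) by (intro indicator_UN_disjoint[symmetric]) (auto simp: disjoint_family_on_def)
    show ?case
    proof (rule avg_converges_limit[OF b g], rule law_lim_zero[where C = 1, OF b avg_converges_bdd[OF g]])
      show "\<bar>indicator (\<Union>i. B i) x - (\<Sum>i<n. indicator (B i) x)\<bar> \<le> (1::real)" for n x
        unfolding eq by (auto simp: indicator_def)
      show "(\<lambda>n. \<Sum>i<n. indicator (B i) x) \<longlonglongrightarrow> (indicator (\<Union>i. B i) x :: real)" for x
        unfolding eq by (rule LIMSEQ_indicator_UN)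
    qed
  qed
qed

theorem avg_converges_nonneg:
  assumes f: "bdd_meas f" and nn: "\<And>x. 0 \<le> f x"
  shows "avg_converges f"
proof -
  \<comment> \<open>Boundedness is made a premise of the statement proved by induction, since the
    induction ranges over all nonnegative measurable functions.\<close>
  have "(\<exists>C. \<forall>x\<in>space path_space. f x \<le> C) \<longrightarrow> avg_converges f"
    using bdd_meas_measurable[OF f] nn
  proof (induct rule: borel_measurable_induct_real)
    case (set A)
    then show ?case using avg_converges_indicator by simp
  next
    case (mult u c)
    show ?case
    proof
      assume "\<exists>C. \<forall>x\<in>space path_space. c * u x \<le> C"
      then obtain C where C: "\<forall>x\<in>space path_space. c * u x \<le> C" by blast
      show "avg_converges (\<lambda>x. c * u x)"
      proof (cases "c = 0")
        case True
        then show ?thesis using avg_converges_zero by simp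
      next
        case False
        then have "\<forall>x\<in>space path_space. u x \<le> C / c" using C mult(1) by (simp add: field_simps)
        then show ?thesis using mult by (intro avg_converges_cmult) blast
      qed
    qed
  next
    case (add u v)
    show ?case
    proof
      assume "\<exists>C. \<forall>x\<in>space path_space. v x + u x \<le> C"
      then obtain C where C: "\<forall>x\<in>space path_space. v x + u x \<le> C" by blast
      have "\<forall>x\<in>space path_space. u x \<le> C" "\<forall>x\<in>space path_space. v x \<le> C"
        using C add(2,5) by (auto intro: order_trans[rotated])
      then show "avg_converges (\<lambda>x. v x + u x)" using add by (intro avg_converges_add) blast+
    qed
  next
    case (seq U)
    show ?case
    proof
      assume "\<exists>C. \<forall>x\<in>space path_space. f x \<le> C"
      then obtain C where C: "\<forall>x\<in>space path_space. f x \<le> C" by blast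
      have le: "U i x \<le> f x" if "x \<in> space path_space" for i x
        using seq(4,5) that by (intro incseq_le) (auto simp: incseq_def le_fun_def)
      have g: "avg_converges (U i)" for i using seq(3)[of i] le C by (meson order_trans)
      show "avg_converges f"
      proof (rule avg_converges_limit[OF f g], rule law_lim_zero[where C = C, OF f avg_converges_bdd[OF g]])
        fix i and x :: "'n cpath" assume x: "x \<in> space path_space"
        show "\<bar>f x - U i x\<bar> \<le> C" using le[OF x, of i] seq(2)[of i x] C x by auto
      qed (rule seq(5))
    qed
  qed
  moreover have "\<exists>C. \<forall>x\<in>space path_space. f x \<le> C" using f by (auto simp: bdd_meas_def abs_le_iff)
  ultimately show ?thesis by blast
qed

text \<open>Averaging preserves the condition, and its case of zero shift is the inequality between
  the averages. Convergence in \<open>L^1\<close> gives almost sure convergence along a subsequence,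
  and nonnegativity allows the powers to pass to the limit.\<close>

theorem cond_prekopa_leindler:
  assumes s: "0 < s" "s < 1" and bm: "bdd_meas A" "bdd_meas B" "bdd_meas C"
    and nn: "\<And>x. 0 \<le> A x" "\<And>x. 0 \<le> B x" "\<And>x. 0 \<le> C x"
    and pl: "\<And>m. pl_condition law (Suc m) s A B C"
  shows "AE w in M. cexp B w powr s * cexp C w powr (1 - s) \<le> cexp A w"
proof -
  have app: "AE w in M. approx (Suc m) B w powr s * approx (Suc m) C w powr (1 - s) \<le> approx (Suc m) A w" for m
  proof -
    \<comment> \<open>All grid times are treated at once, since the level at \<open>w\<close> is
      random.\<close>
    have "AE w in M. \<forall>l. iter_avg (Suc m) (dirs (Suc m) l) B (\<beta> w) powr s
        * iter_avg (Suc m) (dirs (Suc m) l) C (\<beta> w) powr (1 - s) \<le> iter_avg (Suc m) (dirs (Suc m) l) A (\<beta> w)"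
      unfolding AE_all_countable
    proof
      fix l
      show "AE w in M. iter_avg (Suc m) (dirs (Suc m) l) B (\<beta> w) powr s
        * iter_avg (Suc m) (dirs (Suc m) l) C (\<beta> w) powr (1 - s) \<le> iter_avg (Suc m) (dirs (Suc m) l) A (\<beta> w)"
        by (rule AE_distrD[OF beta_measurable W.pl_conditionD[OF W.pl_condition_iter_avg[OF pl s bm nn dirs_less]]])
    qed
    then show ?thesis by eventually_elim (simp add: approx_def)
  qed
  have L1: "(\<lambda>m. LINT w|M. norm (approx (Suc m) f w - cexp f w)) \<longlonglongrightarrow> 0" if "bdd_meas f" "\<And>x. 0 \<le> f x" for f
    using avg_converges_nonneg[OF that] by (simp add: avg_converges_def)
  have int: "integrable M (\<lambda>w. approx (Suc (r m)) f w - cexp f w)" if "bdd_meas f" for f m and r :: "nat \<Rightarrow> nat"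
    by (intro Bochner_Integration.integrable_diff approx_integrable cexp_integrable that) simp
  \<comment> \<open>Stated for an arbitrary subsequence \<open>r\<close>, so that it can be applied
    to the three functions in turn and one subsequence serves them all.\<close>
  have sub: "\<exists>r'. strict_mono r' \<and> (AE w in M. (\<lambda>m. approx (Suc (r (r' m))) f w) \<longlonglongrightarrow> cexp f w)"
    if f: "bdd_meas f" "\<And>x. 0 \<le> f x" and r: "strict_mono r" for f and r :: "nat \<Rightarrow> nat"
  proof -
    have lim: "(\<lambda>m. LINT w|M. norm (approx (Suc (r m)) f w - cexp f w)) \<longlonglongrightarrow> 0"
      using LIMSEQ_subseq_LIMSEQ[OF L1[OF f] r] by (simp add: o_def)
    obtain r' where "strict_mono r'" "AE w in M. (\<lambda>m. approx (Suc (r (r' m))) f w - cexp f w) \<longlonglongrightarrow> 0"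
      using tendsto_L1_AE_subseq[OF int[OF f(1), of r] lim] by blast
    then show ?thesis
      by (intro exI[of _ r'] conjI) (auto elim!: eventually_mono simp: LIM_zero_iff)
  qed
  obtain r1 where r1: "strict_mono r1" "AE w in M. (\<lambda>m. approx (Suc (r1 m)) A w) \<longlonglongrightarrow> cexp A w"
    using sub[OF bm(1) nn(1), of "\<lambda>m. m"] by (auto simp: strict_mono_def)
  obtain r2 where r2: "strict_mono r2" "AE w in M. (\<lambda>m. approx (Suc (r1 (r2 m))) B w) \<longlonglongrightarrow> cexp B w"
    using sub[OF bm(2) nn(2) r1(1)] by blast
  have r12: "strict_mono (\<lambda>m. r1 (r2 m))" using strict_mono_o[OF r1(1) r2(1)] by (simp add: o_def)
  obtain r3 where r3: "strict_mono r3" "AE w in M. (\<lambda>m. approx (Suc (r1 (r2 (r3 m)))) C w) \<longlonglongrightarrow> cexp C w"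
    using sub[OF bm(3) nn(3) r12] by blast
  have app': "AE w in M. \<forall>m. approx (Suc m) B w powr s * approx (Suc m) C w powr (1 - s) \<le> approx (Suc m) A w"
    unfolding AE_all_countable by (intro allI app)
  have appnn: "0 \<le> approx (Suc m) f w" if "bdd_meas f" "\<And>x. 0 \<le> f x" "w \<in> space M" for f m w
  proof -
    have "\<bar>approx (Suc m) f w\<bar> \<le> iter_avg (Suc m) (dirs (Suc m) (level (Suc m) w)) (\<lambda>x. \<bar>f x\<bar>) (\<beta> w)"
      unfolding approx_def by (rule abs_iter_avg_le[OF that(1) dirs_less beta_space[OF that(3)]])
    then show ?thesis using that(2) by (simp add: approx_def)
  qed
  show ?thesis
    using app' r1(2) r2(2) r3(2) AE_space
  proof eventually_elim
    case (elim w)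
    let ?r = "\<lambda>m. r1 (r2 (r3 m))"
    have A: "(\<lambda>m. approx (Suc (?r m)) A w) \<longlonglongrightarrow> cexp A w"
      using LIMSEQ_subseq_LIMSEQ[OF elim(2) strict_mono_o[OF r2(1) r3(1)]] by (simp add: o_def)
    have B: "(\<lambda>m. approx (Suc (?r m)) B w) \<longlonglongrightarrow> cexp B w"
      using LIMSEQ_subseq_LIMSEQ[OF elim(3) r3(1)] by (simp add: o_def)
    have "(\<lambda>m. approx (Suc (?r m)) B w powr s * approx (Suc (?r m)) C w powr (1 - s)) \<longlonglongrightarrow> cexp B w powr s * cexp C w powr (1 - s)"
      using s by (intro tendsto_mult tendsto_powr' B elim(4) tendsto_const disjI2 conjI always_eventually allI appnn bm nn elim(5)) auto
    then show ?case by (rule LIMSEQ_le[OF _ A]) (use elim(1) in auto)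
  qed
qed

text \<open>A Doob-Dynkin factorization up to null sets: at time 1 every event is almost surely an
  event of the path of \<beta>, and this passes from indicators to measurable functions.\<close>

lemma factor_through_beta_ennreal:
  assumes "u \<in> borel_measurable M"
  shows "\<exists>v\<in>borel_measurable path_space. AE w in M. u w = (v (\<beta> w) :: ennreal)"
  using assms
proof (induct rule: borel_measurable_induct)
  case (cong f g)
  then obtain v where v: "v \<in> borel_measurable path_space" "AE w in M. g w = v (\<beta> w)" by blast
  have "AE w in M. f w = v (\<beta> w)" using v(2) AE_space by eventually_elim (simp add: cong)
  then show ?case using v by blast
next
  case (set S)
  then have "S \<in> sets (F 1)" using F_full[of 1] by simp
  then obtain T where T: "T \<in> sets path_space" "AE w in M. w \<in> S \<longleftrightarrow> path_stop 1 (\<beta> w) \<in> T"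
    using F_generated[of 1 S] by auto
  have "AE w in M. indicator S w = (indicator T (\<beta> w) :: ennreal)"
    using T(2) AE_space
  proof eventually_elim
    case (elim w)
    have "path_stop 1 (\<beta> w) = \<beta> w"
      using beta_space[OF elim(2)] by (intro path_eqI) (auto simp: space_path_space_iff path_stop_apply min_def)
    then show ?case using elim(1) by (simp add: indicator_def)
  qed
  then show ?case using T(1) by (intro bexI[of _ "indicator T"]) auto
next
  case (mult u c)
  then obtain v where v: "v \<in> borel_measurable path_space" "AE w in M. u w = v (\<beta> w)" by blast
  have "AE w in M. c * u w = c * v (\<beta> w)" using v(2) by eventually_elim simp
  then show ?case using v(1) by (intro bexI[of _ "\<lambda>x. c * v x"]) auto
next
  case (add u u')
  then obtain v v' where v: "v \<in> borel_measurable path_space" "AE w in M. u w = v (\<beta> w)"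
    "v' \<in> borel_measurable path_space" "AE w in M. u' w = v' (\<beta> w)" by blast
  have "AE w in M. u' w + u w = v' (\<beta> w) + v (\<beta> w)" using v(2,4) by eventually_elim simp
  then show ?case using v(1,3) by (intro bexI[of _ "\<lambda>x. v' x + v x"]) auto
next
  case (seq U)
  then obtain V where V: "\<And>i. V i \<in> borel_measurable path_space" "\<And>i. AE w in M. U i w = V i (\<beta> w)" by metis
  have "AE w in M. \<forall>i. U i w = V i (\<beta> w)" unfolding AE_all_countable using V(2) by blast
  then have "AE w in M. (SUP i. U i) w = (SUP i. V i (\<beta> w))"
    by eventually_elim (simp only: SUP_apply)
  then show ?case using V(1) by (intro bexI[of _ "\<lambda>x. SUP i. V i x"]) auto
qed

lemma factor_through_beta:
  assumes u: "u \<in> borel_measurable M" and b: "\<And>w. w \<in> space M \<Longrightarrow> 0 \<le> u w" "\<And>w. w \<in> space M \<Longrightarrow> u w \<le> C"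
  shows "\<exists>v. bdd_meas v \<and> (\<forall>x. 0 \<le> v x) \<and> (AE w in M. u w = v (\<beta> w))"
proof -
  obtain v where v: "v \<in> borel_measurable path_space" "AE w in M. ennreal (u w) = v (\<beta> w)"
    using factor_through_beta_ennreal[of "\<lambda>w. ennreal (u w)"] u by auto
  \<comment> \<open>The bounds must hold at every path, while the factorization is known only almost
    surely; hence the truncation at \<open>\<bar>C\<bar>\<close> and the default value of
    \<open>enn2real\<close> at infinity.\<close>
  let ?v = "\<lambda>x. min \<bar>C\<bar> (enn2real (v x))"
  have "bdd_meas ?v" using v(1) by (intro bdd_measI[of _ "\<bar>C\<bar>"]) auto
  moreover have "AE w in M. u w = ?v (\<beta> w)"
    using v(2) AE_space
  proof eventually_elim
    case (elim w)
    have "enn2real (v (\<beta> w)) = u w" using elim b by (metis enn2real_ennreal)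
    then show ?case using b[OF elim(2)] by simp
  qed
  ultimately show ?thesis by (intro exI[of _ ?v]) auto
qed

end

section \<open>Brownian motion with a completed filtration\<close>

lemma nat_filtration_generators:
  fixes \<nu> :: "'n::finite cpath measure" and X :: "'n cpath \<Rightarrow> 'n cpath"
  assumes "X \<in> completion \<nu> \<rightarrow>\<^sub>M path_space"
  shows "{(\<lambda>w. X w s) -` B \<inter> space \<nu> | s B. s \<in> {0..1} \<and> s \<le> t \<and> B \<in> sets borel} \<union> null_sets (completion \<nu>) \<subseteq> sets (completion \<nu>)"
proof safe
  fix s :: real and B :: "(real ^ 'n) set" assume s: "s \<in> {0..1}" "B \<in> sets borel"
  have "(\<lambda>w. X w s) \<in> borel_measurable (completion \<nu>)"
    by (rule measurable_compose[OF assms measurable_path_eval[OF s(1)]])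
  from measurable_sets[OF this s(2)] show "(\<lambda>w. X w s) -` B \<inter> space \<nu> \<in> sets (completion \<nu>)" by simp
qed auto

lemma sets_nat_filtration:
  fixes \<nu> :: "'n::finite cpath measure" and X :: "'n cpath \<Rightarrow> 'n cpath"
  assumes "X \<in> completion \<nu> \<rightarrow>\<^sub>M path_space"
  shows "sets (nat_filtration \<nu> X t) = sigma_sets (space \<nu>)
     ({(\<lambda>w. X w s) -` B \<inter> space \<nu> | s B. s \<in> {0..1} \<and> s \<le> t \<and> B \<in> sets borel} \<union> null_sets (completion \<nu>))"
  unfolding nat_filtration_def using nat_filtration_generators[OF assms, of t] sets.sets_into_space[of _ "completion \<nu>"]
  by (intro sets_measure_of) (auto simp: subset_eq)

lemma space_nat_filtration: "space (nat_filtration \<nu> X t) = space \<nu>"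
  by (simp add: nat_filtration_def space_measure_of_conv)

lemma nat_filtration_eval:
  fixes \<nu> :: "'n::finite cpath measure" and X :: "'n cpath \<Rightarrow> 'n cpath"
  assumes X: "X \<in> completion \<nu> \<rightarrow>\<^sub>M path_space" and s: "s \<in> {0..1}" "s \<le> t"
  shows "(\<lambda>w. X w s) \<in> borel_measurable (nat_filtration \<nu> X t)"
proof (rule measurableI)
  fix B :: "(real ^ 'n) set" assume "B \<in> sets borel"
  then show "(\<lambda>w. X w s) -` B \<inter> space (nat_filtration \<nu> X t) \<in> sets (nat_filtration \<nu> X t)"
    unfolding sets_nat_filtration[OF X] space_nat_filtration using s by (intro sigma_sets.Basic) blast
qed simp

lemma coord_process_measurable:
  assumes "sets \<nu> = sets path_space"
  shows "coord_process \<in> completion \<nu> \<rightarrow>\<^sub>M path_space"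
proof -
  have "(\<lambda>w. w) \<in> completion \<nu> \<rightarrow>\<^sub>M path_space"
    using assms by (intro measurable_completion measurable_ident_sets)
  then show ?thesis by (simp add: coord_process_def[abs_def])
qed

text \<open>The stopped path is measurable for the past of \<beta>, hence independent of the next
  increment; so their joint law is a product, and the Markov identity is Fubini.\<close>

lemma brownian_motion_law:
  fixes \<nu> :: "'n::finite cpath measure"
  assumes p: "prob_space \<nu>" and bm: "brownian_motion \<nu> \<beta>"
  shows "wiener (distr (completion \<nu>) path_space \<beta>)"
proof -
  let ?M = "completion \<nu>"
  interpret M: prob_space ?M by (rule prob_space.prob_space_completion[OF p])
  have \<beta>[measurable]: "\<beta> \<in> ?M \<rightarrow>\<^sub>M path_space" using bm by (simp add: brownian_motion_def)
  interpret L: prob_space "distr ?M path_space \<beta>" by (rule M.prob_space_distr[OF \<beta>])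
  show ?thesis
  proof (intro wiener.intro wiener_axioms.intro)
    show "prob_space (distr ?M path_space \<beta>)" by (rule M.prob_space_distr[OF \<beta>])
    show "sets (distr ?M path_space \<beta>) = sets path_space" by simp
    have [measurable]: "(\<lambda>x. x 0) \<in> borel_measurable (path_space :: 'n cpath measure)"
      by (rule measurable_path_eval) simp
    have "AE w in ?M. \<beta> w 0 = 0" using bm by (simp add: brownian_motion_def AE_completion_iff)
    then show "AE x in distr ?M path_space \<beta>. x 0 = 0"
      by (subst AE_distr_iff) auto
    fix a b :: real and \<Phi> :: "'n cpath \<times> (real ^ 'n) \<Rightarrow> ennreal"
    assume ab: "0 \<le> a" "a < b" "b \<le> 1" and \<Phi>[measurable]: "\<Phi> \<in> borel_measurable (path_space \<Otimes>\<^sub>M borel)"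
    let ?Y = "\<lambda>w. path_stop a (\<beta> w)" and ?D = "\<lambda>w. \<beta> w b - \<beta> w a"
    have Y: "?Y \<in> nat_filtration \<nu> \<beta> a \<rightarrow>\<^sub>M path_space"
    proof (rule measurable_pathI)
      show "?Y w \<in> space path_space" if "w \<in> space (nat_filtration \<nu> \<beta> a)" for w
        using that measurable_space[OF \<beta>] ab by (intro path_stop_space) (auto simp: space_nat_filtration)
      show "(\<lambda>w. ?Y w t) \<in> borel_measurable (nat_filtration \<nu> \<beta> a)" if "t \<in> {0..1}" for t
        using that ab unfolding path_stop_apply[OF that] by (intro nat_filtration_eval[OF \<beta>]) auto
    qed
    have YM[measurable]: "?Y \<in> ?M \<rightarrow>\<^sub>M path_space"
      using measurable_path_stop[OF \<beta>, of "\<lambda>_. a"] ab by simp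
    have ev: "(\<lambda>x. x b - x a) \<in> borel_measurable (path_space :: 'n cpath measure)"
      using ab by (intro borel_measurable_diff measurable_path_eval) auto
    have D[measurable]: "?D \<in> borel_measurable ?M"
      by (rule measurable_compose[OF \<beta> ev])
    have st: "(\<lambda>x. path_stop a x) \<in> path_space \<rightarrow>\<^sub>M (path_space :: 'n cpath measure)"
      using measurable_path_stop[of "\<lambda>x. x" path_space "\<lambda>_. a"] ab by simp
    have dist: "distributed ?M lborel ?D (\<lambda>x. ennreal (\<Prod>i\<in>UNIV. normal_density 0 (sqrt (b - a)) (x $ i)))"
      and ind: "M.indep_set (sets (nat_filtration \<nu> \<beta> a)) {?D -` B \<inter> space \<nu> | B. B \<in> sets borel}"
      using bm ab by (auto simp: brownian_motion_def)
    have gD: "distr ?M borel ?D = gauss (b - a)"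
      using dist by (simp add: distributed_def gauss_def cong: distr_cong)
    interpret g: prob_space "gauss (b - a) :: (real ^ 'n) measure"
      unfolding gD[symmetric] by (rule M.prob_space_distr[OF D])
    interpret Y: prob_space "distr ?M path_space ?Y" by (rule M.prob_space_distr[OF YM])
    \<comment> \<open>It suffices to compare rectangles, where the independence assumption applies
      directly.\<close>
    have prod: "distr ?M path_space ?Y \<Otimes>\<^sub>M gauss (b - a) = distr ?M (path_space \<Otimes>\<^sub>M borel) (\<lambda>w. (?Y w, ?D w))"
    proof (rule pair_measure_eqI)
      show "sigma_finite_measure (distr ?M path_space ?Y)" "sigma_finite_measure (gauss (b - a) :: (real ^ 'n) measure)"
        by unfold_locales
      show "sets (distr ?M path_space ?Y \<Otimes>\<^sub>M gauss (b - a)) = sets (distr ?M (path_space \<Otimes>\<^sub>M borel) (\<lambda>w. (?Y w, ?D w)))"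
        by (simp cong: sets_pair_measure_cong)
      fix A :: "'n cpath set" and B :: "(real ^ 'n) set"
      assume A: "A \<in> sets (distr ?M path_space ?Y)" and B: "B \<in> sets (gauss (b - a))"
      have A': "A \<in> sets path_space" and B': "B \<in> sets borel" using A B by auto
      have EA: "?Y -` A \<inter> space ?M \<in> sets (nat_filtration \<nu> \<beta> a)"
        using measurable_sets[OF Y A'] by (simp add: space_nat_filtration)
      have "M.prob ((?Y -` A \<inter> space ?M) \<inter> (?D -` B \<inter> space \<nu>)) = M.prob (?Y -` A \<inter> space ?M) * M.prob (?D -` B \<inter> space \<nu>)"
        by (rule M.indep_setD[OF ind EA]) (use B' in blast)
      then have "emeasure ?M ((?Y -` A \<inter> space ?M) \<inter> (?D -` B \<inter> space ?M)) = emeasure ?M (?Y -` A \<inter> space ?M) * emeasure ?M (?D -` B \<inter> space ?M)"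
        by (simp add: M.emeasure_eq_measure ennreal_mult)
      moreover have "(?Y -` A \<inter> space ?M) \<inter> (?D -` B \<inter> space ?M) = (\<lambda>w. (?Y w, ?D w)) -` (A \<times> B) \<inter> space ?M"
        by auto
      moreover have "emeasure (gauss (b - a)) B = emeasure ?M (?D -` B \<inter> space ?M)"
        unfolding gD[symmetric] by (rule emeasure_distr[OF D B'])
      ultimately show "emeasure (distr ?M path_space ?Y) A * emeasure (gauss (b - a)) B
        = emeasure (distr ?M (path_space \<Otimes>\<^sub>M borel) (\<lambda>w. (?Y w, ?D w))) (A \<times> B)"
        using A' B' by (simp add: emeasure_distr)
    qed
    have \<Phi>': "\<Phi> \<in> borel_measurable (path_space \<Otimes>\<^sub>M gauss (b - a))"
      using \<Phi> by (simp cong: measurable_cong_sets sets_pair_measure_cong)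
    have \<Phi>'': "\<Phi> \<in> borel_measurable (distr ?M path_space ?Y \<Otimes>\<^sub>M gauss (b - a))"
      using \<Phi> by (simp cong: measurable_cong_sets sets_pair_measure_cong)
    have \<Phi>g: "(\<lambda>y. \<integral>\<^sup>+z. \<Phi> (y, z) \<partial>gauss (b - a)) \<in> borel_measurable path_space"
      using g.borel_measurable_nn_integral[of "\<lambda>y z. \<Phi> (y, z)" path_space] \<Phi>' by simp
    have "(\<integral>\<^sup>+x. \<Phi> (path_stop a x, x b - x a) \<partial>distr ?M path_space \<beta>) = (\<integral>\<^sup>+w. \<Phi> (?Y w, ?D w) \<partial>?M)"
      by (rule nn_integral_distr[OF \<beta>])
        (use measurable_compose[OF measurable_Pair[OF st ev] \<Phi>] in simp)
    also have "\<dots> = (\<integral>\<^sup>+p. \<Phi> p \<partial>distr ?M (path_space \<Otimes>\<^sub>M borel) (\<lambda>w. (?Y w, ?D w)))"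
      by (rule nn_integral_distr[symmetric]) measurable
    also have "\<dots> = (\<integral>\<^sup>+y. \<integral>\<^sup>+z. \<Phi> (y, z) \<partial>gauss (b - a) \<partial>distr ?M path_space ?Y)"
      unfolding prod[symmetric] by (rule g.nn_integral_fst[symmetric]) (simp add: \<Phi>'')
    also have "\<dots> = (\<integral>\<^sup>+w. \<integral>\<^sup>+z. \<Phi> (?Y w, z) \<partial>gauss (b - a) \<partial>?M)"
      by (rule nn_integral_distr[OF YM]) (simp add: \<Phi>g)
    also have "\<dots> = (\<integral>\<^sup>+x. \<integral>\<^sup>+z. \<Phi> (path_stop a x, z) \<partial>gauss (b - a) \<partial>distr ?M path_space \<beta>)"
    proof -
      have "(\<lambda>x. \<integral>\<^sup>+z. \<Phi> (path_stop a x, z) \<partial>gauss (b - a)) \<in> borel_measurable (distr ?M path_space \<beta>)"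
        using measurable_compose[OF st \<Phi>g] by (simp only: measurable_distr_eq1)
      from nn_integral_distr[OF \<beta> this] show ?thesis by (rule sym)
    qed
    finally show "(\<integral>\<^sup>+x. \<Phi> (path_stop a x, x b - x a) \<partial>distr ?M path_space \<beta>)
      = (\<integral>\<^sup>+x. \<integral>\<^sup>+z. \<Phi> (path_stop a x, z) \<partial>gauss (b - a) \<partial>distr ?M path_space \<beta>)" .
  qed
qed

text \<open>The stopping time refers to the filtration of the coordinate process, the Gaussian
  structure to that of \<beta>; \<open>same_filtration\<close> identifies the two up to time
  1.\<close>

lemma (in perturbed_coordinates) stopped_brownian:
  "stopped_brownian (completion \<nu>) (coord_filtration \<nu>) \<beta> \<tau>"
proof -
  let ?M = "completion \<nu>"
  let ?F = "coord_filtration \<nu>"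
  interpret M: prob_space ?M by (rule prob_space.prob_space_completion[OF prob_space])
  have coord: "coord_process \<in> ?M \<rightarrow>\<^sub>M path_space" by (rule coord_process_measurable[OF sets_eq])
  have \<beta>: "\<beta> \<in> ?M \<rightarrow>\<^sub>M path_space" using brownian_motion by (simp add: brownian_motion_def)
  note setsF = sets_nat_filtration[OF coord]
  have filt: "filtration (space ?M) ?F"
  proof
    show "space (?F t) = space ?M" for t by (simp add: space_nat_filtration)
    show "sets (?F s) \<le> sets (?F t)" if "s \<le> t" for s t
      unfolding setsF using that by (intro sigma_sets_mono' Un_mono order_refl) (blast intro: order_trans)
  qed
  interpret filtration "space ?M" ?F by (rule filt)
  have sub: "sets (?F t) \<subseteq> sets ?M" for t
    unfolding setsF using sets.sigma_sets_subset[OF nat_filtration_generators[OF coord, of t]] by simp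
  show ?thesis
  proof (intro stopped_brownian.intro stopped_brownian_axioms.intro)
    show "prob_space ?M" by unfold_locales
    show "filtration (space ?M) ?F" by (rule filt)
    show "sets (?F t) \<subseteq> sets ?M" for t by (rule sub)
    show "sets (?F t) = sets ?M" if "1 \<le> t" for t
    proof
      \<comment> \<open>A set of the completion is a measurable set of paths, generated by the
        coordinates up to time 1, together with a null set, which is a generator of the
        filtration.\<close>
      show "sets ?M \<subseteq> sets (?F t)"
      proof
        fix S assume "S \<in> sets ?M"
        then obtain S' N N' where S: "S = S' \<union> N" "N \<subseteq> N'" "N' \<in> null_sets \<nu>" "S' \<in> sets \<nu>"
          by (rule sets_completionE) auto
        have "N \<in> null_sets ?M" by (rule null_sets_completion_subset[OF S(2)]) (rule null_sets_completionI[OF S(3)])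
        then have N: "N \<in> sets (?F t)" unfolding setsF by (intro sigma_sets.Basic) blast
        have "coord_process \<in> ?F t \<rightarrow>\<^sub>M path_space"
        proof (rule measurable_pathI)
          show "coord_process w \<in> space path_space" if "w \<in> space (?F t)" for w
            using that sets_eq_imp_space_eq[OF sets_eq] by (simp add: space_nat_filtration coord_process_def)
          show "(\<lambda>w. coord_process w s) \<in> borel_measurable (?F t)" if "s \<in> {0..1}" for s
            using that \<open>1 \<le> t\<close> by (intro nat_filtration_eval[OF coord]) auto
        qed
        from measurable_sets[OF this, of S'] have "S' \<in> sets (?F t)"
          using S(4) sets.sets_into_space[OF S(4)] sets_eq
          by (simp add: coord_process_def[abs_def] space_nat_filtration Int_absorb1)
        then show "S \<in> sets (?F t)" unfolding S(1) using N by (rule sets.Un)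
      qed
    qed (rule sub)
    show "\<beta> \<in> ?M \<rightarrow>\<^sub>M path_space" by (rule \<beta>)
    show "wiener (distr ?M path_space \<beta>)" by (rule brownian_motion_law[OF prob_space brownian_motion])
    show "(\<lambda>w. path_stop t (\<beta> w)) \<in> ?F t \<rightarrow>\<^sub>M path_space" if t: "t \<in> {0..1}" for t
    proof -
      have "(\<lambda>w. path_stop t (\<beta> w)) \<in> nat_filtration \<nu> \<beta> t \<rightarrow>\<^sub>M path_space"
      proof (rule measurable_pathI)
        show "path_stop t (\<beta> w) \<in> space path_space" if "w \<in> space (nat_filtration \<nu> \<beta> t)" for w
          using that t measurable_space[OF \<beta>] by (intro path_stop_space) (auto simp: space_nat_filtration)
        show "(\<lambda>w. path_stop t (\<beta> w) s) \<in> borel_measurable (nat_filtration \<nu> \<beta> t)" if "s \<in> {0..1}" for s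
          using that t unfolding path_stop_apply[OF that] by (intro nat_filtration_eval[OF \<beta>]) auto
      qed
      then show ?thesis by (simp add: measurable_cong_sets[OF same_filtration[OF t] refl])
    qed
    \<comment> \<open>Induction along the generation of the filtration of \<beta>; a generating null
      set is represented by the empty set of paths.\<close>
    show "\<exists>T\<in>sets path_space. AE w in ?M. (w \<in> S) = (path_stop t (\<beta> w) \<in> T)"
      if t: "t \<in> {0..1}" and S: "S \<in> sets (?F t)" for t S
    proof -
      have "S \<in> sigma_sets (space \<nu>)
        ({(\<lambda>w. \<beta> w s) -` B \<inter> space \<nu> | s B. s \<in> {0..1} \<and> s \<le> t \<and> B \<in> sets borel} \<union> null_sets ?M)"
        using S same_filtration[OF t] sets_nat_filtration[OF \<beta>, of t] by simp
      then show ?thesis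
      proof induct
        case (Basic S)
        then consider "\<exists>s B. S = (\<lambda>w. \<beta> w s) -` B \<inter> space \<nu> \<and> s \<in> {0..1} \<and> s \<le> t \<and> B \<in> sets borel"
          | "S \<in> null_sets ?M" unfolding Un_iff mem_Collect_eq by (rule disjE)
        then show ?case
        proof cases
          case exists: 1
          then obtain s B where 1: "S = (\<lambda>w. \<beta> w s) -` B \<inter> space \<nu>" "s \<in> {0..1}" "s \<le> t" "B \<in> sets borel"
            by (elim exE conjE)
          let ?T = "(\<lambda>x. x s) -` B \<inter> space path_space"
          have "?T \<in> sets path_space" by (rule measurable_sets[OF measurable_path_eval[OF 1(2)] 1(4)])
          moreover have "AE w in ?M. (w \<in> S) = (path_stop t (\<beta> w) \<in> ?T)"
          proof (rule AE_I2)
            fix w assume w: "w \<in> space ?M"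
            have "path_stop t (\<beta> w) \<in> space path_space"
              using t measurable_space[OF \<beta> w] by (intro path_stop_space) auto
            then show "(w \<in> S) = (path_stop t (\<beta> w) \<in> ?T)"
              using 1 w by (simp add: path_stop_apply min_absorb1)
          qed
          ultimately show ?thesis by blast
        next
          case 2
          then have "AE w in ?M. w \<notin> S" by (rule AE_not_in)
          then show ?thesis by (intro bexI[of _ "{}"]) (auto elim: eventually_mono)
        qed
      next
        case Empty
        show ?case by (intro bexI[of _ "{}"]) auto
      next
        case (Compl S)
        then obtain T where T: "T \<in> sets path_space" "AE w in ?M. (w \<in> S) = (path_stop t (\<beta> w) \<in> T)" by blast
        have "AE w in ?M. (w \<in> space \<nu> - S) = (path_stop t (\<beta> w) \<in> space path_space - T)"
          using T(2) AE_space
        proof eventually_elim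
          case (elim w)
          have "path_stop t (\<beta> w) \<in> space path_space"
            using t measurable_space[OF \<beta> elim(2)] by (intro path_stop_space) auto
          then show ?case using elim by simp
        qed
        then show ?case using T(1) by (intro bexI[of _ "space path_space - T"]) auto
      next
        case (Union S)
        then have "\<forall>i. \<exists>T. T \<in> sets path_space \<and> (AE w in ?M. (w \<in> S i) = (path_stop t (\<beta> w) \<in> T))"
          by (simp add: Bex_def)
        from choice[OF this] obtain T
          where T: "\<And>i. T i \<in> sets path_space" "\<And>i. AE w in ?M. (w \<in> S i) = (path_stop t (\<beta> w) \<in> T i)"
          by auto
        have "AE w in ?M. \<forall>i. (w \<in> S i) = (path_stop t (\<beta> w) \<in> T i)" unfolding AE_all_countable using T(2) by blast
        then have "AE w in ?M. (w \<in> (\<Union>i. S i)) = (path_stop t (\<beta> w) \<in> (\<Union>i. T i))" by eventually_elim auto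
        then show ?case using T(1) by (intro bexI[of _ "\<Union>i. T i"]) auto
      qed
    qed
    show "stopping_time ?F \<tau>" by (rule stopping_time)
    show "0 \<le> \<tau> w" if "w \<in> space ?M" for w using that by (intro stopping_time_nonneg) simp
  qed
qed

section \<open>Step functions as drifts\<close>

text \<open>Half lines form an intersection-stable generator of the Borel sets, so the integral over
  every Borel set vanishes; the total integral enters through complements.\<close>

lemma AE_zero_of_primitive_zero:
  fixes f :: "real \<Rightarrow> real"
  assumes f: "integrable lborel f" and z: "\<And>a. (LINT s:{..a}|lborel. f s) = 0" and tot: "(LINT s|lborel. f s) = 0"
  shows "AE s in lborel. f s = 0"
proof (rule density_unique_real[OF f])
  fix A :: "real set" assume "A \<in> sets lborel"
  then have A: "A \<in> sigma_sets UNIV (range (\<lambda>a::real. {..a}))"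
    by (simp add: borel_eq_atMost)
  have Int: "Int_stable (range (\<lambda>a::real. {..a}))"
    by (auto intro!: Int_stableI simp: Int_atMost)
  have "range (\<lambda>a::real. {..a}) \<subseteq> Pow UNIV" by simp
  from Int this A have "(LINT s:A|lborel. f s) = 0"
  proof (induct A rule: sigma_sets_induct_disjoint)
    case (basic A)
    then show ?case using z by auto
  next
    case empty
    show ?case by (simp add: set_lebesgue_integral_def)
  next
    case (compl A)
    have A: "A \<in> sets lborel" using compl(1) by (simp add: borel_eq_atMost)
    have "(LINT s:UNIV - A|lborel. f s) = (LINT s|lborel. f s - indicator A s *\<^sub>R f s)"
      unfolding set_lebesgue_integral_def by (rule Bochner_Integration.integral_cong) (auto simp: indicator_def)
    also have "\<dots> = (LINT s|lborel. f s) - (LINT s:A|lborel. f s)"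
      unfolding set_lebesgue_integral_def
      by (rule Bochner_Integration.integral_diff[OF f integrable_mult_indicator[OF A f]])
    finally show ?case using tot compl(2) by simp
  next
    case (union A)
    have A: "A i \<in> sets lborel" for i using union(2) by (auto simp: borel_eq_atMost)
    have U: "(\<Union>i. A i) \<in> sets lborel" using A by blast
    have "(LINT s:(\<Union>i. A i)|lborel. f s) = (\<Sum>i. (LINT s:(A i)|lborel. f s))"
    proof (rule lebesgue_integral_countable_add[OF A])
      show "i \<noteq> j \<Longrightarrow> A i \<inter> A j = {}" for i j using union(1) by (auto simp: disjoint_family_on_def)
      show "set_integrable lborel (\<Union>i. A i) f"
        unfolding set_integrable_def by (rule integrable_mult_indicator[OF U f])
    qed
    then show ?case using union(3) by simp
  qed
  then show "(LINT s:A|lborel. f s) = (LINT s:A|lborel. (0::real))" by simp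
qed simp

lemma has_H_deriv_integrable:
  assumes "has_H_deriv h g"
  shows "integrable lborel (\<lambda>s. indicator {0..1} s *\<^sub>R g s)"
proof -
  have g[measurable]: "g \<in> borel_measurable borel" and i: "set_integrable lborel {0..1} (\<lambda>s. (norm (g s))\<^sup>2)"
    using assms by (auto simp: has_H_deriv_def)
  have i1: "integrable lborel (\<lambda>s. indicator {0..1::real} s + indicator {0..1} s *\<^sub>R (norm (g s))\<^sup>2)"
    using i by (intro Bochner_Integration.integrable_add) (auto simp: set_integrable_def)
  show ?thesis
  proof (rule Bochner_Integration.integrable_bound[OF i1])
    have "x \<le> 1 + x\<^sup>2" for x :: real
      using zero_le_power2[of "x - 1/2"] by (simp add: power2_eq_square algebra_simps)
    then show "AE s in lborel. norm (indicator {0..1} s *\<^sub>R g s) \<le> norm (indicator {0..1::real} s + indicator {0..1} s *\<^sub>R (norm (g s))\<^sup>2)"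
      by (intro AE_I2) (auto simp: indicator_def)
  qed measurable
qed

text \<open>\<open>H_deriv\<close> is a chosen version, so it can be identified with a given
  derivative only through uniqueness. Testing against basis vectors reduces this to real functions
  with vanishing primitive.\<close>

lemma has_H_deriv_unique:
  fixes g g' :: "real \<Rightarrow> real ^ 'n::finite"
  assumes g: "has_H_deriv h g" and g': "has_H_deriv h g'"
  shows "AE s in lborel. s \<in> {0..1} \<longrightarrow> g s = g' s"
proof -
  have "AE s in lborel. indicator {0..1} s * ((g s - g' s) \<bullet> b) = (0::real)" for b
  proof (rule AE_zero_of_primitive_zero)
    let ?f = "\<lambda>s. indicator {0..1} s * ((g s - g' s) \<bullet> b) :: real"
    have int: "integrable lborel (\<lambda>s. (indicator {0..1} s *\<^sub>R g s) \<bullet> b - (indicator {0..1} s *\<^sub>R g' s) \<bullet> b)"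
      using has_H_deriv_integrable[OF g] has_H_deriv_integrable[OF g'] by (intro Bochner_Integration.integrable_diff integrable_inner_left) auto
    have eq: "?f = (\<lambda>s. (indicator {0..1} s *\<^sub>R g s) \<bullet> b - (indicator {0..1} s *\<^sub>R g' s) \<bullet> b)"
      by (auto simp: fun_eq_iff inner_diff_left right_diff_distrib)
    show "integrable lborel ?f" unfolding eq by (rule int)
    have prim: "(LINT s:{0..t}|lborel. ?f s) = 0" if t: "t \<in> {0..1}" for t
    proof -
      have sub: "integrable lborel (\<lambda>s. indicator {0..t} s *\<^sub>R k s)" if "has_H_deriv h k" for k :: "real \<Rightarrow> real ^ 'n"
      proof -
        have "(\<lambda>s. indicator {0..t} s *\<^sub>R k s) = (\<lambda>s. indicator {0..t} s *\<^sub>R (indicator {0..1} s *\<^sub>R k s))"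
          using t by (auto simp: fun_eq_iff indicator_def)
        then show ?thesis using integrable_mult_indicator[OF _ has_H_deriv_integrable[OF that], of "{0..t}"] by simp
      qed
      have h: "(LINT s|lborel. indicator {0..t} s *\<^sub>R k s) = h t" if "has_H_deriv h k" for k :: "real \<Rightarrow> real ^ 'n"
        using that t by (simp add: has_H_deriv_def set_lebesgue_integral_def)
      have "(LINT s:{0..t}|lborel. ?f s) = (LINT s|lborel. (indicator {0..t} s *\<^sub>R g s) \<bullet> b - (indicator {0..t} s *\<^sub>R g' s) \<bullet> b)"
        unfolding set_lebesgue_integral_def
        by (rule Bochner_Integration.integral_cong) (use t in \<open>auto simp: indicator_def inner_diff_left\<close>)
      also have "\<dots> = h t \<bullet> b - h t \<bullet> b"
        using sub[OF g] sub[OF g'] h[OF g] h[OF g']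
        by (subst Bochner_Integration.integral_diff) (auto simp: integral_inner_left simp del: inner_scaleR_left)
      finally show ?thesis by simp
    qed
    show "(LINT s|lborel. ?f s) = 0"
    proof -
      have "(LINT s|lborel. ?f s) = (LINT s:{0..1}|lborel. ?f s)"
        unfolding set_lebesgue_integral_def
        by (rule Bochner_Integration.integral_cong) (auto simp: indicator_def)
      then show ?thesis using prim[of 1] by simp
    qed
    show "(LINT s:{..a}|lborel. ?f s) = 0" for a
    proof (cases "0 \<le> a")
      case True
      have "(LINT s:{..a}|lborel. ?f s) = (LINT s:{0..min a 1}|lborel. ?f s)"
        unfolding set_lebesgue_integral_def
        by (rule Bochner_Integration.integral_cong) (auto simp: indicator_def)
      also have "\<dots> = 0" using True by (intro prim) auto
      finally show ?thesis .
    next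
      case False
      have "(LINT s:{..a}|lborel. ?f s) = (LINT s|(lborel :: real measure). (0::real))"
        unfolding set_lebesgue_integral_def
        by (rule Bochner_Integration.integral_cong) (use False in \<open>auto simp: indicator_def\<close>)
      then show ?thesis by simp
    qed
  qed
  then have "AE s in lborel. \<forall>b\<in>Basis. indicator {0..1} s * ((g s - g' s) \<bullet> b) = (0::real)"
    by (intro AE_finite_allI) auto
  then show ?thesis
  proof eventually_elim
    case (elim s)
    show ?case
    proof
      assume "s \<in> {0..1}"
      then have "\<forall>b\<in>Basis. g s \<bullet> b = g' s \<bullet> b" using elim by (simp add: inner_diff_left)
      from euclidean_eqI[OF bspec[OF this]] show "g s = g' s" .
    qed
  qed
qed

text \<open>The intervals are open on the left and closed on the right, as in
  \<open>elementary_process\<close>, so that this derivative is itself an elementary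
  process.\<close>

definition step_deriv :: "nat \<Rightarrow> (nat \<times> 'n \<Rightarrow> real) \<Rightarrow> real \<Rightarrow> real ^ 'n::finite" where
  "step_deriv m y s = (\<Sum>k\<in>{..<m} \<times> UNIV.
     (y k * sqrt (real m) * indicator {grid m (fst k)<..grid m (Suc (fst k))} s) *\<^sub>R axis (snd k) 1)"

definition step_H :: "nat \<Rightarrow> (nat \<times> 'n \<Rightarrow> real) \<Rightarrow> 'n::finite cpath" where
  "step_H m y = (\<lambda>t\<in>{0..1}. step_path m y t)"

lemma step_path_scale: "step_path m (\<lambda>k. r * y k) t = r *\<^sub>R step_path m y t"
  by (simp add: step_path_def scaleR_sum_right)

lemma step_deriv_measurable [measurable]: "step_deriv m y \<in> borel_measurable borel"
  unfolding step_deriv_def by measurable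

lemma indicator_sum_square:
  fixes c :: "nat \<Rightarrow> real"
  assumes "disjoint_family_on I {..<m}"
  shows "(\<Sum>j<m. c j * indicator (I j) s)\<^sup>2 = (\<Sum>j<m. (c j)\<^sup>2 * indicator (I j) s)"
proof (cases "\<exists>j<m. s \<in> I j")
  case True
  then obtain j0 where j0: "j0 < m" "s \<in> I j0" by blast
  have ind: "indicator (I j) s = (if j = j0 then 1 else 0 :: real)" if "j < m" for j
    using assms j0 that by (auto simp: disjoint_family_on_def indicator_def)
  have "(\<Sum>j<m. d j * indicator (I j) s) = d j0" for d :: "nat \<Rightarrow> real"
  proof -
    have "(\<Sum>j<m. d j * indicator (I j) s) = (\<Sum>j<m. if j = j0 then d j else 0)"
      by (rule sum.cong) (auto simp: ind)
    then show ?thesis using j0 by simp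
  qed
  then show ?thesis by simp
next
  case False
  then have "indicator (I j) s = (0::real)" if "j < m" for j using that by simp
  then show ?thesis by simp
qed

lemma grid_intervals_disjoint: "disjoint_family_on (\<lambda>j. {grid m j<..grid m (Suc j)}) {..<m}"
proof -
  have "{grid m i<..grid m (Suc i)} \<inter> {grid m j<..grid m (Suc j)} = {}" if "i < j" for i j
  proof -
    have "grid m (Suc i) \<le> grid m j" using that by (intro divide_right_mono) auto
    then show ?thesis by auto
  qed
  note less_disj = this
  show ?thesis
    unfolding disjoint_family_on_def
  proof (intro ballI impI)
    fix i j :: nat assume "i \<noteq> j"
    then show "{grid m i<..grid m (Suc i)} \<inter> {grid m j<..grid m (Suc j)} = {}"
    proof (cases rule: linorder_cases[of i j])
      case less
      then show ?thesis by (rule less_disj)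
    next
      case greater
      then show ?thesis by (subst Int_commute) (rule less_disj)
    qed simp
  qed
qed

lemma sum_grid_prod: "(\<Sum>k\<in>{..<m} \<times> (UNIV :: 'n::finite set). F k) = (\<Sum>j<m. \<Sum>i\<in>UNIV. F (j, i))"
  by (simp add: sum.cartesian_product case_prod_beta)

lemma norm_step_deriv_sq:
  fixes y :: "nat \<times> 'n::finite \<Rightarrow> real"
  shows "(norm (step_deriv m y s))\<^sup>2
    = (\<Sum>k\<in>{..<m} \<times> UNIV. (y k)\<^sup>2 * real m * indicator {grid m (fst k)<..grid m (Suc (fst k))} s)"
proof -
  let ?I = "\<lambda>j. {grid m j<..grid m (Suc j)}"
  have comp: "step_deriv m y s $ i = (\<Sum>j<m. (y (j, i) * sqrt (real m)) * indicator (?I j) s)" for i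
    unfolding step_deriv_def sum_grid_prod by (simp add: axis_def if_distrib cong: if_cong)
  have "(norm (step_deriv m y s))\<^sup>2 = (\<Sum>i\<in>UNIV. (step_deriv m y s $ i)\<^sup>2)"
    by (simp only: power2_norm_eq_inner) (simp add: inner_vec_def power2_eq_square)
  also have "\<dots> = (\<Sum>i\<in>UNIV. \<Sum>j<m. (y (j, i))\<^sup>2 * real m * indicator (?I j) s)"
    unfolding comp indicator_sum_square[OF grid_intervals_disjoint] by (simp add: power_mult_distrib)
  also have "\<dots> = (\<Sum>j<m. \<Sum>i\<in>UNIV. (y (j, i))\<^sup>2 * real m * indicator (?I j) s)"
    by (rule sum.swap)
  finally show ?thesis unfolding sum_grid_prod by simp
qed

lemma integral_grid_interval:
  assumes "t \<in> {0..1}" "0 \<le> u"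
  shows "integrable lborel (\<lambda>s. indicator {0..t} s * indicator {u<..v} s :: real)"
    "(LINT s|lborel. indicator {0..t} s * indicator {u<..v} s) = ramp u v t"
proof -
  have eq: "(\<lambda>s. indicator {0..t} s * indicator {u<..v} s :: real) = indicator {u<..min v t}"
    using assms by (auto simp: fun_eq_iff indicator_def)
  show "integrable lborel (\<lambda>s. indicator {0..t} s * indicator {u<..v} s :: real)"
    unfolding eq by (cases "u \<le> min v t") (auto simp: integrable_indicator_iff)
  show "(LINT s|lborel. indicator {0..t} s * indicator {u<..v} s) = ramp u v t"
    unfolding eq by (cases "u \<le> min v t") (auto simp: ramp_def)
qed

lemma has_H_deriv_step:
  fixes y :: "nat \<times> 'n::finite \<Rightarrow> real"
  shows "has_H_deriv (step_H m y) (step_deriv m y)"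
  unfolding has_H_deriv_def
proof (intro conjI)
  show "set_integrable lborel {0..1} (\<lambda>s. (norm (step_deriv m y s))\<^sup>2)"
    unfolding set_integrable_def norm_step_deriv_sq real_scaleR_def sum_distrib_left
  proof (rule Bochner_Integration.integrable_sum)
    fix k :: "nat \<times> 'n"
    have "integrable lborel (\<lambda>s. ((y k)\<^sup>2 * real m) * (indicator {0..1} s * indicator {grid m (fst k)<..grid m (Suc (fst k))} s))"
      by (intro integrable_mult_right integral_grid_interval) auto
    then show "integrable lborel (\<lambda>s. indicator {0..1} s * ((y k)\<^sup>2 * real m * indicator {grid m (fst k)<..grid m (Suc (fst k))} s))"
      by (simp add: mult_ac)
  qed
  show "step_H m y = (\<lambda>t\<in>{0..1}. LINT s:{0..t}|lborel. step_deriv m y s)"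
    unfolding step_H_def
  proof (rule restrict_ext)
    fix t :: real assume t: "t \<in> {0..1}"
    let ?J = "\<lambda>k s. indicator {0..t} s * indicator {grid m (fst k)<..grid m (Suc (fst k))} s :: real"
    have "(LINT s:{0..t}|lborel. step_deriv m y s)
      = (LINT s|lborel. (\<Sum>k\<in>{..<m} \<times> UNIV. ?J k s *\<^sub>R ((y k * sqrt (real m)) *\<^sub>R axis (snd k) 1)))"
      unfolding set_lebesgue_integral_def step_deriv_def scaleR_sum_right
      by (intro Bochner_Integration.integral_cong sum.cong refl) (simp add: mult_ac)
    also have "\<dots> = (\<Sum>k\<in>{..<m} \<times> UNIV. (LINT s|lborel. ?J k s *\<^sub>R ((y k * sqrt (real m)) *\<^sub>R axis (snd k) 1)))"
      by (rule Bochner_Integration.integral_sum) (intro integrable_scaleR_left integral_grid_interval t, simp)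
    also have "\<dots> = (\<Sum>k\<in>{..<m} \<times> UNIV. ramp (grid m (fst k)) (grid m (Suc (fst k))) t *\<^sub>R ((y k * sqrt (real m)) *\<^sub>R axis (snd k) 1))"
    proof (rule sum.cong[OF refl])
      fix k :: "nat \<times> 'n"
      have "(LINT s|lborel. ?J k s *\<^sub>R ((y k * sqrt (real m)) *\<^sub>R axis (snd k) (1::real)))
        = (LINT s|lborel. ?J k s) *\<^sub>R ((y k * sqrt (real m)) *\<^sub>R axis (snd k) 1)"
        by (rule integral_scaleR_left) (intro integral_grid_interval t, simp)
      also have "(LINT s|lborel. ?J k s) = ramp (grid m (fst k)) (grid m (Suc (fst k))) t"
        by (rule integral_grid_interval(2)[OF t]) simp
      finally show "(LINT s|lborel. ?J k s *\<^sub>R ((y k * sqrt (real m)) *\<^sub>R axis (snd k) (1::real)))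
        = ramp (grid m (fst k)) (grid m (Suc (fst k))) t *\<^sub>R ((y k * sqrt (real m)) *\<^sub>R axis (snd k) 1)" .
    qed
    also have "\<dots> = step_path m y t"
      unfolding step_path_def dir_def by (rule sum.cong[OF refl]) (simp add: mult_ac)
    finally show "step_path m y t = (LINT s:{0..t}|lborel. step_deriv m y s)" ..
  qed
qed measurable

lemma has_H_deriv_H_deriv: "has_H_deriv h g \<Longrightarrow> has_H_deriv h (H_deriv h)"
  unfolding H_deriv_def by (rule someI[of "has_H_deriv h"])

lemma H_deriv_step: "AE s in lborel. s \<in> {0..1} \<longrightarrow> H_deriv (step_H m y) s = step_deriv m y s"
  by (rule has_H_deriv_unique[OF has_H_deriv_H_deriv[OF has_H_deriv_step] has_H_deriv_step])

text \<open>The squared height \<open>(y k)\<^sup>2 * m\<close> lives on an interval of length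
  \<open>1 / m\<close>; the coordinates \<open>y\<close> are orthonormal in the Cameron-Martin
  space.\<close>

lemma H_norm_step:
  fixes y :: "nat \<times> 'n::finite \<Rightarrow> real"
  assumes m: "0 < m"
  shows "(H_norm (step_H m y))\<^sup>2 = (\<Sum>k\<in>{..<m} \<times> UNIV. (y k)\<^sup>2)"
proof -
  have [measurable]: "H_deriv (step_H m y) \<in> borel_measurable borel"
    using has_H_deriv_H_deriv[OF has_H_deriv_step, of m y] by (simp add: has_H_deriv_def)
  have "(LINT s:{0..1}|lborel. (norm (H_deriv (step_H m y) s))\<^sup>2) = (LINT s:{0..1}|lborel. (norm (step_deriv m y s))\<^sup>2)"
    unfolding set_lebesgue_integral_def
    by (rule integral_cong_AE, measurable, use H_deriv_step[of m y] in eventually_elim) (auto simp: indicator_def)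
  also have "\<dots> = (LINT s|lborel. (\<Sum>k\<in>{..<m} \<times> UNIV. ((y k)\<^sup>2 * real m) * (indicator {0..1} s * indicator {grid m (fst k)<..grid m (Suc (fst k))} s)))"
    unfolding set_lebesgue_integral_def norm_step_deriv_sq real_scaleR_def sum_distrib_left
    by (intro Bochner_Integration.integral_cong sum.cong refl) (simp add: mult_ac)
  also have "\<dots> = (\<Sum>k\<in>{..<m} \<times> UNIV. (LINT s|lborel. ((y k)\<^sup>2 * real m) * (indicator {0..1} s * indicator {grid m (fst k)<..grid m (Suc (fst k))} s)))"
    by (rule Bochner_Integration.integral_sum) (intro integrable_mult_right integral_grid_interval, auto)
  also have "\<dots> = (\<Sum>k\<in>{..<m} \<times> UNIV. (y k)\<^sup>2)"
  proof (rule sum.cong[OF refl])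
    fix k :: "nat \<times> 'n" assume k: "k \<in> {..<m} \<times> UNIV"
    have "grid m (Suc (fst k)) \<le> 1" using k by auto
    then have r: "ramp (grid m (fst k)) (grid m (Suc (fst k))) 1 = 1 / real m"
      unfolding ramp_def by (simp add: min_absorb1 diff_divide_distrib[symmetric] del: of_nat_Suc)
    have "(LINT s|lborel. ((y k)\<^sup>2 * real m) * (indicator {0..1} s * indicator {grid m (fst k)<..grid m (Suc (fst k))} s))
      = ((y k)\<^sup>2 * real m) * (LINT s|lborel. indicator {0..1} s * indicator {grid m (fst k)<..grid m (Suc (fst k))} s)"
      by (rule integral_mult_right_zero)
    also have "\<dots> = (y k)\<^sup>2"
      using m by (subst integral_grid_interval(2)) (auto simp: r simp del: of_nat_Suc)
    finally show "(LINT s|lborel. ((y k)\<^sup>2 * real m) * (indicator {0..1} s * indicator {grid m (fst k)<..grid m (Suc (fst k))} s)) = (y k)\<^sup>2" .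
  qed
  finally show ?thesis unfolding H_norm_def by (simp add: sum_nonneg)
qed

lemma step_deriv_bound:
  fixes y :: "nat \<times> 'n::finite \<Rightarrow> real"
  shows "norm (step_deriv m y s) \<le> (\<Sum>k\<in>{..<m} \<times> UNIV. \<bar>y k * sqrt (real m)\<bar>)"
  unfolding step_deriv_def by (rule sum_norm_le) (simp add: indicator_def abs_mult)

lemma step_H_in_H_b: "step_H m y \<in> H_b"
proof -
  have "AE s in lborel. s \<in> {0..1} \<longrightarrow> norm (H_deriv (step_H m y) s) \<le> (\<Sum>k\<in>{..<m} \<times> UNIV. \<bar>y k * sqrt (real m)\<bar>)"
    using H_deriv_step[of m y] by eventually_elim (use step_deriv_bound[of m y] in auto)
  then show ?thesis using has_H_deriv_step[of m y] unfolding H_b_def H_space_def by blast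
qed

lemma step_H_space: "step_H m y \<in> space path_space"
  unfolding step_H_def space_path_space_iff continuous_on_restrict_iff by (simp add: continuous_on_step_path)

lemma path_add_step_H: "path_add x (step_H m y) = path_add x (step_path m y)"
  by (auto simp: path_add_def step_H_def fun_eq_iff)

lemma elementary_process_step:
  fixes y :: "nat \<times> 'n::finite \<Rightarrow> real"
  shows "elementary_process m (grid m) (\<lambda>j _. \<Sum>i\<in>UNIV. (y (j, i) * sqrt (real m)) *\<^sub>R axis i 1) w s = step_deriv m y s"
  unfolding elementary_process_def step_deriv_def sum_grid_prod
  by (rule sum.cong[OF refl]) (auto simp: indicator_def simp del: of_nat_Suc)

context perturbed_coordinates
begin

lemma step_drift: "(\<lambda>_. step_H m y) \<in> bounded_drifts \<nu>"
proof -
  have "adapted_H_deriv \<nu> (\<lambda>_. step_H m y) (\<lambda>_. step_deriv m y)"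
    unfolding adapted_H_deriv_def using has_H_deriv_step by (auto simp: case_prod_beta)
  moreover have "AE (w, s) in completion \<nu> \<Otimes>\<^sub>M lborel. s \<in> {0..1} \<longrightarrow> norm (step_deriv m y s) \<le> (\<Sum>k\<in>{..<m} \<times> UNIV. \<bar>y k * sqrt (real m)\<bar>)"
    by (rule AE_I2) (auto simp: step_deriv_bound)
  moreover have "(\<lambda>_. step_H m y) \<in> completion \<nu> \<rightarrow>\<^sub>M path_space" by (rule measurable_const) (rule step_H_space)
  ultimately show ?thesis unfolding bounded_drifts_def L0a_def by blast
qed

text \<open>The integral is a choice, so its properties rest on existence. The derivative is almost
  everywhere an elementary process, and a constant sequence of elementary integrals is a
  witness.\<close>

lemma ito_integral_step_measurable:
  assumes m: "0 < m"
  shows "ito_integral \<nu> \<beta> (\<lambda>_. step_H m y) \<in> borel_measurable (completion \<nu>)"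
proof -
  let ?\<xi> = "\<lambda>j (_::'n cpath). \<Sum>i\<in>UNIV. (y (j, i) * sqrt (real m)) *\<^sub>R axis i 1 :: real ^ 'n"
  let ?I = "elementary_integral \<beta> m (grid m) ?\<xi>"
  have \<beta>: "\<beta> \<in> completion \<nu> \<rightarrow>\<^sub>M path_space" using brownian_motion by (simp add: brownian_motion_def)
  have I: "?I \<in> borel_measurable (completion \<nu>)"
    unfolding elementary_integral_def
  proof (intro borel_measurable_sum borel_measurable_inner borel_measurable_const borel_measurable_diff)
    fix j assume "j \<in> {..<m}"
    then have "j < m" by simp
    from grid_mem[OF this]
    show "(\<lambda>w. \<beta> w (grid m (Suc j))) \<in> borel_measurable (completion \<nu>)" "(\<lambda>w. \<beta> w (grid m j)) \<in> borel_measurable (completion \<nu>)"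
      by (auto intro!: measurable_compose[OF \<beta> measurable_path_eval])
  qed
  have "is_ito_integral \<nu> \<beta> (\<lambda>_. step_H m y) ?I"
    unfolding is_ito_integral_def
  proof (intro conjI I exI allI)
    show "elementary_integrand \<nu> m (grid m) ?\<xi>"
      unfolding elementary_integrand_def using m by (auto simp: divide_strict_right_mono)
    have "(\<integral>\<^sup>+w. (\<integral>\<^sup>+s\<in>{0..1}. ennreal ((norm (elementary_process m (grid m) ?\<xi> w s
                - H_deriv (step_H m y) s))\<^sup>2) \<partial>lborel) \<partial>completion \<nu>) = (\<integral>\<^sup>+w. 0 \<partial>completion \<nu>)"
    proof (rule nn_integral_cong)
      fix w
      have "(\<integral>\<^sup>+s\<in>{0..1}. ennreal ((norm (elementary_process m (grid m) ?\<xi> w s - H_deriv (step_H m y) s))\<^sup>2) \<partial>lborel) = (\<integral>\<^sup>+s. 0 \<partial>(lborel :: real measure))"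
        unfolding elementary_process_step
        by (rule nn_integral_cong_AE, use H_deriv_step[of m y] in eventually_elim) (auto simp: indicator_def)
      then show "(\<integral>\<^sup>+s\<in>{0..1}. ennreal ((norm (elementary_process m (grid m) ?\<xi> w s - H_deriv (step_H m y) s))\<^sup>2) \<partial>lborel) = 0"
        by simp
    qed
    then show "(\<lambda>k::nat. \<integral>\<^sup>+w. (\<integral>\<^sup>+s\<in>{0..1}. ennreal ((norm (elementary_process m (grid m) ?\<xi> w s
                - H_deriv (step_H m y) s))\<^sup>2) \<partial>lborel) \<partial>completion \<nu>) \<longlonglongrightarrow> 0" by simp
    show "(\<lambda>k::nat. \<integral>\<^sup>+w. ennreal ((?I w - ?I w)\<^sup>2) \<partial>completion \<nu>) \<longlonglongrightarrow> 0" by simp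
  qed
  then have "is_ito_integral \<nu> \<beta> (\<lambda>_. step_H m y) (ito_integral \<nu> \<beta> (\<lambda>_. step_H m y))"
    unfolding ito_integral_def by (rule someI[of "is_ito_integral \<nu> \<beta> (\<lambda>_. step_H m y)"])
  then show ?thesis by (simp add: is_ito_integral_def)
qed

text \<open>The Girsanov density is strictly positive, so \<open>X_law\<close> makes the law of
  \<open>X u\<close> under \<nu> absolutely continuous with respect to \<nu>. Hence an almost sure
  statement may be composed with the perturbation.\<close>

lemma AE_step_perturbation:
  assumes m: "0 < m" and P: "AE w in \<nu>. P w"
  shows "AE w in \<nu>. P (X (\<lambda>_. step_H m y) w)"
proof -
  let ?u = "\<lambda>_. step_H m y" and ?M = "completion \<nu>"
  let ?\<rho> = "\<lambda>w. ennreal (girsanov_density \<nu> \<beta> ?u w)"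
  have X: "X ?u \<in> ?M \<rightarrow>\<^sub>M path_space" by (rule X_paths[OF step_drift])
  have \<rho>: "?\<rho> \<in> borel_measurable ?M"
    unfolding girsanov_density_def using ito_integral_step_measurable[OF m, of y] by measurable
  obtain N where N: "{w \<in> space \<nu>. \<not> P w} \<subseteq> N" "N \<in> null_sets \<nu>"
    using P by (auto simp: eventually_ae_filter)
  have Np: "N \<in> sets path_space" using N(2) sets_eq by auto
  have sp: "space \<nu> = space path_space" by (rule sets_eq_imp_space_eq[OF sets_eq])
  have "emeasure (distr \<nu> path_space coord_process) N = 0"
  proof -
    have c: "coord_process \<in> \<nu> \<rightarrow>\<^sub>M path_space"
      using measurable_ident_sets[OF sets_eq] by (simp add: coord_process_def[abs_def])
    have "coord_process -` N \<inter> space \<nu> = N"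
      using sets.sets_into_space[OF Np] sp by (auto simp: coord_process_def)
    then show ?thesis using null_setsD1[OF N(2)] by (simp add: emeasure_distr[OF c Np])
  qed
  then have "emeasure (distr (density ?M ?\<rho>) path_space (X ?u)) N = 0"
    by (simp only: X_law[OF step_drift])
  moreover have "X ?u \<in> density ?M ?\<rho> \<rightarrow>\<^sub>M path_space" using X by simp
  ultimately have E0: "emeasure (density ?M ?\<rho>) (X ?u -` N \<inter> space ?M) = 0"
    using Np by (simp add: emeasure_distr)
  have XN: "X ?u -` N \<inter> space ?M \<in> sets ?M" by (rule measurable_sets[OF X Np])
  have "(\<integral>\<^sup>+w. ?\<rho> w * indicator (X ?u -` N \<inter> space ?M) w \<partial>?M) = 0"
    using emeasure_density[OF \<rho> XN] E0 by (rule trans[OF sym])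
  then have "AE w in ?M. ?\<rho> w * indicator (X ?u -` N \<inter> space ?M) w = 0"
    using \<rho> XN by (subst (asm) nn_integral_0_iff_AE) auto
  then have "AE w in ?M. P (X ?u w)"
    using AE_space
  proof eventually_elim
    case (elim w)
    have "0 < ?\<rho> w" by (simp add: girsanov_density_def)
    then have nN: "X ?u w \<notin> N" using elim by (auto simp: indicator_def split: if_splits)
    have spX: "X ?u w \<in> space \<nu>" using measurable_space[OF X elim(2)] sp by simp
    show ?case
    proof (rule ccontr)
      assume "\<not> P (X ?u w)"
      with spX have "X ?u w \<in> N" by (intro subsetD[OF N(1)]) simp
      with nN show False by (rule notE)
    qed
  qed
  then show ?thesis by (simp only: AE_completion_iff)
qed

text \<open>This is where a perturbation of the coordinate process turns into a translation of the
  Brownian path.\<close>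

lemma AE_step_shift:
  assumes m: "0 < m" and A: "AE w in \<nu>. A w = A' (\<beta> w)"
  shows "AE w in \<nu>. A (X (\<lambda>_. step_H m y) w) = A' (path_add (\<beta> w) (step_path m y))"
  using AE_step_perturbation[OF m A, of y] X_shift[OF step_drift[of m y]]
  by eventually_elim (simp add: path_add_step_H)

end

section \<open>Truncation and change of measure\<close>

lemma ennreal_powr_0_1 [simp]: "ennreal_powr x 0 = 1" "ennreal_powr x 1 = x"
  by (auto simp: ennreal_powr_def less_top)

lemma tendsto_ennreal_powr:
  assumes lim: "(f \<longlongrightarrow> x) F" and s: "0 < s"
  shows "((\<lambda>n. ennreal_powr (f n) s) \<longlongrightarrow> ennreal_powr x s) F"
proof (cases "x = \<infinity>")
  case True
  have "\<forall>\<^sub>F n in F. ennreal l < ennreal_powr (f n) s" if l: "0 \<le> l" for l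
  proof -
    \<comment> \<open>Chosen so that its power with exponent \<open>s\<close> is
      \<open>l + 1\<close>, which exceeds \<open>l\<close>.\<close>
    let ?r = "(l + 1) powr (1 / s)"
    have "\<forall>\<^sub>F n in F. ennreal ?r < f n"
      using order_tendstoD(1)[OF lim, of "ennreal ?r"] True by simp
    then show ?thesis
    proof eventually_elim
      case (elim n)
      show ?case
      proof (cases "f n = \<infinity>")
        case False
        then obtain y where y: "f n = ennreal y" "0 \<le> y" by (cases "f n") auto
        then have "?r < y" using elim by (simp add: ennreal_less_iff)
        then have "?r powr s < y powr s" using s by (intro powr_less_mono2) auto
        then have "l < y powr s" using s l by (simp add: powr_powr)
        then show ?thesis using y s l by (simp add: ennreal_powr_def ennreal_less_iff)
      qed (use s in \<open>simp add: ennreal_powr_def\<close>)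
    qed
  qed
  then show ?thesis using True s by (simp add: ennreal_powr_def tendsto_top_iff_ennreal)
next
  case False
  then obtain y where y: "x = ennreal y" "0 \<le> y" by (cases x) auto
  have fin: "\<forall>\<^sub>F n in F. f n < \<infinity>" using order_tendstoD(2)[OF lim, of \<infinity>] False by (simp add: less_top)
  have "((\<lambda>n. enn2real (f n)) \<longlongrightarrow> y) F"
    using lim y by (intro tendsto_enn2real) auto
  then have "((\<lambda>n. enn2real (f n) powr s) \<longlongrightarrow> y powr s) F"
    using s by (intro tendsto_powr' tendsto_const) auto
  then have "((\<lambda>n. ennreal (enn2real (f n) powr s)) \<longlongrightarrow> ennreal (y powr s)) F"
    by (rule tendsto_ennrealI)
  moreover have "\<forall>\<^sub>F n in F. ennreal (enn2real (f n) powr s) = ennreal_powr (f n) s"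
    using fin by eventually_elim (use s in \<open>auto simp: ennreal_powr_def\<close>)
  ultimately have "((\<lambda>n. ennreal_powr (f n) s) \<longlongrightarrow> ennreal (y powr s)) F"
    by (rule Lim_transform_eventually)
  then show ?thesis using y s by (simp add: ennreal_powr_def)
qed

text \<open>The product is continuous except at zero times infinity, and there its value is 0, so
  the bound is trivial.\<close>

lemma ennreal_powr_mult_le_SUP:
  assumes x: "incseq x" and y: "incseq y" and s: "0 < s" "s < 1"
    and le: "\<And>n. ennreal_powr (x n) s * ennreal_powr (y n) (1 - s) \<le> z"
  shows "ennreal_powr (SUP n. x n) s * ennreal_powr (SUP n. y n) (1 - s) \<le> z"
proof (cases "ennreal_powr (SUP n. x n) s = 0 \<or> ennreal_powr (SUP n. y n) (1 - s) = 0")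
  case False
  have "(\<lambda>n. ennreal_powr (x n) s * ennreal_powr (y n) (1 - s)) \<longlonglongrightarrow> ennreal_powr (SUP n. x n) s * ennreal_powr (SUP n. y n) (1 - s)"
    by (intro tendsto_mult_ennreal tendsto_ennreal_powr LIMSEQ_SUP x y) (use s False in auto)
  then show ?thesis by (rule LIMSEQ_le_const2) (use le in auto)
qed auto

text \<open>If \<open>d1\<close> or \<open>d2\<close> vanishes, the assumption may be void, but the
  product on the left is then 0.\<close>

lemma neg_log_convexD:
  assumes s: "0 < s" "s < 1" and nn: "0 \<le> d0" "0 \<le> d1" "0 \<le> d2"
    and le: "neg_log d0 \<le> ereal s * neg_log d1 + ereal (1 - s) * neg_log d2"
  shows "d1 powr s * d2 powr (1 - s) \<le> d0"
proof (cases "d1 = 0 \<or> d2 = 0")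
  case False
  then have d: "0 < d1" "0 < d2" using nn by auto
  have "d0 \<noteq> 0" using le d by (auto simp: neg_log_def)
  then have d0: "0 < d0" using nn by simp
  have "- ln d0 \<le> s * (- ln d1) + (1 - s) * (- ln d2)" using le d d0 by (simp add: neg_log_def)
  then have "exp (s * ln d1 + (1 - s) * ln d2) \<le> exp (ln d0)" by simp
  then show ?thesis using d d0 by (simp add: powr_def exp_add)
qed (use nn in auto)

text \<open>The geometric mean of \<open>K\<close> with itself is \<open>K\<close>, and
  \<open>e \<le> 1\<close>; so truncating all three functions at the same level keeps the
  inequality.\<close>

lemma powr_truncate_le:
  fixes x y z e K s :: real
  assumes s: "0 < s" "s < 1" and nn: "0 \<le> x" "0 \<le> y" "0 < K" and e: "0 \<le> e" "e \<le> 1"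
    and le: "e * (x powr s * y powr (1 - s)) \<le> z"
  shows "e * ((min x K) powr s * (min y K) powr (1 - s)) \<le> min z K"
proof -
  have "e * ((min x K) powr s * (min y K) powr (1 - s)) \<le> e * (x powr s * y powr (1 - s))"
    using assms by (intro mult_left_mono mult_mono powr_mono2) auto
  moreover have "(min x K) powr s * (min y K) powr (1 - s) \<le> K powr s * K powr (1 - s)"
    using assms by (intro mult_mono powr_mono2) auto
  moreover have "K powr s * K powr (1 - s) = K" using nn by (simp add: powr_add[symmetric])
  moreover have "e * ((min x K) powr s * (min y K) powr (1 - s)) \<le> 1 * ((min x K) powr s * (min y K) powr (1 - s))"
    using e by (intro mult_right_mono) auto
  ultimately show ?thesis using le by linarith
qed

section \<open>Conditional expectations with values in \<open>[0, \<infinity>]\<close>\<close>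

lemma (in sigma_finite_subalgebra) nn_cond_exp_eq_real:
  assumes f: "integrable M f" and nn: "\<And>w. w \<in> space M \<Longrightarrow> 0 \<le> f w"
  shows "AE w in M. nn_cond_exp M F (\<lambda>w. ennreal (f w)) w = ennreal (real_cond_exp M F f w) \<and> 0 \<le> real_cond_exp M F f w"
proof -
  have [measurable]: "f \<in> borel_measurable M" using f by auto
  have "AE w in M. nn_cond_exp M F (\<lambda>w. ennreal (- f w)) w = nn_cond_exp M F (\<lambda>_. 0) w"
    by (rule nn_cond_exp_cong) (use nn in \<open>auto simp: ennreal_neg\<close>)
  moreover have "AE w in M. 0 = nn_cond_exp M F (\<lambda>_. 0) w"
    by (rule nn_cond_exp_F_meas) auto
  moreover have "AE w in M. nn_cond_exp M F (\<lambda>w. ennreal (f w)) w \<noteq> \<infinity>"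
  proof (rule nn_integral_noteq_infinite)
    have "(\<integral>\<^sup>+w. nn_cond_exp M F (\<lambda>w. ennreal (f w)) w \<partial>M) = (\<integral>\<^sup>+w. ennreal (f w) \<partial>M)"
      using nn_cond_exp_intg[of "\<lambda>_. 1" "\<lambda>w. ennreal (f w)"] by simp
    also have "\<dots> = ennreal (LINT w|M. f w)"
      by (rule nn_integral_eq_integral[OF f]) (use nn in auto)
    finally show "(\<integral>\<^sup>+w. nn_cond_exp M F (\<lambda>w. ennreal (f w)) w \<partial>M) \<noteq> \<infinity>" by simp
  qed measurable
  ultimately show ?thesis
  proof eventually_elim
    case (elim w)
    then have "real_cond_exp M F f w = enn2real (nn_cond_exp M F (\<lambda>w. ennreal (f w)) w)"
      by (simp add: real_cond_exp_def)
    then show ?case using elim by (simp add: less_top)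
  qed
qed

text \<open>Conditional monotone convergence, for removing the truncation; the limits may be
  infinite.\<close>

lemma (in sigma_finite_subalgebra) nn_cond_exp_SUP:
  assumes f[measurable]: "\<And>n::nat. f n \<in> borel_measurable M" and inc: "\<And>n w. w \<in> space M \<Longrightarrow> f n w \<le> f (Suc n) w"
  shows "AE w in M. nn_cond_exp M F (\<lambda>w. SUP n. f n w) w = (SUP n. nn_cond_exp M F (f n) w) \<and> incseq (\<lambda>n. nn_cond_exp M F (f n) w)"
proof -
  have mono: "AE w in M. nn_cond_exp M F (f n) w \<le> nn_cond_exp M F (f (Suc n)) w" for n
    by (rule nn_cond_exp_mono) (use inc in auto)
  then have "AE w in M. \<forall>n. nn_cond_exp M F (f n) w \<le> nn_cond_exp M F (f (Suc n)) w"
    unfolding AE_all_countable by blast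
  moreover have "AE w in M. (SUP n. nn_cond_exp M F (f n) w) = nn_cond_exp M F (\<lambda>w. SUP n. f n w) w"
  proof (rule nn_cond_exp_charact)
    fix A assume A[measurable]: "A \<in> sets F"
    have [measurable]: "A \<in> sets M" using subalg A by (auto simp: subalgebra_def)
    have "(\<integral>\<^sup>+w\<in>A. (SUP n. nn_cond_exp M F (f n) w) \<partial>M) = (\<integral>\<^sup>+w. (SUP n. indicator A w * nn_cond_exp M F (f n) w) \<partial>M)"
      by (rule nn_integral_cong) (simp add: SUP_mult_left_ennreal mult.commute)
    also have "\<dots> = (SUP n. \<integral>\<^sup>+w. indicator A w * nn_cond_exp M F (f n) w \<partial>M)"
    proof (rule nn_integral_monotone_convergence_SUP_AE)
      show "AE w in M. indicator A w * nn_cond_exp M F (f n) w \<le> indicator A w * nn_cond_exp M F (f (Suc n)) w" for n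
        using mono[of n] by eventually_elim (simp add: mult_left_mono)
    qed measurable
    also have "\<dots> = (SUP n. \<integral>\<^sup>+w. indicator A w * f n w \<partial>M)"
      by (simp add: nn_cond_exp_intg)
    also have "\<dots> = (\<integral>\<^sup>+w. (SUP n. indicator A w * f n w) \<partial>M)"
      by (rule nn_integral_monotone_convergence_SUP_AE[symmetric]) (use inc in \<open>auto intro!: AE_I2 mult_left_mono\<close>)
    also have "\<dots> = (\<integral>\<^sup>+w\<in>A. (SUP n. f n w) \<partial>M)"
      by (rule nn_integral_cong) (simp add: SUP_mult_left_ennreal mult.commute)
    finally show "(\<integral>\<^sup>+w\<in>A. (SUP n. f n w) \<partial>M) = (\<integral>\<^sup>+w\<in>A. (SUP n. nn_cond_exp M F (f n) w) \<partial>M)" ..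
  qed measurable
  ultimately show ?thesis by eventually_elim (simp add: incseq_SucI)
qed

text \<open>On \<open>F\<close> the measures with densities \<open>1\<close> and \<open>d\<close> agree, so that null sets do not matter.\<close>

lemma (in sigma_finite_subalgebra) nn_cond_exp_density:
  assumes d[measurable]: "d \<in> borel_measurable M" and d1: "AE w in M. nn_cond_exp M F d w = 1"
    and fin: "finite_measure (density M d)" and f[measurable]: "f \<in> borel_measurable M"
  shows "AE w in M. nn_cond_exp (density M d) F f w = nn_cond_exp M F (\<lambda>w. f w * d w) w"
proof -
  let ?D = "density M d"
  let ?g = "nn_cond_exp M F (\<lambda>w. f w * d w)"
  have sub: "subalgebra ?D F" using subalg by (simp add: subalgebra_def)
  interpret D: finite_measure_subalgebra ?D F
    using fin sub by (intro finite_measure_subalgebra.intro finite_measure_subalgebra_axioms.intro)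
  have dens: "(\<integral>\<^sup>+w. h w \<partial>?D) = (\<integral>\<^sup>+w. h w \<partial>M)" if h[measurable]: "h \<in> borel_measurable F" for h
  proof -
    have [measurable]: "h \<in> borel_measurable M" by (rule measurable_from_subalg[OF subalg h])
    have "(\<integral>\<^sup>+w. h w \<partial>?D) = (\<integral>\<^sup>+w. h w * d w \<partial>M)"
      by (subst nn_integral_density) (auto simp: mult.commute)
    also have "\<dots> = (\<integral>\<^sup>+w. h w * nn_cond_exp M F d w \<partial>M)" by (rule nn_cond_exp_intg[symmetric]) measurable
    also have "\<dots> = (\<integral>\<^sup>+w. h w \<partial>M)"
      by (rule nn_integral_cong_AE) (use d1 in \<open>auto elim: eventually_mono\<close>)
    finally show ?thesis .
  qed
  have "AE w in ?D. ?g w = nn_cond_exp ?D F f w"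
  proof (rule D.nn_cond_exp_charact)
    fix A assume A[measurable]: "A \<in> sets F"
    have [measurable]: "A \<in> sets M" using subalg A by (auto simp: subalgebra_def)
    have "(\<integral>\<^sup>+w\<in>A. f w \<partial>?D) = (\<integral>\<^sup>+w. indicator A w * (f w * d w) \<partial>M)"
      by (subst nn_integral_density) (auto simp: mult_ac)
    also have "\<dots> = (\<integral>\<^sup>+w. indicator A w * ?g w \<partial>M)" by (rule nn_cond_exp_intg[symmetric]) measurable
    also have "\<dots> = (\<integral>\<^sup>+w. indicator A w * ?g w \<partial>?D)" by (rule dens[symmetric]) measurable
    finally show "(\<integral>\<^sup>+w\<in>A. f w \<partial>?D) = (\<integral>\<^sup>+w\<in>A. ?g w \<partial>?D)" by (simp add: mult.commute)
  qed measurable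
  moreover have S[measurable]: "{w \<in> space F. ?g w \<noteq> nn_cond_exp ?D F f w} \<in> sets F" (is "?S \<in> _")
    by measurable
  ultimately have "(\<integral>\<^sup>+w. indicator ?S w \<partial>?D) = (\<integral>\<^sup>+w. 0 \<partial>?D)"
    by (intro nn_integral_cong_AE) (auto elim!: eventually_mono)
  then have "(\<integral>\<^sup>+w. indicator ?S w \<partial>M) = 0"
    using dens[of "indicator ?S"] by simp
  moreover have SM: "?S \<in> sets M" using S subalg by (auto simp: subalgebra_def)
  ultimately have "AE w in M. w \<notin> ?S" by (intro AE_not_in) (simp add: null_sets_def)
  then show ?thesis using AE_space
    by eventually_elim (use subalg in \<open>auto simp: subalgebra_def\<close>)
qed

context perturbed_coordinates
begin

lemma path_zero_step: "path_zero = step_H m (\<lambda>_. 0)"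
  by (simp add: path_zero_def step_H_def step_path_def)

text \<open>These are the two shifts seen from their convex combination, which is the form that
  \<open>pl_condition\<close> uses.\<close>

lemma path_conv_step: "path_conv s (step_H m (\<lambda>k. (1 - s) * y k)) (step_H m (\<lambda>k. - s * y k)) = path_zero"
  unfolding path_conv_def path_zero_def step_H_def step_path_scale
  by (rule restrict_ext) simp

text \<open>The three functions are replaced by functions of \<beta>, equal almost surely also after
  the perturbations. The assumption \<open>pl\<close> then becomes \<open>pl_condition\<close> for
  the law of \<beta>.\<close>

theorem cond_exp_prekopa_leindler:
  assumes s: "0 < s" "s < 1"
    and meas: "A \<in> borel_measurable (completion \<nu>)" "B \<in> borel_measurable (completion \<nu>)" "C \<in> borel_measurable (completion \<nu>)"
    and nn: "\<And>w. w \<in> space \<nu> \<Longrightarrow> 0 \<le> A w" "\<And>w. w \<in> space \<nu> \<Longrightarrow> 0 \<le> B w" "\<And>w. w \<in> space \<nu> \<Longrightarrow> 0 \<le> C w"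
    and bd: "\<And>w. w \<in> space \<nu> \<Longrightarrow> A w \<le> K" "\<And>w. w \<in> space \<nu> \<Longrightarrow> B w \<le> K" "\<And>w. w \<in> space \<nu> \<Longrightarrow> C w \<le> K"
    and pl: "\<And>m y. AE w in \<nu>. exp (- 1/2 * s * (1 - s) * (\<Sum>k\<in>{..<Suc m} \<times> UNIV. (y k)\<^sup>2))
       * (B (X (\<lambda>_. step_H (Suc m) (\<lambda>k. (1 - s) * y k)) w) powr s
       * C (X (\<lambda>_. step_H (Suc m) (\<lambda>k. - s * y k)) w) powr (1 - s)) \<le> A w"
  shows "AE w in completion \<nu>. real_cond_exp (completion \<nu>) (stopped_sigma \<nu> \<tau>) B w powr s
    * real_cond_exp (completion \<nu>) (stopped_sigma \<nu> \<tau>) C w powr (1 - s) \<le> real_cond_exp (completion \<nu>) (stopped_sigma \<nu> \<tau>) A w"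
proof -
  let ?M = "completion \<nu>"
  interpret SB: stopped_brownian ?M "coord_filtration \<nu>" \<beta> \<tau> by (rule stopped_brownian)
  have sig: "stopped_sigma \<nu> \<tau> = SB.F\<tau>" by (simp add: stopped_sigma_def)
  have sp: "space ?M = space \<nu>" by simp
  obtain A' where A': "bdd_meas A'" "\<And>x. 0 \<le> A' x" "AE w in ?M. A w = A' (\<beta> w)"
    using SB.factor_through_beta[OF meas(1), of K] nn bd by auto
  obtain B' where B': "bdd_meas B'" "\<And>x. 0 \<le> B' x" "AE w in ?M. B w = B' (\<beta> w)"
    using SB.factor_through_beta[OF meas(2), of K] nn bd by auto
  obtain C' where C': "bdd_meas C'" "\<And>x. 0 \<le> C' x" "AE w in ?M. C w = C' (\<beta> w)"
    using SB.factor_through_beta[OF meas(3), of K] nn bd by auto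
  have pl': "pl_condition SB.law (Suc m) s A' B' C'" for m
    unfolding pl_condition_def
  proof
    fix y :: "nat \<times> 'n \<Rightarrow> real"
    let ?e = "exp (- 1/2 * s * (1 - s) * (\<Sum>k\<in>{..<Suc m} \<times> UNIV. (y k)\<^sup>2))"
    let ?P = "\<lambda>x. ?e * (B' (path_add x (\<lambda>t. (1 - s) *\<^sub>R step_path (Suc m) y t)) powr s
       * C' (path_add x (\<lambda>t. (- s) *\<^sub>R step_path (Suc m) y t)) powr (1 - s)) \<le> A' x"
    have sc: "(\<lambda>t. r *\<^sub>R step_path (Suc m) y t) = step_path (Suc m) (\<lambda>k. r * y k)" for r
      by (simp add: fun_eq_iff step_path_scale)
    have "AE w in \<nu>. A w = A' (\<beta> w)" using A'(3) by (simp only: AE_completion_iff)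
    moreover have "AE w in \<nu>. B (X (\<lambda>_. step_H (Suc m) (\<lambda>k. (1 - s) * y k)) w) = B' (path_add (\<beta> w) (step_path (Suc m) (\<lambda>k. (1 - s) * y k)))"
      by (rule AE_step_shift) (use B'(3) in \<open>simp_all only: AE_completion_iff zero_less_Suc\<close>)
    moreover have "AE w in \<nu>. C (X (\<lambda>_. step_H (Suc m) (\<lambda>k. - s * y k)) w) = C' (path_add (\<beta> w) (step_path (Suc m) (\<lambda>k. - s * y k)))"
      by (rule AE_step_shift) (use C'(3) in \<open>simp_all only: AE_completion_iff zero_less_Suc\<close>)
    ultimately have "AE w in \<nu>. ?P (\<beta> w)"
      using pl[of y m]
    proof eventually_elim
      case (elim w)
      show ?case using elim(4) unfolding elim(1-3) sc .
    qed
    then have AEP: "AE w in ?M. ?P (\<beta> w)" by (simp only: AE_completion_iff)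
    have sh: "(\<lambda>x. f (path_add x (\<lambda>t. r *\<^sub>R step_path (Suc m) y t))) \<in> borel_measurable path_space" if "bdd_meas f" for f :: "'n cpath \<Rightarrow> real" and r
      by (rule measurable_compose[OF measurable_path_add bdd_meas_measurable[OF that]])
        (auto intro!: continuous_intros continuous_on_step_path)
    have "{x \<in> space path_space. ?P x} \<in> sets path_space"
      by (intro borel_measurable_le borel_measurable_times borel_measurable_const powr_real_measurable sh B'(1) C'(1) bdd_meas_measurable[OF A'(1)])
    then show "AE x in SB.law. ?P x"
      using AE_distr_iff[OF SB.beta_measurable, of ?P] AEP by simp
  qed
  have eq: "AE w in ?M. real_cond_exp ?M SB.F\<tau> f w = SB.cexp f' w"
    if "AE w in ?M. f w = f' (\<beta> w)" "bdd_meas f'" "f \<in> borel_measurable ?M" for f f'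
    unfolding SB.cexp_def using that SB.bdd_comp_integrable[OF that(2)] by (intro SB.C.real_cond_exp_cong) auto
  show ?thesis
    unfolding sig
    using SB.cond_prekopa_leindler[OF s A'(1) B'(1) C'(1) A'(2) B'(2) C'(2) pl']
      eq[OF A'(3,1) meas(1)] eq[OF B'(3,1) meas(2)] eq[OF C'(3,1) meas(3)]
    by eventually_elim simp
qed

end

theorem theorem8:
  fixes \<nu> \<theta> :: "'n::finite cpath measure"
    and \<tau> :: "'n cpath \<Rightarrow> real"
    and \<beta> :: "'n cpath \<Rightarrow> 'n cpath"
    and X :: "('n cpath \<Rightarrow> 'n cpath) \<Rightarrow> 'n cpath \<Rightarrow> 'n cpath"
    and a b c d :: "'n cpath \<Rightarrow> real"
  assumes "perturbed_coordinates \<nu> \<tau> \<beta> X"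
    and "\<And>u. u \<in> bounded_drifts \<nu> \<Longrightarrow> AE w in \<nu>. X u w = X (\<lambda>_. u w) w"
    and "a \<in> borel_measurable (completion \<nu>)" "\<And>w. w \<in> space \<nu> \<Longrightarrow> 0 < a w"
    and "b \<in> borel_measurable (completion \<nu>)" "\<And>w. w \<in> space \<nu> \<Longrightarrow> 0 < b w"
    and "c \<in> borel_measurable (completion \<nu>)" "\<And>w. w \<in> space \<nu> \<Longrightarrow> 0 < c w"
    and "\<And>h k s. h \<in> H_b \<Longrightarrow> k \<in> H_b \<Longrightarrow> s \<in> {0..1} \<Longrightarrow>
      AE w in \<nu>. a (X (\<lambda>_. path_conv s h k) w) * exp (- 1/2 * (H_norm (path_conv s h k))\<^sup>2)
        \<ge> (b (X (\<lambda>_. h) w) * exp (- 1/2 * (H_norm h)\<^sup>2)) powr s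
          * (c (X (\<lambda>_. k) w) * exp (- 1/2 * (H_norm k)\<^sup>2)) powr (1 - s)"
    and "d \<in> borel_measurable (completion \<nu>)" "\<And>w. w \<in> space \<nu> \<Longrightarrow> 0 \<le> d w"
    and "(\<integral>\<^sup>+w. ennreal (d w) \<partial>completion \<nu>) = 1"
    and "as_convex_on_H_b \<nu> (\<lambda>h w. neg_log (d (X (\<lambda>_. h) w)))"
    and "AE w in \<nu>. real_cond_exp (completion \<nu>) (stopped_sigma \<nu> \<tau>) d w = 1"
    and "\<theta> = density (completion \<nu>) (\<lambda>w. ennreal (d w))"
  shows "\<forall>s\<in>{0..1}. AE w in \<nu>.
    nn_cond_exp \<theta> (stopped_sigma \<nu> \<tau>) (\<lambda>w. ennreal (a w)) w
      \<ge> ennreal_powr (nn_cond_exp \<theta> (stopped_sigma \<nu> \<tau>) (\<lambda>w. ennreal (b w)) w) s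
        * ennreal_powr (nn_cond_exp \<theta> (stopped_sigma \<nu> \<tau>) (\<lambda>w. ennreal (c w)) w) (1 - s)"
proof -
  interpret perturbed_coordinates \<nu> \<tau> \<beta> X by (rule assms(1))
  let ?M = "completion \<nu>" and ?F = "stopped_sigma \<nu> \<tau>"
  interpret SB: stopped_brownian ?M "coord_filtration \<nu>" \<beta> \<tau> by (rule stopped_brownian)
  have sig: "?F = SB.F\<tau>" by (simp add: stopped_sigma_def)
  interpret E: finite_measure_subalgebra ?M ?F unfolding sig by (rule SB.C.finite_measure_subalgebra_axioms)
  note meas[measurable] = assms(3,5,7,10)
  note pos = assms(4,6,8) and d_nn = assms(11) and prekopa = assms(9)
  have pos': "\<forall>w\<in>space \<nu>. 0 < a w" "\<forall>w\<in>space \<nu>. 0 < b w" "\<forall>w\<in>space \<nu>. 0 < c w" using pos by auto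
  have sp: "space \<nu> = space path_space" by (rule sets_eq_imp_space_eq[OF sets_eq])
  have X_space: "X (\<lambda>_. step_H m y) w \<in> space \<nu>" if "w \<in> space \<nu>" for m y w
    using measurable_space[OF X_paths[OF step_drift]] that sp by simp
  have d_int: "integrable ?M d"
    using assms(12) d_nn by (intro integrableI_nonneg) (auto intro!: AE_I2)
  have d_cond: "AE w in ?M. nn_cond_exp ?M ?F (\<lambda>w. ennreal (d w)) w = 1"
  proof -
    have "AE w in ?M. real_cond_exp ?M ?F d w = 1" using assms(14) by (simp only: AE_completion_iff)
    moreover have "AE w in ?M. nn_cond_exp ?M ?F (\<lambda>w. ennreal (d w)) w = ennreal (real_cond_exp ?M ?F d w) \<and> 0 \<le> real_cond_exp ?M ?F d w"
      by (rule E.nn_cond_exp_eq_real[OF d_int]) (use d_nn in simp)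
    ultimately show ?thesis by eventually_elim simp
  qed
  have \<theta>_fin: "finite_measure (density ?M (\<lambda>w. ennreal (d w)))"
  proof (rule finite_measureI)
    have "emeasure (density ?M (\<lambda>w. ennreal (d w))) (space ?M) = (\<integral>\<^sup>+w. ennreal (d w) \<partial>?M)"
      by (subst emeasure_density) (auto intro!: nn_integral_cong)
    then show "emeasure (density ?M (\<lambda>w. ennreal (d w))) (space (density ?M (\<lambda>w. ennreal (d w)))) \<noteq> \<infinity>"
      by (simp add: assms(12))
  qed
  have cond_\<theta>: "AE w in ?M. nn_cond_exp \<theta> ?F (\<lambda>w. ennreal (f w)) w = nn_cond_exp ?M ?F (\<lambda>w. ennreal (f w) * ennreal (d w)) w"
    if [measurable]: "f \<in> borel_measurable ?M" for f
    unfolding assms(15) by (rule E.nn_cond_exp_density[OF _ d_cond \<theta>_fin]) measurable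

  \<comment> \<open>At \<open>s = 0\<close> and \<open>s = 1\<close> only one of \<open>b\<close>,
    \<open>c\<close> remains, and monotonicity of conditional expectations suffices.\<close>
  have end_case: "AE w in ?M. nn_cond_exp \<theta> ?F (\<lambda>w. ennreal (f w)) w \<le> nn_cond_exp \<theta> ?F (\<lambda>w. ennreal (a w)) w"
    if f: "f \<in> borel_measurable ?M" and le: "AE w in \<nu>. f w \<le> a w" for f
  proof -
    have "AE w in ?M. nn_cond_exp ?M ?F (\<lambda>w. ennreal (f w) * ennreal (d w)) w \<le> nn_cond_exp ?M ?F (\<lambda>w. ennreal (a w) * ennreal (d w)) w"
    proof (rule E.nn_cond_exp_mono)
      have "AE w in ?M. f w \<le> a w" using le by (simp only: AE_completion_iff)
      then show "AE w in ?M. ennreal (f w) * ennreal (d w) \<le> ennreal (a w) * ennreal (d w)"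
        by eventually_elim (intro mult_right_mono ennreal_leI, auto)
    qed (use f in measurable)
    with cond_\<theta>[OF f] cond_\<theta>[OF meas(1)] show ?thesis by eventually_elim simp
  qed
  have zero_H: "path_zero \<in> H_b" unfolding path_zero_step[of 1] by (rule step_H_in_H_b)
  have H_norm_zero: "H_norm path_zero = 0"
    using H_norm_step[of 1 "\<lambda>_. 0"] unfolding path_zero_step[of 1, symmetric] by simp
  have conv_zero: "path_conv s path_zero path_zero = path_zero" for s
    by (auto simp: path_conv_def path_zero_def)
  have X_zero_pos: "AE w in \<nu>. X (\<lambda>_. path_zero) w = w \<and> w \<in> space \<nu>"
    using X_zero AE_space by eventually_elim (simp add: coord_process_def)

  show ?thesis
  proof
    fix s :: real assume s01: "s \<in> {0..1}"
    consider "s = 0" | "s = 1" | "0 < s" "s < 1" using s01 by fastforce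
    then show "AE w in \<nu>. nn_cond_exp \<theta> ?F (\<lambda>w. ennreal (a w)) w
      \<ge> ennreal_powr (nn_cond_exp \<theta> ?F (\<lambda>w. ennreal (b w)) w) s
        * ennreal_powr (nn_cond_exp \<theta> ?F (\<lambda>w. ennreal (c w)) w) (1 - s)"
    proof cases
      case 1
      \<comment> \<open>Zero drifts in the hypothesis: \<open>X\<close> at zero drift is the
        identity almost surely and all norms vanish. Positivity of \<open>b\<close> is what makes
        its power with exponent 0 equal to 1.\<close>
      have "AE w in \<nu>. c w \<le> a w"
        using prekopa[OF zero_H zero_H s01] X_zero_pos
        by eventually_elim (use pos in \<open>force simp: 1 conv_zero H_norm_zero less_imp_le\<close>)
      from end_case[OF meas(3) this] show ?thesis
        by (simp add: 1 AE_completion_iff)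
    next
      case 2
      have "AE w in \<nu>. b w \<le> a w"
        using prekopa[OF zero_H zero_H s01] X_zero_pos
        by eventually_elim (use pos in \<open>force simp: 2 conv_zero H_norm_zero less_imp_le\<close>)
      from end_case[OF meas(2) this] show ?thesis
        by (simp add: 2 AE_completion_iff)
    next
      case 3
      \<comment> \<open>Bounded functions are needed for the \<open>L^1\<close> argument;
        \<open>Suc N\<close> keeps the truncation level positive.\<close>
      let ?t = "\<lambda>f (N::nat) w. min (f w * d w) (real (Suc N))"
      have t_meas[measurable]: "?t f N \<in> borel_measurable ?M" if [measurable]: "f \<in> borel_measurable ?M" for f N
        by measurable
      have trunc: "AE w in ?M. real_cond_exp ?M ?F (?t b N) w powr s * real_cond_exp ?M ?F (?t c N) w powr (1 - s)
        \<le> real_cond_exp ?M ?F (?t a N) w" for N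
      proof (rule cond_exp_prekopa_leindler[OF 3, where K = "real (Suc N)"])
        fix m and y :: "nat \<times> 'n \<Rightarrow> real"
        let ?Q = "\<Sum>k\<in>{..<Suc m} \<times> UNIV. (y k)\<^sup>2"
        let ?h = "step_H (Suc m) (\<lambda>k. (1 - s) * y k)" and ?k = "step_H (Suc m) (\<lambda>k. - s * y k)"
        have nh: "(H_norm ?h)\<^sup>2 = (1 - s)\<^sup>2 * ?Q"
          by (simp add: H_norm_step power_mult_distrib sum_distrib_left del: sum.lessThan_Suc)
        have nk: "(H_norm ?k)\<^sup>2 = s\<^sup>2 * ?Q"
          by (simp add: H_norm_step power_mult_distrib sum_distrib_left del: sum.lessThan_Suc)
        have "AE w in \<nu>. (b (X (\<lambda>_. ?h) w) * exp (- 1/2 * ((1 - s)\<^sup>2 * ?Q))) powr s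
          * (c (X (\<lambda>_. ?k) w) * exp (- 1/2 * (s\<^sup>2 * ?Q))) powr (1 - s) \<le> a (X (\<lambda>_. path_zero) w)"
          using prekopa[OF step_H_in_H_b step_H_in_H_b s01, of "Suc m" "\<lambda>k. (1 - s) * y k" "Suc m" "\<lambda>k. - s * y k"]
          unfolding path_conv_step nh nk H_norm_zero by simp
        \<comment> \<open>Convexity for the same two shifts: their convex combination is zero, so
          the left-hand side becomes \<open>- log d\<close> at \<open>w\<close> itself.\<close>
        moreover have "AE w in \<nu>. neg_log (d (X (\<lambda>_. path_zero) w))
          \<le> ereal s * neg_log (d (X (\<lambda>_. ?h) w)) + ereal (1 - s) * neg_log (d (X (\<lambda>_. ?k) w))"
          using assms(13) s01 step_H_in_H_b[of "Suc m" "\<lambda>k. (1 - s) * y k"] step_H_in_H_b[of "Suc m" "\<lambda>k. - s * y k"]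
          unfolding as_convex_on_H_b_def path_conv_step[of s "Suc m" y, symmetric] by blast
        ultimately show "AE w in \<nu>. exp (- 1/2 * s * (1 - s) * ?Q)
          * (?t b N (X (\<lambda>_. ?h) w) powr s * ?t c N (X (\<lambda>_. ?k) w) powr (1 - s)) \<le> ?t a N w"
          using X_zero_pos
        proof eventually_elim
          case (elim w)
          let ?b = "b (X (\<lambda>_. ?h) w)" and ?c = "c (X (\<lambda>_. ?k) w)"
          let ?d = "d (X (\<lambda>_. ?h) w)" and ?d' = "d (X (\<lambda>_. ?k) w)"
          let ?e = "exp (- 1/2 * s * (1 - s) * ?Q)"
          have w: "w \<in> space \<nu>" and X0: "X (\<lambda>_. path_zero) w = w" using elim by auto
          have nn: "0 < ?b" "0 < ?c" "0 \<le> ?d" "0 \<le> ?d'" "0 < a w" "0 \<le> d w"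
            using pos d_nn w X_space by auto
          have dle: "?d powr s * ?d' powr (1 - s) \<le> d w"
            by (rule neg_log_convexD[OF 3]) (use elim nn in \<open>simp_all add: X0\<close>)
          \<comment> \<open>The coefficients add up by
            \<open>s (1 - s)\<^sup>2 + (1 - s) s\<^sup>2 = s (1 - s)\<close>.\<close>
          have expo: "- 1/2 * ((1 - s)\<^sup>2 * q) * s + - 1/2 * (s\<^sup>2 * q) * (1 - s) = - 1/2 * s * (1 - s) * q" for q :: real
            by (simp add: field_simps power2_eq_square)
          have "exp (- 1/2 * ((1 - s)\<^sup>2 * ?Q)) powr s * exp (- 1/2 * (s\<^sup>2 * ?Q)) powr (1 - s) = ?e"
            unfolding exp_powr_real exp_add[symmetric] by (rule arg_cong[where f = exp]) (rule expo)
          then have ale: "?e * (?b powr s * ?c powr (1 - s)) \<le> a w"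
            using elim(1) nn by (simp add: X0 powr_mult mult_ac del: sum.lessThan_Suc)
          have "?e * ((?b * ?d) powr s * (?c * ?d') powr (1 - s)) = (?e * (?b powr s * ?c powr (1 - s))) * (?d powr s * ?d' powr (1 - s))"
            using nn by (simp add: powr_mult mult_ac)
          also have "\<dots> \<le> a w * d w" using ale dle nn by (intro mult_mono) auto
          finally have *: "?e * ((?b * ?d) powr s * (?c * ?d') powr (1 - s)) \<le> a w * d w" .
          have "?e \<le> 1" using 3 by (simp add: sum_nonneg mult_nonneg_nonneg del: sum.lessThan_Suc)
          then show ?case
            by (intro powr_truncate_le[OF 3 _ _ _ _ _ *]) (use nn in auto)
        qed
      qed (use pos d_nn in \<open>auto intro!: mult_nonneg_nonneg simp: less_imp_le\<close>)
      have t_nn: "0 \<le> ?t f N w" if "\<forall>w\<in>space \<nu>. 0 < f w" "w \<in> space \<nu>" for f N w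
        using that d_nn[OF that(2)] by (simp add: less_imp_le)
      let ?G = "\<lambda>f (N::nat). nn_cond_exp ?M ?F (\<lambda>w. ennreal (?t f N w))"
      have real: "AE w in ?M. ?G f N w = ennreal (real_cond_exp ?M ?F (?t f N) w) \<and> 0 \<le> real_cond_exp ?M ?F (?t f N) w"
        if [measurable]: "f \<in> borel_measurable ?M" and f: "\<forall>w\<in>space \<nu>. 0 < f w" for f N
      proof (rule E.nn_cond_exp_eq_real)
        show "integrable ?M (?t f N)"
        proof (rule SB.integrable_const_bound[where B = "real (Suc N)"])
          show "AE w in ?M. norm (?t f N w) \<le> real (Suc N)"
          proof (rule AE_I2)
            fix w assume "w \<in> space ?M"
            then have "0 \<le> ?t f N w" by (intro t_nn f) auto
            then show "norm (?t f N w) \<le> real (Suc N)" by simp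
          qed
        qed measurable
      qed (rule t_nn, use f in auto)
      \<comment> \<open>The side of \<open>a\<close> is enlarged to the untruncated product at once,
        so that the limit in \<open>N\<close> concerns only \<open>b\<close> and
        \<open>c\<close>.\<close>
      have a_le: "AE w in ?M. ?G a N w \<le> nn_cond_exp ?M ?F (\<lambda>w. ennreal (a w) * ennreal (d w)) w" for N
        by (rule E.nn_cond_exp_mono) (use pos d_nn in \<open>auto intro!: AE_I2 ennreal_leI simp: ennreal_mult''[symmetric]\<close>)
      have le: "AE w in ?M. ennreal_powr (?G b N w) s * ennreal_powr (?G c N w) (1 - s)
        \<le> nn_cond_exp ?M ?F (\<lambda>w. ennreal (a w) * ennreal (d w)) w" for N
        using trunc[of N] real[OF meas(1) pos'(1), of N] real[OF meas(2) pos'(2), of N] real[OF meas(3) pos'(3), of N] a_le[of N]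
      proof eventually_elim
        case (elim w)
        have "ennreal_powr (?G b N w) s * ennreal_powr (?G c N w) (1 - s)
          = ennreal (real_cond_exp ?M ?F (?t b N) w powr s * real_cond_exp ?M ?F (?t c N) w powr (1 - s))"
          using elim 3 by (simp add: ennreal_powr_def ennreal_mult)
        also have "\<dots> \<le> ?G a N w" using elim by (simp add: ennreal_leI)
        finally show ?case using elim by simp
      qed
      \<comment> \<open>The truncated products increase to the full ones, for which no integrability
        is assumed.\<close>
      have sup: "AE w in ?M. nn_cond_exp ?M ?F (\<lambda>w. ennreal (f w) * ennreal (d w)) w = (SUP N. ?G f N w) \<and> incseq (\<lambda>N. ?G f N w)"
        if [measurable]: "f \<in> borel_measurable ?M" and f: "\<forall>w\<in>space \<nu>. 0 < f w" for f
      proof -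
        have "(SUP N. ennreal (?t f N w)) = ennreal (f w) * ennreal (d w)" if w: "w \<in> space \<nu>" for w
        proof -
          have z: "ennreal (f w) * ennreal (d w) = ennreal (f w * d w)" using w d_nn[OF w] by (simp add: ennreal_mult'')
          obtain N where N: "f w * d w \<le> real N" using real_arch_simple by blast
          show ?thesis unfolding z
          proof (rule antisym)
            show "(SUP N. ennreal (?t f N w)) \<le> ennreal (f w * d w)" by (intro SUP_least ennreal_leI) simp
            show "ennreal (f w * d w) \<le> (SUP N. ennreal (?t f N w))"
              by (rule SUP_upper2[of N]) (use N in auto)
          qed
        qed
        then have "AE w in ?M. nn_cond_exp ?M ?F (\<lambda>w. SUP N. ennreal (?t f N w)) w = nn_cond_exp ?M ?F (\<lambda>w. ennreal (f w) * ennreal (d w)) w"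
          by (intro E.nn_cond_exp_cong) (auto intro!: AE_I2)
        moreover have "AE w in ?M. nn_cond_exp ?M ?F (\<lambda>w. SUP N. ennreal (?t f N w)) w = (SUP N. ?G f N w) \<and> incseq (\<lambda>N. ?G f N w)"
          by (rule E.nn_cond_exp_SUP) (measurable, intro ennreal_leI min.mono, auto)
        ultimately show ?thesis by eventually_elim simp
      qed
      have "AE w in ?M. \<forall>N. ennreal_powr (?G b N w) s * ennreal_powr (?G c N w) (1 - s)
        \<le> nn_cond_exp ?M ?F (\<lambda>w. ennreal (a w) * ennreal (d w)) w"
        unfolding AE_all_countable using le by blast
      then have "AE w in ?M. nn_cond_exp \<theta> ?F (\<lambda>w. ennreal (a w)) w
        \<ge> ennreal_powr (nn_cond_exp \<theta> ?F (\<lambda>w. ennreal (b w)) w) s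
        * ennreal_powr (nn_cond_exp \<theta> ?F (\<lambda>w. ennreal (c w)) w) (1 - s)"
        using sup[OF meas(2) pos'(2)] sup[OF meas(3) pos'(3)] cond_\<theta>[OF meas(1)] cond_\<theta>[OF meas(2)] cond_\<theta>[OF meas(3)]
      proof eventually_elim
        case (elim w)
        then show ?case
          using ennreal_powr_mult_le_SUP[OF _ _ 3, of "\<lambda>N. ?G b N w" "\<lambda>N. ?G c N w"] by simp
      qed
      then show ?thesis by (simp only: AE_completion_iff)
    qed
  qed
qed

end
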